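(* Let $\alpha>-1/2$ and $a,b>0$. Then there exists $\varepsilon_0>0$ such that, if $0<\varepsilon<\varepsilon_0$ and if $S,\Sigma\subset\mathbb{R}^+$ are subsets of the form $$S=S_0\cup S_\infty,\qquad \Sigma=\Sigma_0\cup\Sigma_\infty,$$ where $S_0=[0,a]$, $\Sigma_0=[0,b]$, and $S_\infty\subset[a,\infty)$, $\Sigma_\infty\subset[b,\infty)$ are $(\varepsilon,\alpha)$-thin, then $$\|F_\Sigma E_S\|<1.$$ In particular, $(S,\Sigma)$ is a strong annihilating pair.
   Context: Here $\mathbb{R}^+=[0,\infty)$. For $\alpha>-1/2$, let $d\mu_\alpha(x)=\frac{2\pi^{\alpha+1}}{\Gamma(\alpha+1)}x^{2\alpha+1}\,dx$ on $\mathbb{R}^+$. For $1\le p<\infty$, $L^p_\alpha(\mathbb{R}^+)$ is the space of (complex-valued) measurable functions on $\mathbb{R}^+$ with $\|f\|_{L^p_\alpha}=\left(\int_0^\infty|f|^p\,d\mu_\alpha\right)^{1/p}<\infty$; for measurable $A\subset\mathbb{R}^+$, $\|f\|^2_{L^2_\alpha(A)}=\int_A|f|^2\,d\mu_\alpha$, and $A^c=\mathbb{R}^+\setminus A$. The Fourier-Bessel (Hankel) transform of $f\in L^1_\alpha(\mathbb{R}^+)$ is $\mathcal{F}_\alpha(f)(y)=\int_0^\infty f(x)\,j_\alpha(2\pi xy)\,d\mu_\alpha(x)$, where $j_\alpha(x)=\Gamma(\alpha+1)\sum_{n=0}^\infty\frac{(-1)^n}{n!\,\Gamma(n+\alpha+1)}\left(\frac{x}{2}\right)^{2n}$.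 It extends from $L^1_\alpha\cap L^2_\alpha$ to an isometry of $L^2_\alpha(\mathbb{R}^+)$, still denoted $\mathcal{F}_\alpha$. For measurable $S,\Sigma\subset\mathbb{R}^+$, define the orthogonal projections on $L^2_\alpha(\mathbb{R}^+)$: $E_Sf=\chi_Sf$ (with $\chi_S$ the indicator function of $S$) and $F_\Sigma f=\mathcal{F}_\alpha\big[E_\Sigma\mathcal{F}_\alpha(f)\big]$. The norm $\|F_\Sigma E_S\|$ is the operator norm on $L^2_\alpha(\mathbb{R}^+)$. For $\varepsilon\in(0,1)$, a (measurable) set $S\subset\mathbb{R}^+$ is $(\varepsilon,\alpha)$-thin if, for $0\leq x\leq1$, $\mu_\alpha(S\cap[x,x+1])\leq\varepsilon\,\mu_\alpha([x,x+1])$, and, for $x\geq1$, $\mu_\alpha\left(S\cap\left[x,x+\frac1x\right]\right)\leq\varepsilon\,\mu_\alpha\left(\left[x,x+\frac1x\right]\right)$. A pair $(S,\Sigma)$ of measurable subsets of $\mathbb{R}^+$ is a strong annihilating pair if there exists a constant $C_\alpha(S,\Sigma)$ such that for every $f\in L^2_\alpha(\mathbb{R}^+)$, $\|f\|^2_{L^2_\alpha}\leq C_\alpha(S,\Sigma)\left(\|f\|^2_{L^2_\alpha(S^c)}+\|\mathcal{F}_\alpha(f)\|^2_{L^2_\alpha(\Sigma^c)}\right)$. *)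

theory Defs
  imports "HOL-Analysis.Analysis"
begin

text \<open>The half-line carries its Lebesgue (not only Borel) measurable sets, so
  \<open>A \<in> sets (mu \<alpha>)\<close> says that \<open>A\<close> is a measurable subset of \<open>{0..}\<close>.\<close>

definition mu :: "real \<Rightarrow> real measure" where
  "mu \<alpha> = density (lebesgue_on {0..})
     (\<lambda>x. ennreal (2 * pi powr (\<alpha> + 1) / Gamma (\<alpha> + 1) * x powr (2 * \<alpha> + 1)))"

text \<open>Elements of the Lebesgue spaces are represented by functions, not by classes of
  functions modulo null sets. Norms take values in \<^typ>\<open>ennreal\<close>, so that a function
  outside the space has norm \<open>\<infinity>\<close>.\<close>

definition L1 :: "real \<Rightarrow> (real \<Rightarrow> complex) set" where
  "L1 \<alpha> = {f. integrable (mu \<alpha>) f}"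

definition l2_norm_sq_on :: "real \<Rightarrow> real set \<Rightarrow> (real \<Rightarrow> complex) \<Rightarrow> ennreal" where
  "l2_norm_sq_on \<alpha> A f = (\<integral>\<^sup>+x\<in>A. ennreal ((cmod (f x))\<^sup>2) \<partial>mu \<alpha>)"

definition l2_norm :: "real \<Rightarrow> (real \<Rightarrow> complex) \<Rightarrow> ennreal" where
  "l2_norm \<alpha> f =
     (let I = l2_norm_sq_on \<alpha> {0..} f
      in if I = \<infinity> then \<infinity> else ennreal (sqrt (enn2real I)))"

definition L2 :: "real \<Rightarrow> (real \<Rightarrow> complex) set" where
  "L2 \<alpha> = {f \<in> borel_measurable (mu \<alpha>). l2_norm \<alpha> f < \<infinity>}"

definition bessel_j :: "real \<Rightarrow> real \<Rightarrow> real" where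
  "bessel_j \<alpha> x =
     Gamma (\<alpha> + 1) * (\<Sum>n. (-1) ^ n / (fact n * Gamma (real n + \<alpha> + 1)) * (x / 2) ^ (2 * n))"

definition hankel_L1 :: "real \<Rightarrow> (real \<Rightarrow> complex) \<Rightarrow> real \<Rightarrow> complex" where
  "hankel_L1 \<alpha> f y = (LINT x|mu \<alpha>. f x * complex_of_real (bessel_j \<alpha> (2 * pi * x * y)))"

text \<open>The extension by continuity of \<^const>\<open>hankel_L1\<close> from \<open>L1 \<alpha> \<inter> L2 \<alpha>\<close> to \<open>L2 \<alpha>\<close>:
  the value at \<open>f\<close> is the \<open>L2\<close> limit of the transforms of functions that approximate \<open>f\<close>.
  This limit is determined only up to null sets, and the choice operator selects a representative.\<close>

definition is_hankel_L2 :: "real \<Rightarrow> (real \<Rightarrow> complex) \<Rightarrow> (real \<Rightarrow> complex) \<Rightarrow> bool" where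
  "is_hankel_L2 \<alpha> f g \<longleftrightarrow> g \<in> L2 \<alpha> \<and>
     (\<exists>u. (\<forall>n::nat. u n \<in> L1 \<alpha> \<inter> L2 \<alpha>) \<and>
          (\<lambda>n. l2_norm \<alpha> (\<lambda>x. u n x - f x)) \<longlonglongrightarrow> 0 \<and>
          (\<lambda>n. l2_norm \<alpha> (\<lambda>y. hankel_L1 \<alpha> (u n) y - g y)) \<longlonglongrightarrow> 0)"

definition hankel :: "real \<Rightarrow> (real \<Rightarrow> complex) \<Rightarrow> real \<Rightarrow> complex" where
  "hankel \<alpha> f = (SOME g. is_hankel_L2 \<alpha> f g)"

definition E_proj :: "real set \<Rightarrow> (real \<Rightarrow> complex) \<Rightarrow> real \<Rightarrow> complex" where
  "E_proj S f = (\<lambda>x. indicator S x * f x)"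

definition F_proj :: "real \<Rightarrow> real set \<Rightarrow> (real \<Rightarrow> complex) \<Rightarrow> real \<Rightarrow> complex" where
  "F_proj \<alpha> \<Sigma> f = hankel \<alpha> (E_proj \<Sigma> (hankel \<alpha> f))"

definition op_norm :: "real \<Rightarrow> ((real \<Rightarrow> complex) \<Rightarrow> (real \<Rightarrow> complex)) \<Rightarrow> ennreal" where
  "op_norm \<alpha> T = (SUP f \<in> {f \<in> L2 \<alpha>. l2_norm \<alpha> f \<le> 1}. l2_norm \<alpha> (T f))"

definition thin :: "real \<Rightarrow> real \<Rightarrow> real set \<Rightarrow> bool" where
  "thin \<epsilon> \<alpha> S \<longleftrightarrow> 0 < \<epsilon> \<and> \<epsilon> < 1 \<and> S \<in> sets (mu \<alpha>) \<and>
     (\<forall>x. 0 \<le> x \<and> x \<le> 1 \<longrightarrow>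
        emeasure (mu \<alpha>) (S \<inter> {x..x+1}) \<le> ennreal \<epsilon> * emeasure (mu \<alpha>) {x..x+1}) \<and>
     (\<forall>x\<ge>1. emeasure (mu \<alpha>) (S \<inter> {x..x+1/x}) \<le> ennreal \<epsilon> * emeasure (mu \<alpha>) {x..x+1/x})"

definition strong_annihilating :: "real \<Rightarrow> real set \<Rightarrow> real set \<Rightarrow> bool" where
  "strong_annihilating \<alpha> S \<Sigma> \<longleftrightarrow> S \<in> sets (mu \<alpha>) \<and> \<Sigma> \<in> sets (mu \<alpha>) \<and>
     (\<exists>C::real. \<forall>f\<in>L2 \<alpha>.
        (l2_norm \<alpha> f)\<^sup>2 \<le> ennreal C *
          (l2_norm_sq_on \<alpha> ({0..} - S) f + l2_norm_sq_on \<alpha> ({0..} - \<Sigma>) (hankel \<alpha> f)))"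

end

theory Submission
  imports Defs "HOL-Complex_Analysis.Complex_Analysis"
begin

text \<open>Write \<open>H\<close> for the Hankel transform, \<open>S\<close> for the union of \<open>[0,a]\<close> and a thin set, and \<open>\<Sigma>\<close> for the union of
  \<open>[0,b]\<close> and a thin set. Both conclusions follow from one estimate: there is \<open>c < 1\<close> such that the norm
  of \<open>H f\<close> over \<open>\<Sigma>\<close> is at most \<open>c\<close> times the norm of \<open>f\<close>, for all \<open>f\<close> supported in \<open>S\<close> (\<open>localization_L1_L2\<close>). The operator norm is then
  at most \<open>c\<close> because \<open>H\<close> is an isometry, and the annihilation inequality follows by splitting \<open>f\<close> and \<open>H f\<close>
  along \<open>S\<close> and \<open>\<Sigma>\<close>.

  To prove the estimate, split \<open>f\<close> along \<open>[0,a]\<close> and its complement, and \<open>H f\<close> along \<open>[0,b]\<close> and its complement.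

  The part between the two intervals is a strict contraction whose norm depends on \<open>a\<close> and \<open>b\<close> only
  (\<open>strict_contraction_bounded\<close>). Otherwise there are unit vectors supported in \<open>[0,a]\<close> whose transforms lose
  all mass outside \<open>[0,b]\<close>. These transforms extend to entire functions that are locally uniformly bounded, so by
  Montel's theorem a subsequence converges; the limit vanishes on an interval beyond \<open>b\<close>, hence everywhere,
  although it must carry unit mass on \<open>[0,b]\<close>.

  Every other part has a thin set on one side, and its norm tends to zero with the thinness (\<open>small_form\<close>). With
  \<open>q = 2 + x\<^sup>2 + \<xi>\<^sup>2\<close>, the identity \<open>1 = exp (- \<pi> T q) + \<integral>\<^sub>0\<^sup>T \<pi> q exp (- \<pi> s q) ds\<close> and
  \<open>q = (1 + x\<^sup>2) + (1 + \<xi>\<^sup>2)\<close> cut the bilinear form of \<open>H\<close> into a remainder and two pieces that exchange the roles of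
  \<open>x\<close> and \<open>\<xi>\<close>. In the piece with \<open>1 + x\<^sup>2\<close> the factor \<open>exp (- \<pi> s \<xi>\<^sup>2)\<close> is a Gaussian multiplier, so it turns into
  the heat kernel of the Bessel operator, which is positive and explicit; no cancellation is needed from here on
  and Schur's test applies (\<open>young_schur\<close>). Times \<open>s\<close> below \<open>\<eta> / (1 + x\<^sup>2)\<close> contribute rows of mass at most \<open>\<pi> \<eta>\<close>. For later
  times the heat kernel satisfies a Harnack inequality at the scale \<open>1/x\<close> (\<open>heat_harnack\<close>). This is the scale
  of the windows in the definition of thinness, so columns restricted to a thin set are small
  (\<open>thin_cover\<close>). On a bounded interval there are no later times once \<open>T\<close> is small. The remainder is a heat kernel
  at the fixed time \<open>T\<close> and is treated in the same way.

  The heat kernel is computed with Weber's integral (\<open>weber_integral\<close>). The same formula yields the Plancherel theorem: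
  damping by a Gaussian shows that \<open>H\<close> is a contraction, and \<open>H\<close> inverts itself on combinations of Gaussians,
  which are dense. The bounds on the Bessel function come from an energy of its differential equation that decreases
  because \<open>2 \<alpha> + 1 > 0\<close> (\<open>bes_energy\<close>).\<close>

section \<open>The Bessel function as a power series\<close>

definition bes_coeff :: "real \<Rightarrow> nat \<Rightarrow> real" where
  "bes_coeff \<alpha> n = (-1) ^ n / (fact n * pochhammer (\<alpha> + 1) n)"

text \<open>The hypergeometric function \<open>\<^sub>0F\<^sub>1(; \<alpha> + 1; - z)\<close>. In this variable one power series serves both the Bessel function
  \<open>j(x) = bes \<alpha> (x\<^sup>2/4)\<close> and the modified Bessel function \<open>I(x) = bes \<alpha> (- x\<^sup>2/4)\<close>.\<close>

definition bes :: "real \<Rightarrow> real \<Rightarrow> real" where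
  "bes \<alpha> z = (\<Sum>n. bes_coeff \<alpha> n * z ^ n)"

lemma pochhammer_lower:
  fixes c :: real assumes "c > 1/2" shows "pochhammer c n \<ge> (1/2) ^ n"
proof (induction n)
  case (Suc n)
  have "pochhammer c n * (c + real n) \<ge> (1/2)^n * (1/2)"
    using Suc assms by (intro mult_mono order_trans[OF _ Suc]) auto
  thus ?case by (simp add: pochhammer_Suc)
qed simp

lemma pochhammer_pos_half:
  fixes c :: real assumes "c > 1/2" shows "pochhammer c n > 0"
  using assms by (intro pochhammer_pos) auto

lemma bes_coeff_bound:
  assumes "\<alpha> > -1/2" shows "\<bar>bes_coeff \<alpha> n\<bar> \<le> 2 ^ n / fact n"
proof -
  have p: "pochhammer (\<alpha>+1) n \<ge> (1/2)^n" using pochhammer_lower[of "\<alpha>+1" n] assms by simp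
  have "\<bar>bes_coeff \<alpha> n\<bar> = 1 / (fact n * pochhammer (\<alpha> + 1) n)"
    using pochhammer_pos_half[of "\<alpha>+1" n] assms by (simp add: bes_coeff_def abs_mult)
  also have "\<dots> \<le> 1 / (fact n * (1/2)^n)"
    using p pochhammer_pos_half[of "\<alpha>+1" n] assms
    by (intro divide_left_mono mult_left_mono mult_pos_pos) auto
  finally show ?thesis by (simp add: field_simps)
qed

lemma bes_summable_abs:
  assumes "\<alpha> > -1/2" shows "summable (\<lambda>n. \<bar>bes_coeff \<alpha> n * z ^ n\<bar>)"
proof (rule summable_comparison_test)
  show "summable (\<lambda>n. (2 * \<bar>z\<bar>) ^ n / fact n)"
    using summable_exp[of "2 * \<bar>z\<bar>"] by (simp add: field_simps)
  show "\<exists>N. \<forall>n\<ge>N. norm \<bar>bes_coeff \<alpha> n * z ^ n\<bar> \<le> (2 * \<bar>z\<bar>) ^ n / fact n"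
    using mult_right_mono[OF bes_coeff_bound[OF assms], of "\<bar>z\<bar> ^ n" for n]
    by (auto simp: abs_mult power_abs power_mult_distrib)
qed

lemma bes_summable: "\<alpha> > -1/2 \<Longrightarrow> summable (\<lambda>n. bes_coeff \<alpha> n * z ^ n)"
  by (rule summable_rabs_cancel[OF bes_summable_abs])

lemma bes_coeff_Suc:
  assumes "\<alpha> > -1/2"
  shows "(\<alpha> + 1 + real n) * (real (Suc n) * bes_coeff \<alpha> (Suc n)) = - bes_coeff \<alpha> n"
proof -
  have p: "pochhammer (\<alpha>+1) n \<noteq> 0" using pochhammer_pos_half[of "\<alpha>+1" n] assms by simp
  have c: "\<alpha> + 1 + real n \<noteq> 0" using assms by simp
  have "real (Suc n) * bes_coeff \<alpha> (Suc n) = - bes_coeff \<alpha> n / (\<alpha> + 1 + real n)"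
    unfolding bes_coeff_def pochhammer_Suc fact_Suc using p c
    by (simp add: divide_simps del: of_nat_Suc)
  thus ?thesis using c by (simp del: of_nat_Suc)
qed

definition bes_deriv :: "real \<Rightarrow> real \<Rightarrow> real" where
  "bes_deriv \<alpha> z = (\<Sum>n. diffs (bes_coeff \<alpha>) n * z ^ n)"

lemma diffs_summable: "\<alpha> > -1/2 \<Longrightarrow> summable (\<lambda>n. diffs (bes_coeff \<alpha>) n * z ^ n)"
  by (rule termdiff_converges_all) (rule bes_summable)

lemma diffs2_summable: "\<alpha> > -1/2 \<Longrightarrow> summable (\<lambda>n. diffs (diffs (bes_coeff \<alpha>)) n * z ^ n)"
  by (rule termdiff_converges_all) (rule diffs_summable)

lemma DERIV_bes: "\<alpha> > -1/2 \<Longrightarrow> (bes \<alpha> has_real_derivative bes_deriv \<alpha> z) (at z)"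
  unfolding bes_def[abs_def] bes_deriv_def by (rule termdiffs_strong_converges_everywhere) (rule bes_summable)

lemma DERIV_bes_deriv:
  "\<alpha> > -1/2 \<Longrightarrow> (bes_deriv \<alpha> has_real_derivative (\<Sum>n. diffs (diffs (bes_coeff \<alpha>)) n * z ^ n)) (at z)"
  unfolding bes_deriv_def[abs_def] by (rule termdiffs_strong_converges_everywhere) (rule diffs_summable)

lemma bes_ode:
  assumes a: "\<alpha> > -1/2"
  shows "z * (\<Sum>n. diffs (diffs (bes_coeff \<alpha>)) n * z ^ n) + (\<alpha> + 1) * bes_deriv \<alpha> z + bes \<alpha> z = 0"
proof -
  let ?c = "bes_coeff \<alpha>"
  have "(\<lambda>n. real n * diffs ?c n * z ^ (n - Suc 0)) sums (\<Sum>n. diffs (diffs ?c) n * z ^ n)"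
    using diffs_equiv[OF diffs2_summable[OF a]] by simp
  hence "(\<lambda>n. z * (real n * diffs ?c n * z ^ (n - Suc 0))) sums (z * (\<Sum>n. diffs (diffs ?c) n * z ^ n))"
    by (rule sums_mult)
  moreover have "z * (real n * diffs ?c n * z ^ (n - Suc 0)) = real n * diffs ?c n * z ^ n" for n
    by (cases n) auto
  ultimately have 1: "(\<lambda>n. real n * diffs ?c n * z ^ n) sums (z * (\<Sum>n. diffs (diffs ?c) n * z ^ n))"
    by simp
  have 2: "(\<lambda>n. (\<alpha>+1) * (diffs ?c n * z ^ n)) sums ((\<alpha>+1) * bes_deriv \<alpha> z)"
    unfolding bes_deriv_def by (intro sums_mult summable_sums diffs_summable a)
  have 3: "(\<lambda>n. ?c n * z ^ n) sums bes \<alpha> z"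
    unfolding bes_def by (intro summable_sums bes_summable a)
  have "real n * diffs ?c n * z ^ n + (\<alpha>+1) * (diffs ?c n * z ^ n) + ?c n * z ^ n = 0" for n
  proof -
    have "real n * diffs ?c n * z ^ n + (\<alpha>+1) * (diffs ?c n * z ^ n) + ?c n * z ^ n
        = ((\<alpha> + 1 + real n) * (real (Suc n) * ?c (Suc n)) + ?c n) * z ^ n"
      by (simp add: diffs_def algebra_simps)
    thus ?thesis using bes_coeff_Suc[OF a, of n] by simp
  qed
  hence "(\<lambda>n. 0::real) sums (z * (\<Sum>n. diffs (diffs ?c) n * z ^ n) + (\<alpha> + 1) * bes_deriv \<alpha> z + bes \<alpha> z)"
    using sums_add[OF sums_add[OF 1 2] 3] by simp
  thus ?thesis using sums_unique2 sums_zero by blast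
qed

lemma bes_0 [simp]: "bes \<alpha> 0 = 1"
  unfolding bes_def by (subst powser_zero) (simp add: bes_coeff_def)

text \<open>The function \<open>f(x) = bes \<alpha> (\<kappa> x\<^sup>2/4)\<close> solves \<open>f'' + (2 \<alpha> + 1)/x f' + \<kappa> f = 0\<close>. The derivative of \<open>\<kappa> f\<^sup>2 + f'\<^sup>2\<close> is therefore
  \<open>- 2 (2 \<alpha> + 1) f'\<^sup>2 / x \<le> 0\<close>, and the energy never exceeds its initial value \<open>\<kappa>\<close>. For \<open>\<kappa> = 1\<close> this bounds the Bessel
  function, for \<open>\<kappa> = -1\<close> the logarithmic derivative of the modified one.\<close>

lemma bes_energy:
  assumes a: "\<alpha> > -1/2" and "x \<ge> 0"
  shows "\<kappa> * (bes \<alpha> (\<kappa> * x\<^sup>2 / 4))\<^sup>2 + \<kappa>\<^sup>2 * x\<^sup>2 / 4 * (bes_deriv \<alpha> (\<kappa> * x\<^sup>2 / 4))\<^sup>2 \<le> \<kappa>"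
proof -
  define E where "E = (\<lambda>x. \<kappa> * (bes \<alpha> (\<kappa> * x\<^sup>2 / 4))\<^sup>2 + \<kappa>\<^sup>2 * x\<^sup>2 / 4 * (bes_deriv \<alpha> (\<kappa> * x\<^sup>2 / 4))\<^sup>2)"
  have "E x \<le> E 0"
  proof (rule DERIV_nonpos_imp_nonincreasing[OF \<open>x \<ge> 0\<close>])
    fix t assume t: "0 \<le> t" "t \<le> x"
    define z where "z = \<kappa> * t\<^sup>2 / 4"
    define D where "D = (\<Sum>n. diffs (diffs (bes_coeff \<alpha>)) n * z ^ n)"
    note [derivative_intros] = DERIV_chain2[OF DERIV_bes[OF a]] DERIV_chain2[OF DERIV_bes_deriv[OF a]]
    have "(E has_real_derivative
        (\<kappa> * (2 * bes \<alpha> z * (bes_deriv \<alpha> z * (\<kappa> * t / 2))) +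
         (\<kappa>\<^sup>2 * t / 2 * (bes_deriv \<alpha> z)\<^sup>2 + \<kappa>\<^sup>2 * t\<^sup>2 / 4 * (2 * bes_deriv \<alpha> z * (D * (\<kappa> * t / 2)))))) (at t)"
      unfolding E_def D_def z_def
      by (rule derivative_eq_intros refl | simp)+ (simp add: field_simps power2_eq_square)
    also have "(\<kappa> * (2 * bes \<alpha> z * (bes_deriv \<alpha> z * (\<kappa> * t / 2))) +
         (\<kappa>\<^sup>2 * t / 2 * (bes_deriv \<alpha> z)\<^sup>2 + \<kappa>\<^sup>2 * t\<^sup>2 / 4 * (2 * bes_deriv \<alpha> z * (D * (\<kappa> * t / 2)))))
        = \<kappa>\<^sup>2 * t * bes_deriv \<alpha> z * ((z * D + (\<alpha>+1) * bes_deriv \<alpha> z + bes \<alpha> z) - (\<alpha> + 1/2) * bes_deriv \<alpha> z)"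
      unfolding z_def by (simp add: field_simps power2_eq_square)
    also have "\<dots> = - (\<kappa>\<^sup>2 * t * (\<alpha> + 1/2) * (bes_deriv \<alpha> z)\<^sup>2)"
      using bes_ode[OF a, of z] by (simp add: D_def power2_eq_square)
    finally have "(E has_real_derivative - (\<kappa>\<^sup>2 * t * (\<alpha> + 1/2) * (bes_deriv \<alpha> z)\<^sup>2)) (at t)" .
    moreover have "- (\<kappa>\<^sup>2 * t * (\<alpha> + 1/2) * (bes_deriv \<alpha> z)\<^sup>2) \<le> 0" using t a by simp
    ultimately show "\<exists>y. (E has_real_derivative y) (at t) \<and> y \<le> 0" by blast
  qed
  also have "E 0 = \<kappa>" by (simp add: E_def)
  finally show ?thesis unfolding E_def .
qed

lemma bes_abs_le_1:
  assumes "\<alpha> > -1/2" "z \<ge> 0" shows "\<bar>bes \<alpha> z\<bar> \<le> 1"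
proof -
  have "(2 * sqrt z)\<^sup>2 = 4 * z" using assms by (simp add: power_mult_distrib)
  hence "(bes \<alpha> z)\<^sup>2 + z * (bes_deriv \<alpha> z)\<^sup>2 \<le> 1"
    using bes_energy[OF assms(1), of "2 * sqrt z" 1] assms(2) by simp
  moreover have "z * (bes_deriv \<alpha> z)\<^sup>2 \<ge> 0" using assms by simp
  ultimately have "(bes \<alpha> z)\<^sup>2 \<le> 1" by linarith
  thus ?thesis by (simp add: abs_square_le_1)
qed

lemma bes_neg_sums:
  assumes a: "\<alpha> > -1/2"
  shows "(\<lambda>n. z ^ n / (fact n * pochhammer (\<alpha>+1) n)) sums bes \<alpha> (-z)"
proof -
  have "(\<lambda>n. bes_coeff \<alpha> n * (-z) ^ n) sums bes \<alpha> (-z)"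
    unfolding bes_def by (intro summable_sums bes_summable a)
  moreover have "bes_coeff \<alpha> n * (-z) ^ n = z ^ n / (fact n * pochhammer (\<alpha>+1) n)" for n
    by (simp add: bes_coeff_def flip: power_mult_distrib)
  ultimately show ?thesis by simp
qed

lemma bes_neg_mono:
  assumes a: "\<alpha> > -1/2" and "0 \<le> x" "x \<le> y" shows "bes \<alpha> (-x) \<le> bes \<alpha> (-y)"
  by (rule sums_le[OF _ bes_neg_sums[OF a] bes_neg_sums[OF a]])
     (use assms in \<open>auto intro!: divide_right_mono power_mono mult_nonneg_nonneg less_imp_le[OF pochhammer_pos_half]\<close>)

lemma bes_neg_ge_1: "\<alpha> > -1/2 \<Longrightarrow> 0 \<le> x \<Longrightarrow> 1 \<le> bes \<alpha> (-x)"
  using bes_neg_mono[of \<alpha> 0 x] by simp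

text \<open>The energy with \<open>\<kappa> = -1\<close> gives \<open>\<bar>I'\<bar> \<le> I\<close>, so \<open>exp (- x) I(x)\<close> decreases.\<close>

lemma bes_neg_growth:
  assumes a: "\<alpha> > -1/2" and xy: "0 \<le> x" "x \<le> y"
  shows "bes \<alpha> (-(y\<^sup>2/4)) \<le> exp (y - x) * bes \<alpha> (-(x\<^sup>2/4))"
proof -
  define g where "g = (\<lambda>x. exp (-x) * bes \<alpha> (-(x\<^sup>2/4)))"
  have "g y \<le> g x"
  proof (rule DERIV_nonpos_imp_nonincreasing[OF xy(2)])
    fix t assume t: "x \<le> t" "t \<le> y"
    let ?F = "bes \<alpha> (-(t\<^sup>2/4))" and ?F' = "bes_deriv \<alpha> (-(t\<^sup>2/4))"
    have t0: "t \<ge> 0" using t xy by simp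
    note [derivative_intros] = DERIV_chain2[OF DERIV_bes[OF a]]
    have "(g has_real_derivative exp (-t) * (- (t/2 * ?F') - ?F)) (at t)"
      unfolding g_def by (rule derivative_eq_intros refl | simp)+ (simp add: field_simps)
    moreover have "(t/2 * ?F')\<^sup>2 \<le> ?F\<^sup>2"
      using bes_energy[OF a t0, of "-1"] by (simp add: power_mult_distrib power_divide)
    hence "\<bar>t/2 * ?F'\<bar> \<le> ?F" using bes_neg_ge_1[OF a, of "t\<^sup>2/4"] by (simp add: abs_le_square_iff[symmetric])
    hence "exp (-t) * (- (t/2 * ?F') - ?F) \<le> 0" by (intro mult_nonneg_nonpos) auto
    ultimately show "\<exists>y. (g has_real_derivative y) (at t) \<and> y \<le> 0" by blast
  qed
  hence "exp y * (exp (-y) * bes \<alpha> (-(y\<^sup>2/4))) \<le> exp y * (exp (-x) * bes \<alpha> (-(x\<^sup>2/4)))"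
    unfolding g_def by (intro mult_left_mono) auto
  thus ?thesis by (simp add: exp_diff exp_minus field_simps)
qed

lemma continuous_on_bes [continuous_intros]:
  "\<alpha> > -1/2 \<Longrightarrow> continuous_on S f \<Longrightarrow> continuous_on S (\<lambda>x. bes \<alpha> (f x))"
proof -
  assume a: "\<alpha> > -1/2" and f: "continuous_on S f"
  have "continuous_on UNIV (bes \<alpha>)" 
    by (intro continuous_at_imp_continuous_on ballI DERIV_isCont[OF DERIV_bes[OF a]])
  thus ?thesis using continuous_on_compose2[OF _ f] by blast
qed

lemma bes_measurable [measurable]: "\<alpha> > -1/2 \<Longrightarrow> bes \<alpha> \<in> borel_measurable borel"
  by (intro borel_measurable_continuous_onI continuous_on_bes) auto

lemma bessel_j_eq:
  assumes a: "\<alpha> > -1/2" shows "bessel_j \<alpha> x = bes \<alpha> (x\<^sup>2/4)"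
proof -
  have G: "Gamma (\<alpha>+1) > 0" using a by (intro Gamma_real_pos) auto
  have "Gamma (real n + \<alpha> + 1) = pochhammer (\<alpha>+1) n * Gamma (\<alpha>+1)" for n
  proof -
    have nz: "\<alpha> + 1 \<notin> \<int>\<^sub>\<le>\<^sub>0" using a nonpos_Ints_nonpos[of "\<alpha>+1"] by auto
    have "real n + \<alpha> + 1 = \<alpha> + 1 + real n" by simp
    thus ?thesis using pochhammer_Gamma[OF nz, of n] G by (simp only: field_simps)
  qed
  note Gm = this
  have eq: "(-1) ^ n / (fact n * Gamma (real n + \<alpha> + 1)) * (x / 2) ^ (2 * n) = inverse (Gamma (\<alpha>+1)) * (bes_coeff \<alpha> n * (x\<^sup>2/4)^n)" for n
  proof -
    have "(x / 2) ^ (2 * n) = (x\<^sup>2/4)^n" by (simp add: power_mult power_divide)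
    moreover have "(-1) ^ n / (fact n * Gamma (real n + \<alpha> + 1)) = inverse (Gamma (\<alpha>+1)) * bes_coeff \<alpha> n"
      unfolding Gm bes_coeff_def by (simp add: divide_inverse)
    ultimately show ?thesis by simp
  qed
  have "bessel_j \<alpha> x = Gamma (\<alpha>+1) * (inverse (Gamma (\<alpha>+1)) * bes \<alpha> (x\<^sup>2/4))"
    unfolding bessel_j_def eq bes_def by (subst suminf_mult) (auto intro: bes_summable a)
  thus ?thesis using G by simp
qed

section \<open>Weber's double series\<close>

lemma has_sum_times_real:
  fixes f g :: "_ \<Rightarrow> real"
  assumes f: "(f has_sum a) A" and g: "(g has_sum b) B"
  shows "((\<lambda>(i,j). f i * g j) has_sum (a * b)) (A \<times> B)"
proof (rule has_sum_SigmaI)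
  show "((\<lambda>y. case (x, y) of (i, j) \<Rightarrow> f i * g j) has_sum f x * b) B" for x
    using has_sum_cmult_right[OF g] by simp
  show "((\<lambda>x. f x * b) has_sum a * b) A" by (rule has_sum_cmult_left[OF f])
  have fa: "(\<lambda>x. norm (f x)) summable_on A" and ga: "(\<lambda>x. norm (g x)) summable_on B"
    using f g has_sum_imp_summable summable_on_iff_abs_summable_on_real by blast+
  have "(\<lambda>x. norm (f x * infsum (\<lambda>y. \<bar>g y\<bar>) B)) summable_on A"
    using summable_on_cmult_left[OF fa, of "\<bar>infsum (\<lambda>y. \<bar>g y\<bar>) B\<bar>"] by (simp add: abs_mult)
  moreover have "infsum (\<lambda>y. \<bar>f x * g y\<bar>) B = \<bar>f x\<bar> * infsum (\<lambda>y. \<bar>g y\<bar>) B" for x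
    using ga by (simp add: abs_mult infsum_cmult_right)
  ultimately have "(\<lambda>x. norm (case x of (i,j) \<Rightarrow> f i * g j)) summable_on A \<times> B"
    unfolding Infinite_Sum.abs_summable_on_Sigma_iff
    using ga summable_on_cmult_right[OF ga] by (auto simp: abs_mult)
  thus "(\<lambda>(i,j). f i * g j) summable_on A \<times> B"
    by (rule abs_summable_summable)
qed

text \<open>The Chu-Vandermonde identity. It compares the coefficients of \<open>A\<^sup>m B\<^sup>n\<close> on the two sides of \<open>weber_sum\<close>.\<close>

lemma pochhammer_vandermonde:
  fixes c :: real assumes c: "c > 0"
  shows "pochhammer c (m + n) / (fact m * fact n * pochhammer c m * pochhammer c n)
       = (\<Sum>k\<le>min m n. 1 / (fact (m - k) * fact (n - k) * fact k * pochhammer c k))"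
proof -
  have pos: "pochhammer c k > 0" for k by (rule pochhammer_pos[OF c])
  have "pochhammer (c + real m) n / fact n = (real m + (c + real n - 1)) gchoose n"
    by (simp add: gbinomial_pochhammer' algebra_simps)
  also have "\<dots> = (\<Sum>k=0..n. (real m gchoose k) * ((c + real n - 1) gchoose (n - k)))"
    by (rule gbinomial_Vandermonde[symmetric])
  also have "\<dots> = (\<Sum>k=0..n. real (m choose k) * (pochhammer (c + real k) (n - k) / fact (n - k)))"
    by (intro sum.cong refl) (auto simp: gbinomial_pochhammer' binomial_gbinomial of_nat_diff algebra_simps)
  also have "\<dots> = (\<Sum>k\<le>min m n. real (m choose k) * (pochhammer (c + real k) (n - k) / fact (n - k)))"
    by (rule sum.mono_neutral_right) auto
  also have "\<dots> = (\<Sum>k\<le>min m n. fact m * pochhammer c n * (1 / (fact (m - k) * fact (n - k) * fact k * pochhammer c k)))"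
  proof (intro sum.cong refl)
    fix k assume "k \<in> {..min m n}"
    hence k: "k \<le> m" "k \<le> n" by auto
    have "pochhammer c n = pochhammer c k * pochhammer (c + real k) (n - k)"
      by (rule pochhammer_product[OF k(2)])
    thus "real (m choose k) * (pochhammer (c + real k) (n - k) / fact (n - k)) =
       fact m * pochhammer c n * (1 / (fact (m - k) * fact (n - k) * fact k * pochhammer c k))"
      using pos[of k] by (simp add: binomial_fact[OF k(1)] field_simps)
  qed
  also have "\<dots> = fact m * pochhammer c n * (\<Sum>k\<le>min m n. 1 / (fact (m - k) * fact (n - k) * fact k * pochhammer c k))"
    by (simp add: sum_distrib_left)
  finally show ?thesis
    using pos[of n] pos[of m] by (simp add: pochhammer_product'[of c m n] field_simps)
qed

text \<open>Expand the three factors \<open>exp A\<close>, \<open>exp B\<close> and \<open>bes \<alpha> (- A B)\<close> and collect monomials: the term with indices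
  \<open>(i, j, k)\<close> contributes to \<open>A\<^sup>i\<^sup>+\<^sup>k B\<^sup>j\<^sup>+\<^sup>k\<close>.\<close>

lemma weber_sum:
  assumes a: "\<alpha> > -1/2"
  shows "((\<lambda>(m,n). A ^ m * B ^ n * (pochhammer (\<alpha>+1) (m + n) /
           (fact m * fact n * pochhammer (\<alpha>+1) m * pochhammer (\<alpha>+1) n)))
     has_sum (exp (A + B) * bes \<alpha> (- (A * B)))) UNIV"
proof -
  let ?c = "\<alpha> + 1"
  have c: "?c > 0" using a by simp
  have exp_has: "((\<lambda>i. x ^ i / fact i) has_sum exp x) UNIV" for x :: real
  proof (rule norm_summable_imp_has_sum)
    show "summable (\<lambda>n. norm (x ^ n / fact n))"
      using summable_norm_exp[of x] by (simp add: divide_inverse mult.commute)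
    show "(\<lambda>i. x ^ i / fact i) sums exp x"
      using exp_converges[of x] by (simp add: divide_inverse mult.commute)
  qed
  have bes_has: "((\<lambda>k. (A*B) ^ k / (fact k * pochhammer ?c k)) has_sum bes \<alpha> (-(A*B))) UNIV"
  proof (rule norm_summable_imp_has_sum[OF _ bes_neg_sums[OF a]])
    have "norm ((A*B) ^ k / (fact k * pochhammer ?c k)) = \<bar>bes_coeff \<alpha> k * (A*B) ^ k\<bar>" for k
      by (simp add: bes_coeff_def abs_mult)
    thus "summable (\<lambda>k. norm ((A*B) ^ k / (fact k * pochhammer ?c k)))"
      using bes_summable_abs[OF a] by simp
  qed
  let ?t = "\<lambda>((i,j),k). (A ^ i / fact i * (B ^ j / fact j)) * ((A*B) ^ k / (fact k * pochhammer ?c k))"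
  have triple: "(?t has_sum (exp (A + B) * bes \<alpha> (-(A*B)))) UNIV"
    using has_sum_times_real[OF has_sum_times_real[OF exp_has[of A] exp_has[of B]] bes_has]
    by (simp add: exp_add case_prod_unfold)
  let ?g = "\<lambda>((m,n),k). A ^ m * B ^ n * (1 / (fact (m - k) * fact (n - k) * fact k * pochhammer ?c k))"
  have "(?g has_sum (exp (A + B) * bes \<alpha> (-(A*B)))) (SIGMA mn:UNIV. {..min (fst mn) (snd mn)})"
  proof (rule iffD2[OF has_sum_reindex_bij_witness[where i = "\<lambda>((i,j),k). ((i+k,j+k),k)"
        and j = "\<lambda>((m,n),k). ((m-k,n-k),k)" and T = UNIV and h = ?t] triple])
    show "(\<lambda>((i,j),k). ((i+k,j+k),k)) ((\<lambda>((m,n),k). ((m-k,n-k),k)) a) = a"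
      if "a \<in> (SIGMA mn:UNIV. {..min (fst mn) (snd mn)})" for a :: "(nat \<times> nat) \<times> nat"
      using that by auto
    show "(\<lambda>((m,n),k). ((m-k,n-k),k)) ((\<lambda>((i,j),k). ((i+k,j+k),k)) b) = b" for b :: "(nat \<times> nat) \<times> nat"
      by (auto split: prod.splits)
    show "?t ((\<lambda>((m,n),k). ((m-k,n-k),k)) a) = ?g a"
      if mem: "a \<in> (SIGMA mn:UNIV. {..min (fst mn) (snd mn)})" for a :: "(nat \<times> nat) \<times> nat"
    proof -
      obtain m n k where [simp]: "a = ((m,n),k)" by (metis surj_pair)
      have k: "k \<le> m" "k \<le> n" using mem by auto
      have "A ^ m = A ^ (m - k) * A ^ k" "B ^ n = B ^ (n - k) * B ^ k"
        using k by (simp_all flip: power_add)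
      thus ?thesis by (simp add: power_mult_distrib mult_ac)
    qed
  qed (auto split: prod.splits)
  hence "((\<lambda>mn. \<Sum>k\<le>min (fst mn) (snd mn). ?g (mn, k)) has_sum (exp (A + B) * bes \<alpha> (-(A*B)))) UNIV"
    by (rule has_sum_SigmaD) (simp add: has_sum_finite)
  moreover have "(\<Sum>k\<le>min (fst mn) (snd mn). ?g (mn, k)) =
     (case mn of (m,n) \<Rightarrow> A ^ m * B ^ n * (pochhammer ?c (m + n) / (fact m * fact n * pochhammer ?c m * pochhammer ?c n)))" for mn
    unfolding pochhammer_vandermonde[OF c] by (simp add: case_prod_unfold sum_distrib_left)
  ultimately show ?thesis by simp
qed

section \<open>The measure on the half-line and Weber's integral\<close>

definition mu_const :: "real \<Rightarrow> real" where
  "mu_const \<alpha> = 2 * pi powr (\<alpha> + 1) / Gamma (\<alpha> + 1)"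

lemma mu_const_pos: "\<alpha> > -1/2 \<Longrightarrow> mu_const \<alpha> > 0"
  unfolding mu_const_def by (intro divide_pos_pos mult_pos_pos Gamma_real_pos) auto

lemma mu_alt: "mu \<alpha> = density (lebesgue_on {0..}) (\<lambda>x. ennreal (mu_const \<alpha> * x powr (2 * \<alpha> + 1)))"
  by (simp add: mu_def mu_const_def)

lemma space_mu [simp]: "space (mu \<alpha>) = {0..}"
  by (simp add: mu_def)

lemma sets_mu: "sets (mu \<alpha>) = sets (lebesgue_on {0..})"
  by (simp add: mu_def)

lemma borel_measurable_mu_iff: "f \<in> borel_measurable (mu \<alpha>) \<longleftrightarrow> f \<in> borel_measurable (lebesgue_on {0..})"
  by (simp add: mu_def)

lemma measurable_mu_borel: "(\<lambda>x. x) \<in> borel_measurable (mu \<alpha>)"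
  unfolding borel_measurable_mu_iff by (intro measurable_restrict_space1 measurable_completion) simp

lemma measurable_mu_borel_comp: "f \<in> borel_measurable borel \<Longrightarrow> f \<in> borel_measurable (mu \<alpha>)"
  by (rule measurable_compose[OF measurable_mu_borel])

lemma sets_mu_borel: "A \<in> sets borel \<Longrightarrow> A \<subseteq> {0..} \<Longrightarrow> A \<in> sets (mu \<alpha>)"
  unfolding sets_mu by (subst sets_restrict_space_iff) auto

lemma mu_weight_measurable [measurable]:
  "(\<lambda>x. ennreal (mu_const \<alpha> * x powr (2 * \<alpha> + 1))) \<in> borel_measurable (lebesgue_on {0..})"
  by (intro measurable_restrict_space1 measurable_completion) measurable

lemma nn_integral_mu:
  assumes "f \<in> borel_measurable (mu \<alpha>)"
  shows "(\<integral>\<^sup>+x. f x \<partial>mu \<alpha>) = (\<integral>\<^sup>+x. ennreal (mu_const \<alpha> * x powr (2 * \<alpha> + 1)) * f x * indicator {0..} x \<partial>lborel)"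
proof -
  have "(\<integral>\<^sup>+x. f x \<partial>mu \<alpha>) = (\<integral>\<^sup>+x. ennreal (mu_const \<alpha> * x powr (2 * \<alpha> + 1)) * f x \<partial>lebesgue_on {0..})"
    unfolding mu_alt using assms by (intro nn_integral_density) (auto simp: borel_measurable_mu_iff)
  also have "\<dots> = (\<integral>\<^sup>+x. ennreal (mu_const \<alpha> * x powr (2 * \<alpha> + 1)) * f x * indicator {0..} x \<partial>lebesgue)"
    by (rule nn_integral_restrict_space) simp
  finally show ?thesis by (simp add: nn_integral_completion)
qed

lemma emeasure_mu:
  assumes "A \<in> sets (mu \<alpha>)"
  shows "emeasure (mu \<alpha>) A = (\<integral>\<^sup>+x. ennreal (mu_const \<alpha> * x powr (2 * \<alpha> + 1)) * indicator A x \<partial>lborel)"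
proof -
  have "A \<subseteq> {0..}" using sets.sets_into_space[OF assms] by simp
  hence "indicator A x * indicator {0..} x = (indicator A x :: ennreal)" for x
    by (auto split: split_indicator)
  thus ?thesis
    using nn_integral_mu[of "indicator A" \<alpha>] assms by (simp add: mult.assoc)
qed

lemma emeasure_mu_singleton: "x \<ge> 0 \<Longrightarrow> emeasure (mu \<alpha>) {x} = 0"
proof -
  assume "x \<ge> 0"
  hence "emeasure (mu \<alpha>) {x} = (\<integral>\<^sup>+y. ennreal (mu_const \<alpha> * y powr (2 * \<alpha> + 1)) * indicator {x} y \<partial>lborel)"
    by (intro emeasure_mu sets_mu_borel) auto
  also have "\<dots> = 0"
  proof -
    have "AE y in lborel. ennreal (mu_const \<alpha> * y powr (2 * \<alpha> + 1)) * indicator {x} y = 0"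
      using AE_lborel_singleton[of x] by eventually_elim auto
    thus ?thesis by (subst nn_integral_cong_AE) auto
  qed
  finally show ?thesis .
qed

lemma emeasure_mu_bounded:
  assumes a: "\<alpha> > -1/2"
  shows "emeasure (mu \<alpha>) {0..R} < \<infinity>"
proof -
  have "emeasure (mu \<alpha>) {0..R} = (\<integral>\<^sup>+x. ennreal (mu_const \<alpha> * x powr (2 * \<alpha> + 1)) * indicator {0..R} x \<partial>lborel)"
    by (intro emeasure_mu sets_mu_borel) auto
  also have "\<dots> \<le> (\<integral>\<^sup>+x. ennreal (mu_const \<alpha> * R powr (2 * \<alpha> + 1)) * indicator {0..R} x \<partial>lborel)"
    using a mu_const_pos[OF a]
    by (intro nn_integral_mono) (auto split: split_indicator intro!: ennreal_leI mult_left_mono powr_mono2)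
  also have "\<dots> < \<infinity>"
    by (cases "0 \<le> R") (auto simp: nn_integral_cmult ennreal_mult_less_top)
  finally show ?thesis .
qed

lemma sigma_finite_mu:
  assumes a: "\<alpha> > -1/2" shows "sigma_finite_measure (mu \<alpha>)"
proof
  show "\<exists>A. countable A \<and> A \<subseteq> sets (mu \<alpha>) \<and> \<Union> A = space (mu \<alpha>) \<and> (\<forall>a\<in>A. emeasure (mu \<alpha>) a \<noteq> \<infinity>)"
  proof (intro exI[of _ "range (\<lambda>n::nat. {0..real n})"] conjI)
    show "\<Union> (range (\<lambda>n::nat. {0..real n})) = space (mu \<alpha>)"
      using real_arch_simple by auto
  qed (use emeasure_mu_bounded[OF a, THEN less_imp_neq] in \<open>auto intro!: sets_mu_borel\<close>)
qed

text \<open>The substitution \<open>t = p y\<^sup>2\<close> turns the left-hand side into a Gamma integral.\<close>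

lemma moment_nn:
  assumes a: "\<alpha> > -1/2" and p: "p > 0"
  shows "(\<integral>\<^sup>+y. ennreal (exp (- p * y\<^sup>2) * (p * y\<^sup>2) ^ k) \<partial>mu \<alpha>) =
         ennreal ((pi / p) powr (\<alpha> + 1) * pochhammer (\<alpha> + 1) k)"
proof -
  let ?c = "\<alpha> + 1"
  have c: "?c > 0" using a by simp
  define f where "f = (\<lambda>t. t powr (?c + real k - 1) / exp t :: real)"
  have f: "(f has_integral Gamma (?c + real k)) {0..}"
    unfolding f_def using Gamma_integral_real[of "?c + real k"] c by simp
  have fa: "f absolutely_integrable_on {0..}"
    using f by (intro nonnegative_absolutely_integrable_1) (auto simp: f_def)
  have img: "(\<lambda>y. p * y\<^sup>2) ` {0..} = {0..}"
  proof (intro equalityI subsetI)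
    fix t :: real assume "t \<in> {0..}"
    hence "p * (sqrt (t / p))\<^sup>2 = t" "sqrt (t / p) \<in> {0..}" using p by auto
    thus "t \<in> (\<lambda>y. p * y\<^sup>2) ` {0..}" by (metis imageI)
  qed (use p in auto)
  have "(\<lambda>y. \<bar>2 * p * y\<bar> * f (p * y\<^sup>2)) absolutely_integrable_on {0..} \<and>
        integral {0..} (\<lambda>y. \<bar>2 * p * y\<bar> * f (p * y\<^sup>2)) = Gamma (?c + real k)"
  proof (subst has_absolute_integral_change_of_variables_1'[where g = "\<lambda>y. p * y\<^sup>2" and S = "{0..}" and f = f and g' = "\<lambda>y. 2 * p * y"])
    show "inj_on (\<lambda>y. p * y\<^sup>2) {0..}" using p by (auto simp: inj_on_def power2_eq_iff_nonneg)
    show "f absolutely_integrable_on (\<lambda>y. p * y\<^sup>2) ` {0..} \<and> integral ((\<lambda>y. p * y\<^sup>2) ` {0..}) f = Gamma (?c + real k)"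
      unfolding img using fa f by auto
  qed (auto intro!: derivative_eq_intros)
  hence "((\<lambda>y. \<bar>2 * p * y\<bar> * f (p * y\<^sup>2)) has_integral Gamma (?c + real k)) {0..}"
    using set_lebesgue_integral_eq_integral(1) integrable_integral by metis
  hence I: "(\<integral>\<^sup>+y. ennreal (\<bar>2 * p * y\<bar> * f (p * y\<^sup>2)) * indicator {0..} y \<partial>lborel) = ennreal (Gamma (?c + real k))"
    by (intro nn_integral_has_integral_lebesgue') (auto simp: f_def)
  have ptw: "mu_const \<alpha> * y powr (2 * \<alpha> + 1) * (exp (- p * y\<^sup>2) * (p * y\<^sup>2) ^ k) =
      ((pi / p) powr ?c / Gamma ?c) * (\<bar>2 * p * y\<bar> * f (p * y\<^sup>2))" if "y \<ge> 0" for y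
  proof (cases "y = 0")
    case False
    hence y: "y > 0" using that by simp
    have "(p * y\<^sup>2) powr (?c + real k - 1) = (p * y\<^sup>2) powr \<alpha> * (p * y\<^sup>2) ^ k"
    proof -
      have e: "?c + real k - 1 = \<alpha> + real k" by simp
      show ?thesis unfolding e powr_add using p y by (subst powr_realpow) auto
    qed
    moreover have "(p * y\<^sup>2) powr \<alpha> = p powr \<alpha> * y powr (2 * \<alpha>)"
    proof -
      have "(y\<^sup>2) powr \<alpha> = (y powr 2) powr \<alpha>" using y by simp
      also have "\<dots> = y powr (2 * \<alpha>)" by (rule powr_powr)
      finally show ?thesis using p y by (simp add: powr_mult)
    qed
    moreover have "y powr (2 * \<alpha> + 1) = y powr (2 * \<alpha>) * y" using y by (simp add: powr_add)
    moreover have "(pi / p) powr ?c = pi powr ?c / (p powr \<alpha> * p)" using p by (simp add: powr_divide powr_add)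
    ultimately show ?thesis using y p by (simp add: f_def mu_const_def exp_minus field_simps)
  qed (simp add: f_def)
  have "(\<integral>\<^sup>+y. ennreal (exp (- p * y\<^sup>2) * (p * y\<^sup>2) ^ k) \<partial>mu \<alpha>) =
    (\<integral>\<^sup>+y. ennreal (mu_const \<alpha> * y powr (2 * \<alpha> + 1)) * ennreal (exp (- p * y\<^sup>2) * (p * y\<^sup>2) ^ k) * indicator {0..} y \<partial>lborel)"
    by (intro nn_integral_mu measurable_mu_borel_comp) measurable
  also have "\<dots> = (\<integral>\<^sup>+y. ennreal ((pi / p) powr ?c / Gamma ?c) * (ennreal (\<bar>2 * p * y\<bar> * f (p * y\<^sup>2)) * indicator {0..} y) \<partial>lborel)"
  proof (intro nn_integral_cong)
    fix y :: real
    have G: "(pi / p) powr ?c / Gamma ?c \<ge> 0" using Gamma_real_pos[OF c] by simp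
    show "ennreal (mu_const \<alpha> * y powr (2 * \<alpha> + 1)) * ennreal (exp (- p * y\<^sup>2) * (p * y\<^sup>2) ^ k) * indicator {0..} y
      = ennreal ((pi / p) powr ?c / Gamma ?c) * (ennreal (\<bar>2 * p * y\<bar> * f (p * y\<^sup>2)) * indicator {0..} y)"
    proof (cases "y \<ge> 0")
      case True
      have "ennreal (mu_const \<alpha> * y powr (2 * \<alpha> + 1)) * ennreal (exp (- p * y\<^sup>2) * (p * y\<^sup>2) ^ k)
          = ennreal (((pi / p) powr ?c / Gamma ?c) * (\<bar>2 * p * y\<bar> * f (p * y\<^sup>2)))"
        unfolding ptw[OF True, symmetric] using p by (intro ennreal_mult''[symmetric]) auto
      moreover have "indicator {0..} y = (1::ennreal)" using True by simp
      ultimately show ?thesis by (simp only: ennreal_mult'[OF G] mult_1_right)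
    qed simp
  qed
  also have "\<dots> = ennreal ((pi / p) powr ?c / Gamma ?c) * ennreal (Gamma (?c + real k))"
    by (subst nn_integral_cmult, unfold I) (auto simp: f_def)
  also have "\<dots> = ennreal ((pi / p) powr ?c * (Gamma (?c + real k) / Gamma ?c))"
    using c by (simp flip: ennreal_mult'' add: Gamma_real_pos less_imp_le)
  also have "Gamma (?c + real k) / Gamma ?c = pochhammer ?c k"
  proof (rule pochhammer_Gamma[symmetric])
    show "?c \<notin> \<int>\<^sub>\<le>\<^sub>0" using c nonpos_Ints_nonpos[of ?c] by auto
  qed
  finally show ?thesis .
qed

lemma moment:
  assumes a: "\<alpha> > -1/2" and p: "p > 0"
  shows "has_bochner_integral (mu \<alpha>) (\<lambda>y. exp (- p * y\<^sup>2) * (p * y\<^sup>2) ^ k) ((pi / p) powr (\<alpha> + 1) * pochhammer (\<alpha> + 1) k)"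
proof (rule has_bochner_integral_nn_integral)
  show "(\<lambda>y. exp (- p * y\<^sup>2) * (p * y\<^sup>2) ^ k) \<in> borel_measurable (mu \<alpha>)" by (intro measurable_mu_borel_comp) measurable
qed (use moment_nn[OF a p] p a in \<open>auto intro!: mult_nonneg_nonneg less_imp_le[OF pochhammer_pos]\<close>)

text \<open>Weber's second exponential integral. Expand both Bessel factors, integrate term by term with the moments of the
  Gaussian and sum up by \<open>weber_sum\<close>. Replacing \<open>A\<close> and \<open>B\<close> by \<open>- \<bar>A\<bar>\<close> and \<open>- \<bar>B\<bar>\<close> replaces every term by its absolute value, so
  the same series provides the absolute convergence that the interchange requires.\<close>

lemma weber_integral:
  assumes a: "\<alpha> > -1/2" and p: "p > 0"
  shows "has_bochner_integral (mu \<alpha>) (\<lambda>y. exp (- p * y\<^sup>2) * bes \<alpha> (A * (p * y\<^sup>2)) * bes \<alpha> (B * (p * y\<^sup>2)))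
     ((pi / p) powr (\<alpha> + 1) * (exp (- A - B) * bes \<alpha> (- (A * B))))"
proof -
  let ?c = "\<alpha> + 1"
  let ?P = "(pi / p) powr ?c"
  have c: "?c > 0" using a by simp
  define co where "co = (\<lambda>A B (m,n). (- A) ^ m * (- B) ^ n / (fact m * fact n * pochhammer ?c m * pochhammer ?c n) :: real)"
  define T where "T = (\<lambda>A B mn y. co A B mn * (exp (- p * y\<^sup>2) * (p * y\<^sup>2) ^ (fst mn + snd mn)))"
  have pp: "pochhammer ?c n > 0" for n using c by (rule pochhammer_pos)
  have T_int: "has_bochner_integral (mu \<alpha>) (T A B mn) (?P * (co A B mn * pochhammer ?c (fst mn + snd mn)))" for A B mn
    unfolding T_def using has_bochner_integral_mult_right[OF moment[OF a p, of "fst mn + snd mn"], of "co A B mn"]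
    by (simp add: mult_ac)
  have co_has: "((\<lambda>mn. co A B mn * pochhammer ?c (fst mn + snd mn)) has_sum (exp (- A - B) * bes \<alpha> (- (A * B)))) UNIV" for A B
    using weber_sum[OF a, of "-A" "-B"] by (simp add: co_def case_prod_unfold)
  have norm_co: "\<bar>co A B mn\<bar> = co (-\<bar>A\<bar>) (-\<bar>B\<bar>) mn" for mn
    using pp[THEN less_imp_le] by (cases mn) (simp add: co_def abs_mult power_abs)
  have norm_T: "norm (T A B mn y) = T (-\<bar>A\<bar>) (-\<bar>B\<bar>) mn y" for mn y
    using p by (simp add: T_def abs_mult norm_co)
  have prod_has: "((\<lambda>mn. T A B mn y) has_sum (exp (- p * y\<^sup>2) * bes \<alpha> (A * (p * y\<^sup>2)) * bes \<alpha> (B * (p * y\<^sup>2)))) UNIV" for A B y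
  proof -
    have b: "((\<lambda>n. bes_coeff \<alpha> n * z ^ n) has_sum bes \<alpha> z) UNIV" for z
      using bes_summable_abs[OF a, of z] bes_summable[OF a, of z]
      by (intro norm_summable_imp_has_sum) (auto simp: bes_def intro: summable_sums)
    have "((\<lambda>(m,n). (bes_coeff \<alpha> m * (A * (p * y\<^sup>2)) ^ m) * (bes_coeff \<alpha> n * (B * (p * y\<^sup>2)) ^ n)) has_sum
       (bes \<alpha> (A * (p * y\<^sup>2)) * bes \<alpha> (B * (p * y\<^sup>2)))) (UNIV \<times> UNIV)"
      by (rule has_sum_times_real[OF b b])
    hence "((\<lambda>mn. exp (- p * y\<^sup>2) * (case mn of (m,n) \<Rightarrow> (bes_coeff \<alpha> m * (A * (p * y\<^sup>2)) ^ m) * (bes_coeff \<alpha> n * (B * (p * y\<^sup>2)) ^ n))) has_sum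
       exp (- p * y\<^sup>2) * (bes \<alpha> (A * (p * y\<^sup>2)) * bes \<alpha> (B * (p * y\<^sup>2)))) UNIV"
      by (intro has_sum_cmult_right) simp
    moreover have "exp (- p * y\<^sup>2) * (case mn of (m,n) \<Rightarrow> (bes_coeff \<alpha> m * (A * (p * y\<^sup>2)) ^ m) * (bes_coeff \<alpha> n * (B * (p * y\<^sup>2)) ^ n)) = T A B mn y" for mn
    proof (cases mn)
      case (Pair m n)
      have s: "(- z) ^ k = (- 1) ^ k * z ^ k" for z :: real and k by (simp flip: power_mult_distrib)
      have ab: "(z * w) ^ k = z ^ k * w ^ k" for z w :: real and k by (rule power_mult_distrib)
      show ?thesis unfolding T_def co_def Pair bes_coeff_def
        by (simp only: s[of A] s[of B] ab power_add split: prod.split) (simp add: mult_ac)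
    qed
    ultimately show ?thesis by (simp add: mult.assoc)
  qed
  have seq: "(\<lambda>i. h (prod_decode i)) sums l" if "(h has_sum l) UNIV" for h :: "nat \<times> nat \<Rightarrow> real" and l
    using that has_sum_reindex_bij_betw[OF bij_prod_decode, of h l] by (intro has_sum_imp_sums) simp
  let ?f = "\<lambda>i. T A B (prod_decode i)"
  have 1: "integrable (mu \<alpha>) (?f i)" for i using T_int by (rule integrable.intros)
  have 2: "summable (\<lambda>i. norm (?f i y))" for y
    unfolding norm_T using seq[OF prod_has] by (rule sums_summable)
  have 3: "(\<integral>y. norm (?f i y) \<partial>mu \<alpha>) = ?P * (co (-\<bar>A\<bar>) (-\<bar>B\<bar>) (prod_decode i) * pochhammer ?c (fst (prod_decode i) + snd (prod_decode i)))" for i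
    unfolding norm_T using T_int by (rule has_bochner_integral_integral_eq)
  have 4: "summable (\<lambda>i. \<integral>y. norm (?f i y) \<partial>mu \<alpha>)"
    unfolding 3 using seq[OF has_sum_cmult_right[OF co_has]] by (rule sums_summable)
  have lim: "(\<Sum>i. ?f i y) = exp (- p * y\<^sup>2) * bes \<alpha> (A * (p * y\<^sup>2)) * bes \<alpha> (B * (p * y\<^sup>2))" for y
    using seq[OF prod_has] by (rule sums_unique[symmetric])
  have "integrable (mu \<alpha>) (\<lambda>y. \<Sum>i. ?f i y)" using 1 2 4 by (intro integrable_suminf) auto
  moreover have "(\<integral>y. (\<Sum>i. ?f i y) \<partial>mu \<alpha>) = (\<Sum>i. \<integral>y. ?f i y \<partial>mu \<alpha>)"
    using 1 2 4 by (intro integral_suminf) auto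
  moreover have "(\<Sum>i. \<integral>y. ?f i y \<partial>mu \<alpha>) = ?P * (exp (- A - B) * bes \<alpha> (- (A * B)))"
    using seq[OF has_sum_cmult_right[OF co_has]] has_bochner_integral_integral_eq[OF T_int]
    by (simp add: sums_iff)
  ultimately show ?thesis by (simp add: has_bochner_integral_iff lim)
qed

section \<open>The heat kernel of the Bessel operator\<close>

text \<open>The heat kernel at time \<open>s\<close>, normalised so that it corresponds to the multiplier \<open>exp (- \<pi> s \<xi>\<^sup>2)\<close>. The last factor is
  the modified Bessel function at \<open>2 \<pi> x y / s\<close>.\<close>

definition heat :: "real \<Rightarrow> real \<Rightarrow> real \<Rightarrow> real \<Rightarrow> real" where
  "heat \<alpha> s x y = s powr (- (\<alpha> + 1)) * exp (- pi * (x\<^sup>2 + y\<^sup>2) / s) * bes \<alpha> (- ((pi * x * y / s)\<^sup>2))"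

abbreviation hankel_kernel :: "real \<Rightarrow> real \<Rightarrow> real \<Rightarrow> real" where
  "hankel_kernel \<alpha> x y \<equiv> bessel_j \<alpha> (2 * pi * x * y)"

lemma hankel_kernel_eq: "\<alpha> > -1/2 \<Longrightarrow> hankel_kernel \<alpha> x y = bes \<alpha> ((pi * x * y)\<^sup>2)"
  by (simp add: bessel_j_eq power_mult_distrib mult.assoc)

lemma hankel_kernel_commute: "hankel_kernel \<alpha> x y = hankel_kernel \<alpha> y x"
  by (simp add: mult_ac)

lemma abs_hankel_kernel_le_1: "\<alpha> > -1/2 \<Longrightarrow> \<bar>hankel_kernel \<alpha> x y\<bar> \<le> 1"
  unfolding hankel_kernel_eq by (intro bes_abs_le_1) auto

lemma bessel_j_measurable [measurable]: 
  assumes a: "\<alpha> > -1/2" shows "bessel_j \<alpha> \<in> borel_measurable borel"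
proof -
  have "bessel_j \<alpha> = (\<lambda>x. bes \<alpha> (x\<^sup>2/4))" by (intro ext bessel_j_eq a)
  thus ?thesis using bes_measurable[OF a] by simp
qed

lemma heat_sym: "heat \<alpha> s x y = heat \<alpha> s y x"
  by (simp add: heat_def add.commute mult_ac)

lemma heat_nonneg: "\<alpha> > -1/2 \<Longrightarrow> heat \<alpha> s x y \<ge> 0"
  unfolding heat_def using bes_neg_ge_1[of \<alpha> "(pi * x * y / s)\<^sup>2"] by (intro mult_nonneg_nonneg) auto

lemma heat_measurable [measurable (raw)]:
  assumes a: "\<alpha> > -1/2"
    and [measurable]: "f \<in> borel_measurable M" "g \<in> borel_measurable M" "h \<in> borel_measurable M"
  shows "(\<lambda>z. heat \<alpha> (f z) (g z) (h z)) \<in> borel_measurable M"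
  unfolding heat_def using bes_measurable[OF a] by measurable

text \<open>Weber's integral, read as the Hankel transform of a Gaussian times a Bessel function.\<close>

lemma heat_as_hankel:
  assumes a: "\<alpha> > -1/2" and s: "s > 0"
  shows "has_bochner_integral (mu \<alpha>) (\<lambda>\<xi>. exp (- pi * s * \<xi>\<^sup>2) * hankel_kernel \<alpha> x \<xi> * hankel_kernel \<alpha> y \<xi>) (heat \<alpha> s x y)"
proof -
  have "has_bochner_integral (mu \<alpha>) (\<lambda>\<xi>. exp (- (pi * s) * \<xi>\<^sup>2) * bes \<alpha> ((pi * x\<^sup>2 / s) * ((pi * s) * \<xi>\<^sup>2)) * bes \<alpha> ((pi * y\<^sup>2 / s) * ((pi * s) * \<xi>\<^sup>2)))
    ((pi / (pi * s)) powr (\<alpha> + 1) * (exp (- (pi * x\<^sup>2 / s) - (pi * y\<^sup>2 / s)) * bes \<alpha> (- ((pi * x\<^sup>2 / s) * (pi * y\<^sup>2 / s)))))"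
    by (rule weber_integral[OF a]) (use s in simp)
  moreover have "(pi * u\<^sup>2 / s) * ((pi * s) * \<xi>\<^sup>2) = (pi * u * \<xi>)\<^sup>2" for u \<xi>
    using s by (simp add: power2_eq_square)
  moreover have "(pi / (pi * s)) powr (\<alpha> + 1) = s powr (- (\<alpha> + 1))"
    using s by (simp only: powr_minus) (simp add: powr_divide field_simps)
  moreover have "exp (- (pi * x\<^sup>2 / s) - (pi * y\<^sup>2 / s)) = exp (- pi * (x\<^sup>2 + y\<^sup>2) / s)"
    using s by (simp add: field_simps)
  moreover have "(pi * x\<^sup>2 / s) * (pi * y\<^sup>2 / s) = (pi * x * y / s)\<^sup>2"
    by (simp add: power2_eq_square)
  ultimately show ?thesis unfolding hankel_kernel_eq[OF a] heat_def by (simp add: mult.assoc)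
qed

text \<open>Weber's integral once more, with one Bessel factor at an imaginary argument: the transform of the heat kernel
  gives back the function whose transform it is.\<close>

lemma hankel_of_heat:
  assumes a: "\<alpha> > -1/2" and s: "s > 0"
  shows "has_bochner_integral (mu \<alpha>) (\<lambda>y. heat \<alpha> s x y * hankel_kernel \<alpha> y \<xi>) (exp (- pi * s * \<xi>\<^sup>2) * hankel_kernel \<alpha> x \<xi>)"
proof -
  let ?C = "s powr (- (\<alpha> + 1)) * exp (- pi * x\<^sup>2 / s)"
  have "has_bochner_integral (mu \<alpha>) (\<lambda>y. ?C * (exp (- (pi / s) * y\<^sup>2) * bes \<alpha> ((- pi * x\<^sup>2 / s) * ((pi / s) * y\<^sup>2)) * bes \<alpha> ((pi * s * \<xi>\<^sup>2) * ((pi / s) * y\<^sup>2))))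
    (?C * ((pi / (pi / s)) powr (\<alpha> + 1) * (exp (- (- pi * x\<^sup>2 / s) - (pi * s * \<xi>\<^sup>2)) * bes \<alpha> (- ((- pi * x\<^sup>2 / s) * (pi * s * \<xi>\<^sup>2))))))"
    by (intro has_bochner_integral_mult_right weber_integral[OF a]) (use s in simp)
  moreover have "?C * (exp (- (pi / s) * y\<^sup>2) * bes \<alpha> ((- pi * x\<^sup>2 / s) * ((pi / s) * y\<^sup>2)) * bes \<alpha> ((pi * s * \<xi>\<^sup>2) * ((pi / s) * y\<^sup>2)))
     = heat \<alpha> s x y * hankel_kernel \<alpha> y \<xi>" for y
  proof -
    have 1: "(- pi * x\<^sup>2 / s) * ((pi / s) * y\<^sup>2) = - ((pi * x * y / s)\<^sup>2)"
      and 2: "(pi * s * \<xi>\<^sup>2) * ((pi / s) * y\<^sup>2) = (pi * y * \<xi>)\<^sup>2"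
      and 3: "- pi * (x\<^sup>2 + y\<^sup>2) / s = - pi * x\<^sup>2 / s + - (pi / s) * y\<^sup>2"
      using s by (auto simp: power2_eq_square field_simps)
    show ?thesis unfolding hankel_kernel_eq[OF a] heat_def 1 2 3 exp_add by (simp add: mult_ac)
  qed
  moreover have "?C * ((pi / (pi / s)) powr (\<alpha> + 1) * (exp (- (- pi * x\<^sup>2 / s) - (pi * s * \<xi>\<^sup>2)) * bes \<alpha> (- ((- pi * x\<^sup>2 / s) * (pi * s * \<xi>\<^sup>2)))))
     = exp (- pi * s * \<xi>\<^sup>2) * hankel_kernel \<alpha> x \<xi>"
  proof -
    have 1: "- ((- pi * x\<^sup>2 / s) * (pi * s * \<xi>\<^sup>2)) = (pi * x * \<xi>)\<^sup>2"
      and 2: "- (- pi * x\<^sup>2 / s) - (pi * s * \<xi>\<^sup>2) = - (- pi * x\<^sup>2 / s) + - pi * s * \<xi>\<^sup>2"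
      and 3: "pi / (pi / s) = s"
      using s by (auto simp: power2_eq_square field_simps)
    have 4: "s powr (- (\<alpha> + 1)) * s powr (\<alpha> + 1) = 1" using s by (simp flip: powr_add)
    have 5: "exp (- pi * x\<^sup>2 / s) * exp (- (- pi * x\<^sup>2 / s)) = 1" by (simp flip: exp_add)
    have alg: "u * e * (v * (e' * g * b)) = (u * v) * (e * e') * (g * b)" for u v e e' g b :: real
      by (simp only: mult_ac)
    show ?thesis unfolding hankel_kernel_eq[OF a] 1 2 3 exp_add alg 4 5 by simp
  qed
  ultimately show ?thesis by simp
qed

lemma heat_mass:
  assumes a: "\<alpha> > -1/2" and s: "s > 0"
  shows "(\<integral>\<^sup>+y. ennreal (heat \<alpha> s x y) \<partial>mu \<alpha>) = 1"
proof -
  have "has_bochner_integral (mu \<alpha>) (\<lambda>y. heat \<alpha> s x y) 1"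
    using hankel_of_heat[OF a s, of x 0] hankel_kernel_eq[OF a, of _ 0] by simp
  thus ?thesis
    by (simp add: has_bochner_integral_iff nn_integral_eq_integral heat_nonneg[OF a])
qed

text \<open>The modified Bessel function increases at most like \<open>exp\<close>, so only exponents have to be compared, and that
  comparison amounts to \<open>(y - (2 x - x'))\<^sup>2 \<ge> 0\<close>. Doubling the time pays for moving the point.\<close>

lemma heat_harnack:
  assumes a: "\<alpha> > -1/2" and s: "s > 0" and nn: "x \<ge> 0" "x' \<ge> 0" "y \<ge> 0" and r: "\<bar>x - x'\<bar> \<le> r"
  shows "heat \<alpha> s x y \<le> 2 powr (\<alpha> + 1) * exp (pi * r\<^sup>2 / s) * heat \<alpha> (2 * s) x' y"
proof -
  define Z where "Z = 2 * pi * x * y / s"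
  define Z' where "Z' = pi * x' * y / s"
  let ?I = "\<lambda>z. bes \<alpha> (- (z\<^sup>2 / 4))"
  have Z0: "Z \<ge> 0" "Z' \<ge> 0" using nn s by (auto simp: Z_def Z'_def)
  have I: "?I Z \<le> exp (max 0 (Z - Z')) * ?I Z'"
  proof (cases "Z' \<le> Z")
    case True thus ?thesis using bes_neg_growth[OF a Z0(2) True] by (simp add: max_def)
  next
    case False thus ?thesis
      using Z0 by (auto intro!: bes_neg_mono[OF a] power_mono simp: max_def)
  qed
  have r2: "(x - x')\<^sup>2 \<le> r\<^sup>2" using r by (simp add: abs_le_square_iff[symmetric])
  have "0 \<le> (y - (2 * x - x'))\<^sup>2" by simp
  hence E1: "2 * y * (2 * x - x') \<le> 2 * (x\<^sup>2 + y\<^sup>2) - (x'\<^sup>2 + y\<^sup>2) + 2 * r\<^sup>2"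
    using r2 by (simp add: power2_eq_square algebra_simps)
  have E2: "0 \<le> 2 * (x\<^sup>2 + y\<^sup>2) - (x'\<^sup>2 + y\<^sup>2) + 2 * r\<^sup>2"
  proof -
    have "(2 * x - x')\<^sup>2 = 4 * x\<^sup>2 - 4 * (x * x') + x'\<^sup>2" "(x - x')\<^sup>2 = x\<^sup>2 - 2 * (x * x') + x'\<^sup>2"
      by (simp_all add: power2_eq_square algebra_simps)
    moreover have "0 \<le> 2 * (X + Y) - (X' + Y) + 2 * R"
      if "P = 4 * X - 4 * u + X'" "Q = X - 2 * u + X'" "Q \<le> R" "0 \<le> P" "0 \<le> Y" for X Y X' R P Q u :: real
      using that by argo
    ultimately show ?thesis using r2 zero_le_power2[of "2 * x - x'"] zero_le_power2[of y] by blast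
  qed
  have E: "max 0 (Z - Z') \<le> pi * r\<^sup>2 / s + pi * (x\<^sup>2 + y\<^sup>2) / s - pi * (x'\<^sup>2 + y\<^sup>2) / (2 * s)"
  proof -
    let ?k = "pi / (2 * s)"
    have "Z - Z' = ?k * (2 * y * (2 * x - x'))" using s by (simp add: Z_def Z'_def field_simps)
    moreover have "pi * r\<^sup>2 / s + pi * (x\<^sup>2 + y\<^sup>2) / s - pi * (x'\<^sup>2 + y\<^sup>2) / (2 * s)
       = ?k * (2 * (x\<^sup>2 + y\<^sup>2) - (x'\<^sup>2 + y\<^sup>2) + 2 * r\<^sup>2)" using s by (simp add: field_simps)
    moreover have "?k \<ge> 0" using s by simp
    ultimately show ?thesis using E1 E2 mult_left_mono by (metis max.boundedI mult_nonneg_nonneg)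
  qed
  have "heat \<alpha> s x y = s powr (- (\<alpha> + 1)) * exp (- pi * (x\<^sup>2 + y\<^sup>2) / s) * ?I Z"
    by (simp add: heat_def Z_def power_divide power_mult_distrib mult_ac)
  also have "\<dots> \<le> s powr (- (\<alpha> + 1)) * exp (- pi * (x\<^sup>2 + y\<^sup>2) / s) *
      (exp (pi * r\<^sup>2 / s + pi * (x\<^sup>2 + y\<^sup>2) / s - pi * (x'\<^sup>2 + y\<^sup>2) / (2 * s)) * ?I Z')"
    using E bes_neg_ge_1[OF a, of "Z'\<^sup>2/4"]
    by (intro mult_left_mono order_trans[OF I] mult_right_mono) auto
  also have "\<dots> = s powr (- (\<alpha> + 1)) * exp (pi * r\<^sup>2 / s) * exp (- pi * (x'\<^sup>2 + y\<^sup>2) / (2 * s)) * ?I Z'"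
  proof -
    have "(- pi * S / s) + (A + pi * S / s - pi * S' / (2 * s)) = A + (- pi * S' / (2 * s))" for S S' A
      by simp
    hence "exp (- pi * S / s) * exp (A + pi * S / s - pi * S' / (2 * s)) = exp A * exp (- pi * S' / (2 * s))" for S S' A
      unfolding exp_add[symmetric] by (simp only:)
    thus ?thesis by (simp only: mult.assoc[symmetric]) (simp only: mult.assoc)
  qed
  also have "\<dots> = 2 powr (\<alpha> + 1) * exp (pi * r\<^sup>2 / s) * heat \<alpha> (2 * s) x' y"
  proof -
    have h1: "s powr (- (\<alpha> + 1)) = 2 powr (\<alpha> + 1) * (2 * s) powr (- (\<alpha> + 1))"
    proof -
      have "2 powr (\<alpha> + 1) * 2 powr (- (\<alpha> + 1)) = (1::real)" by (simp flip: powr_add)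
      moreover have "(2 * s) powr (- (\<alpha> + 1)) = 2 powr (- (\<alpha> + 1)) * s powr (- (\<alpha> + 1))"
        using s by (intro powr_mult)
      ultimately show ?thesis by (simp only: mult.assoc[symmetric] mult_1)
    qed
    have h2: "(pi * x' * y / (2 * s))\<^sup>2 = Z'\<^sup>2 / 4"
      by (simp add: Z'_def power_divide power_mult_distrib)
    show ?thesis unfolding heat_def h2 by (subst h1) (simp only: mult_ac)
  qed
  finally show ?thesis .
qed

text \<open>The kernel times \<open>exp (- \<pi> \<sigma> x\<^sup>2)\<close> is a Gaussian in \<open>x\<close> with rate \<open>p = \<pi> (\<sigma> + 1/s)\<close> times one Bessel factor, so Weber's
  integral and its analogue with an additional factor \<open>x\<^sup>2\<close> evaluate both summands of \<open>1 + x\<^sup>2\<close>.\<close>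

lemma heat_gauss_moments:
  assumes a: "\<alpha> > -1/2" and s: "s > 0" and \<sigma>: "\<sigma> \<ge> 0"
  shows "(\<integral>\<^sup>+x. ennreal ((1 + x\<^sup>2) * exp (- pi * \<sigma> * x\<^sup>2) * heat \<alpha> s x y) \<partial>mu \<alpha>)
     \<le> ennreal ((1 + (\<alpha> + 1) * s + y\<^sup>2) * exp (- (pi * \<sigma> * y\<^sup>2 / (1 + \<sigma> * s))))"
proof -
  let ?c = "\<alpha> + 1"
  have c: "?c > 0" using a by simp
  have pp: "pochhammer ?c n > 0" for n using c by (rule pochhammer_pos)
  define p where "p = pi * (\<sigma> + 1 / s)"
  define z where "z = pi * y\<^sup>2 / (s * (1 + \<sigma> * s))"
  have q: "1 + \<sigma> * s \<ge> 1" using s \<sigma> by simp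
  have p: "p > 0" unfolding p_def using s \<sigma> by (intro mult_pos_pos add_nonneg_pos) auto
  have p_alt: "p = pi * (1 + \<sigma> * s) / s" using s by (simp add: p_def field_simps)
  have z: "z \<ge> 0" unfolding z_def using s \<sigma> by auto
  have zp: "z * p = (pi * y / s)\<^sup>2" 
  proof -
    have "pi * y\<^sup>2 / (s * Q) * (pi * Q / s) = (pi * y / s)\<^sup>2" if "Q > 0" for Q
      using s that by (simp add: power2_eq_square field_simps)
    from this[of "1 + \<sigma> * s"] show ?thesis unfolding z_def p_alt using q by linarith
  qed
  have I0: "(\<integral>\<^sup>+x. ennreal (exp (- p * x\<^sup>2) * bes \<alpha> (- z * (p * x\<^sup>2))) \<partial>mu \<alpha>) = ennreal ((pi / p) powr ?c * exp z)"
  proof -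
    have "has_bochner_integral (mu \<alpha>) (\<lambda>x. exp (- p * x\<^sup>2) * bes \<alpha> (- z * (p * x\<^sup>2))) ((pi / p) powr ?c * exp z)"
      using weber_integral[OF a p, of "-z" 0] by simp
    thus ?thesis using bes_neg_ge_1[OF a, of "z * (p * x\<^sup>2)" for x] z p
      by (simp add: has_bochner_integral_iff nn_integral_eq_integral order.trans[OF zero_le_one])
  qed
  have I1: "(\<integral>\<^sup>+x. ennreal (exp (- p * x\<^sup>2) * (p * x\<^sup>2) * bes \<alpha> (- z * (p * x\<^sup>2))) \<partial>mu \<alpha>) = ennreal ((pi / p) powr ?c * ((?c + z) * exp z))"
  proof -
    let ?t = "\<lambda>n x. z ^ n / (fact n * pochhammer ?c n) * (exp (- p * x\<^sup>2) * (p * x\<^sup>2) ^ Suc n)"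
    have t0: "?t n x \<ge> 0" for n x using z p pp[THEN less_imp_le] by (intro mult_nonneg_nonneg divide_nonneg_nonneg) auto
    have "(\<lambda>n. ?t n x) sums (exp (- p * x\<^sup>2) * (p * x\<^sup>2) * bes \<alpha> (- z * (p * x\<^sup>2)))" for x
      using sums_mult[OF bes_neg_sums[OF a, of "z * (p * x\<^sup>2)"], of "exp (- p * x\<^sup>2) * (p * x\<^sup>2)"]
      by (simp add: power_mult_distrib mult_ac)
    hence eq: "ennreal (exp (- p * x\<^sup>2) * (p * x\<^sup>2) * bes \<alpha> (- z * (p * x\<^sup>2))) = (\<Sum>n. ennreal (?t n x))" for x
      using t0 suminf_ennreal2[of "\<lambda>n. ?t n x"] by (simp only: sums_iff)
    have tn: "(\<integral>\<^sup>+x. ennreal (?t n x) \<partial>mu \<alpha>) = ennreal ((pi / p) powr ?c * ((?c + real n) * (z ^ n / fact n)))" for n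
    proof -
      have k: "z ^ n / (fact n * pochhammer ?c n) \<ge> 0" using z pp[of n] by simp
      have "(\<integral>\<^sup>+x. ennreal (?t n x) \<partial>mu \<alpha>) = (\<integral>\<^sup>+x. ennreal (z ^ n / (fact n * pochhammer ?c n)) * ennreal (exp (- p * x\<^sup>2) * (p * x\<^sup>2) ^ Suc n) \<partial>mu \<alpha>)"
        by (subst ennreal_mult'[OF k]) simp
      also have "\<dots> = ennreal (z ^ n / (fact n * pochhammer ?c n)) * ennreal ((pi / p) powr ?c * pochhammer ?c (Suc n))"
        by (subst nn_integral_cmult, intro measurable_mu_borel_comp, measurable) (subst moment_nn[OF a p], simp)
      also have "\<dots> = ennreal ((pi / p) powr ?c * ((?c + real n) * (z ^ n / fact n)))"
      proof -
        have "z ^ n / (fact n * q) * (P * (q * r)) = P * (r * (z ^ n / fact n))" if "q > 0" for q P r :: real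
          using that by simp
        from this[OF pp[of n]] show ?thesis
          unfolding ennreal_mult'[OF k, symmetric] pochhammer_Suc by simp
      qed
      finally show ?thesis .
    qed
    have "(\<integral>\<^sup>+x. ennreal (exp (- p * x\<^sup>2) * (p * x\<^sup>2) * bes \<alpha> (- z * (p * x\<^sup>2))) \<partial>mu \<alpha>) = (\<Sum>n. \<integral>\<^sup>+x. ennreal (?t n x) \<partial>mu \<alpha>)"
      unfolding eq by (intro nn_integral_suminf measurable_mu_borel_comp) measurable
    also have "\<dots> = (\<Sum>n. ennreal ((pi / p) powr ?c * ((?c + real n) * (z ^ n / fact n))))"
      by (simp only: tn)
    also have "\<dots> = ennreal ((pi / p) powr ?c * ((?c + z) * exp z))"
    proof -
      have e: "(\<lambda>n. z ^ n / fact n) sums exp z"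
        using exp_converges[of z] by (simp add: divide_inverse mult.commute)
      have "(\<lambda>n. real (Suc n) * (z ^ Suc n / fact (Suc n))) sums (z * exp z)"
        using sums_mult[OF e, of z] by (simp del: of_nat_Suc)
      hence "(\<lambda>n. real n * (z ^ n / fact n)) sums (z * exp z)"
        by (subst (asm) sums_Suc_iff) simp
      hence "(\<lambda>n. (pi / p) powr ?c * (?c * (z ^ n / fact n) + real n * (z ^ n / fact n))) sums ((pi / p) powr ?c * (?c * exp z + z * exp z))"
        by (intro sums_mult sums_add e)
      hence "(\<lambda>n. (pi / p) powr ?c * ((?c + real n) * (z ^ n / fact n))) sums ((pi / p) powr ?c * ((?c + z) * exp z))"
        by (simp only: distrib_right)
      thus ?thesis using z c by (subst suminf_ennreal2) (auto simp: sums_iff)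
    qed
    finally show ?thesis .
  qed
  let ?K = "s powr (- ?c) * exp (- pi * y\<^sup>2 / s)"
  have K: "?K * ((pi / p) powr ?c * exp z) \<le> exp (- (pi * \<sigma> * y\<^sup>2 / (1 + \<sigma> * s)))"
  proof -
    have "?K * ((pi / p) powr ?c * exp z) = (s powr (- ?c) * (pi / p) powr ?c) * (exp (- pi * y\<^sup>2 / s) * exp z)" by simp
    also have "exp (- pi * y\<^sup>2 / s) * exp z = exp (- (pi * \<sigma> * y\<^sup>2 / (1 + \<sigma> * s)))"
    proof -
      have "1 / (s * Q) = 1 / s - \<sigma> / Q" if "Q > 0" "Q - \<sigma> * s = 1" for Q
      proof -
        have "1 / s - \<sigma> / Q = (Q - \<sigma> * s) / (s * Q)" using that s by (simp add: diff_frac_eq)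
        thus ?thesis using that by simp
      qed
      from this[of "1 + \<sigma> * s"] have e: "1 / (s * (1 + \<sigma> * s)) = 1 / s - \<sigma> / (1 + \<sigma> * s)" using q by simp
      have "z = pi * y\<^sup>2 * (1 / (s * (1 + \<sigma> * s)))" by (simp add: z_def)
      hence "- pi * y\<^sup>2 / s + z = - (pi * \<sigma> * y\<^sup>2 / (1 + \<sigma> * s))"
        unfolding e by (simp add: right_diff_distrib)
      thus ?thesis by (simp only: exp_add[symmetric])
    qed
    also have "s powr (- ?c) * (pi / p) powr ?c = (1 + \<sigma> * s) powr (- ?c)"
    proof -
      have "pi / p = s / (1 + \<sigma> * s)" unfolding p_alt using q by simp
      hence "(pi / p) powr ?c = s powr ?c / (1 + \<sigma> * s) powr ?c" using s q by (simp add: powr_divide)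
      moreover have "s powr (- ?c) * s powr ?c = 1" using s by (simp flip: powr_add)
      ultimately show ?thesis using powr_minus_divide[of "1 + \<sigma> * s" ?c] by (simp only: times_divide_eq_right)
    qed
    also have "\<dots> \<le> 1"
    proof -
      have "(1 + \<sigma> * s) powr ?c \<ge> 1" using q c by (intro ge_one_powr_ge_zero) auto
      thus ?thesis unfolding powr_minus_divide by (subst divide_le_eq_1) auto
    qed
    finally show ?thesis by simp
  qed
  have cz: "(?c + z) / p \<le> ?c * s + y\<^sup>2"
  proof -
    have "pi * y\<^sup>2 / (s * Q) / (pi * Q / s) = y\<^sup>2 / Q\<^sup>2" if "Q > 0" for Q
      using s that by (simp add: power2_eq_square field_simps)
    hence "z / p = y\<^sup>2 / (1 + \<sigma> * s)\<^sup>2" unfolding z_def p_alt using q by simp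
    also have "\<dots> \<le> y\<^sup>2 / 1" using q by (intro divide_left_mono) auto
    finally have 1: "z / p \<le> y\<^sup>2" by simp
    have "1 / p = s / (pi * (1 + \<sigma> * s))" unfolding p_alt by simp
    also have "\<dots> \<le> s / 1" using q s pi_gt3 mult_mono[of 1 pi 1 "1 + \<sigma> * s"] by (intro divide_left_mono) auto
    finally have "?c * (1 / p) \<le> ?c * s" using c by (intro mult_left_mono) auto
    thus ?thesis using 1 by (simp add: add_divide_distrib)
  qed
  have K0: "?K \<ge> 0" by simp
  have gen: "ennreal (K * (A + (1 / p) * B)) = ennreal K * (ennreal A + ennreal (1 / p) * ennreal B)"
    if "K \<ge> 0" "A \<ge> 0" "B \<ge> 0" for K A B
  proof -
    have "ennreal (K * (A + (1 / p) * B)) = ennreal K * ennreal (A + (1 / p) * B)" by (rule ennreal_mult'[OF that(1)])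
    also have "ennreal (A + (1 / p) * B) = ennreal A + ennreal ((1 / p) * B)"
      using that p by (intro ennreal_plus) auto
    also have "ennreal ((1 / p) * B) = ennreal (1 / p) * ennreal B" using p by (intro ennreal_mult') auto
    finally show ?thesis .
  qed
  have "(\<integral>\<^sup>+x. ennreal ((1 + x\<^sup>2) * exp (- pi * \<sigma> * x\<^sup>2) * heat \<alpha> s x y) \<partial>mu \<alpha>)
     = (\<integral>\<^sup>+x. ennreal ?K * (ennreal (exp (- p * x\<^sup>2) * bes \<alpha> (- z * (p * x\<^sup>2))) + ennreal (1 / p) * ennreal (exp (- p * x\<^sup>2) * (p * x\<^sup>2) * bes \<alpha> (- z * (p * x\<^sup>2)))) \<partial>mu \<alpha>)"
  proof (intro nn_integral_cong)
    fix x
    have "- z * (p * x\<^sup>2) = - ((pi * x * y / s)\<^sup>2)" using zp by (simp add: power_divide power_mult_distrib mult.assoc[symmetric])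
    hence b: "bes \<alpha> (- ((pi * x * y / s)\<^sup>2)) = bes \<alpha> (- z * (p * x\<^sup>2))" by simp
    have "exp (- pi * (x\<^sup>2 + y\<^sup>2) / s) * exp (- pi * \<sigma> * x\<^sup>2) = exp (- pi * y\<^sup>2 / s) * exp (- p * x\<^sup>2)"
      unfolding p_def using s by (simp add: field_simps flip: exp_add)
    hence "(1 + x\<^sup>2) * exp (- pi * \<sigma> * x\<^sup>2) * heat \<alpha> s x y = (1 + x\<^sup>2) * (?K * (exp (- p * x\<^sup>2) * bes \<alpha> (- z * (p * x\<^sup>2))))"
      unfolding heat_def b by (simp add: mult_ac)
    also have "\<dots> = ?K * (exp (- p * x\<^sup>2) * bes \<alpha> (- z * (p * x\<^sup>2)) + (1 / p) * (exp (- p * x\<^sup>2) * (p * x\<^sup>2) * bes \<alpha> (- z * (p * x\<^sup>2))))"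
      using p by (simp add: field_simps)
    finally have e: "(1 + x\<^sup>2) * exp (- pi * \<sigma> * x\<^sup>2) * heat \<alpha> s x y = \<dots>" .
    have b0: "bes \<alpha> (- z * (p * x\<^sup>2)) \<ge> 0" using bes_neg_ge_1[OF a, of "z * (p * x\<^sup>2)"] z p by (simp add: mult.assoc)
    show "ennreal ((1 + x\<^sup>2) * exp (- pi * \<sigma> * x\<^sup>2) * heat \<alpha> s x y) =
        ennreal ?K * (ennreal (exp (- p * x\<^sup>2) * bes \<alpha> (- z * (p * x\<^sup>2))) + ennreal (1 / p) * ennreal (exp (- p * x\<^sup>2) * (p * x\<^sup>2) * bes \<alpha> (- z * (p * x\<^sup>2))))"
    proof -
      show ?thesis unfolding e by (rule gen) (use b0 p in auto)
    qed
  qed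
  also have "\<dots> = ennreal ?K * (ennreal ((pi / p) powr ?c * exp z) + ennreal (1 / p) * ennreal ((pi / p) powr ?c * ((?c + z) * exp z)))"
    using bes_measurable[OF a]
    by (subst nn_integral_cmult nn_integral_add, (intro measurable_mu_borel_comp, measurable)+)+ (simp only: I0 I1)
  also have "\<dots> = ennreal (?K * ((pi / p) powr ?c * exp z) * (1 + (?c + z) / p))"
  proof -
    have "?K * ((pi / p) powr ?c * exp z + (1 / p) * ((pi / p) powr ?c * ((?c + z) * exp z)))
        = ?K * ((pi / p) powr ?c * exp z) * (1 + (?c + z) / p)"
      by (simp add: distrib_left distrib_right add_divide_distrib mult_ac)
    moreover have "(pi / p) powr ?c * exp z \<ge> 0" "(pi / p) powr ?c * ((?c + z) * exp z) \<ge> 0" using z c by auto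
    ultimately show ?thesis using gen[OF K0] by metis
  qed
  also have "\<dots> \<le> ennreal ((1 + ?c * s + y\<^sup>2) * exp (- (pi * \<sigma> * y\<^sup>2 / (1 + \<sigma> * s))))"
  proof (rule ennreal_leI)
    have "?K * ((pi / p) powr ?c * exp z) * (1 + (?c + z) / p) \<le> exp (- (pi * \<sigma> * y\<^sup>2 / (1 + \<sigma> * s))) * (1 + ?c * s + y\<^sup>2)"
      using K cz z c p by (intro mult_mono) auto
    thus "?K * ((pi / p) powr ?c * exp z) * (1 + (?c + z) / p) \<le> (1 + ?c * s + y\<^sup>2) * exp (- (pi * \<sigma> * y\<^sup>2 / (1 + \<sigma> * s)))"
      by (simp only: mult.commute)
  qed
  finally show ?thesis .
qed

section \<open>Integral operators with bounded or positive kernels\<close>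

lemma norm_integral_le_nn_integral:
  fixes f :: "'a \<Rightarrow> 'b::{banach, second_countable_topology}"
  shows "ennreal (norm (integral\<^sup>L M f)) \<le> (\<integral>\<^sup>+x. ennreal (norm (f x)) \<partial>M)"
  by (cases "integrable M f") (auto intro: integral_norm_bound_ennreal simp: not_integrable_integral_eq)

lemma Fubini_bounded_kernel:
  fixes f g :: "_ \<Rightarrow> complex" and k :: "_ \<Rightarrow> _ \<Rightarrow> complex"
  assumes "sigma_finite_measure M" "sigma_finite_measure N"
    and f: "integrable M f" and g: "integrable N g"
    and k[measurable]: "case_prod k \<in> borel_measurable (M \<Otimes>\<^sub>M N)"
    and bd: "\<And>x y. norm (k x y) \<le> C"
  shows "(\<integral>x. f x * (\<integral>y. k x y * g y \<partial>N) \<partial>M) = (\<integral>y. (\<integral>x. f x * k x y \<partial>M) * g y \<partial>N)"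
proof -
  interpret M: sigma_finite_measure M by fact
  interpret N: sigma_finite_measure N by fact
  interpret P: pair_sigma_finite M N ..
  have [measurable]: "f \<in> borel_measurable M" "g \<in> borel_measurable N" using f g by auto
  have km: "k x \<in> borel_measurable N" if "x \<in> space M" for x
    using k that by (simp add: measurable_split_conv) 
  have "integrable (M \<Otimes>\<^sub>M N) (case_prod (\<lambda>x y. f x * k x y * g y))"
  proof (rule P.Fubini_integrable)
    show "(\<lambda>(x,y). f x * k x y * g y) \<in> borel_measurable (M \<Otimes>\<^sub>M N)" by measurable
    have i: "integrable N (\<lambda>y. k x y * g y)" if "x \<in> space M" for x
    proof (rule Bochner_Integration.integrable_bound[OF integrable_mult_right[OF g, of "complex_of_real C"]])
      show "(\<lambda>y. k x y * g y) \<in> borel_measurable N" using that by measurable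
      have "norm (k x y * g y) \<le> \<bar>C\<bar> * norm (g y)" for y
        unfolding norm_mult by (intro mult_right_mono order_trans[OF bd]) auto
      thus "AE y in N. norm (k x y * g y) \<le> norm (complex_of_real C * g y)"
        by (auto simp: norm_mult)
    qed
    thus "AE x in M. integrable N (\<lambda>y. case (x, y) of (x, y) \<Rightarrow> f x * k x y * g y)"
      by (auto simp: mult.assoc intro!: AE_I2 integrable_mult_right)
    show "integrable M (\<lambda>x. \<integral>y. norm (case (x, y) of (x, y) \<Rightarrow> f x * k x y * g y) \<partial>N)"
    proof (rule Bochner_Integration.integrable_bound[OF integrable_mult_right[OF integrable_norm[OF f], of "\<bar>C\<bar> * (\<integral>y. norm (g y) \<partial>N)"]])
      show "(\<lambda>x. \<integral>y. norm (case (x, y) of (x, y) \<Rightarrow> f x * k x y * g y) \<partial>N) \<in> borel_measurable M" by measurable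
      have "(\<integral>y. norm (f x * k x y * g y) \<partial>N) \<le> \<bar>C\<bar> * (\<integral>y. norm (g y) \<partial>N) * norm (f x)" if "x \<in> space M" for x
      proof -
        have "(\<integral>y. norm (f x * k x y * g y) \<partial>N) \<le> (\<integral>y. norm (f x) * \<bar>C\<bar> * norm (g y) \<partial>N)"
        proof (rule integral_mono)
          show "integrable N (\<lambda>y. norm (f x * k x y * g y))"
            using integrable_norm[OF integrable_mult_right[OF i[OF that], of "f x"]] by (simp add: mult.assoc)
          show "integrable N (\<lambda>y. norm (f x) * \<bar>C\<bar> * norm (g y))" using g by auto
        qed (auto simp: norm_mult mult.assoc intro!: mult_left_mono mult_right_mono order_trans[OF bd])
        thus ?thesis by (simp add: mult_ac)
      qed
      thus "AE x in M. norm (\<integral>y. norm (case (x, y) of (x, y) \<Rightarrow> f x * k x y * g y) \<partial>N) \<le> norm (\<bar>C\<bar> * (\<integral>y. norm (g y) \<partial>N) * norm (f x))"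
        by (auto intro!: AE_I2 simp: abs_mult)
    qed
  qed
  from P.Fubini_integral[OF this]
  have "(\<integral>y. (\<integral>x. f x * k x y * g y \<partial>M) \<partial>N) = (\<integral>x. (\<integral>y. f x * (k x y * g y) \<partial>N) \<partial>M)"
    by (simp add: mult.assoc)
  moreover have "(\<integral>x. f x * k x y * g y \<partial>M) = (\<integral>x. f x * k x y \<partial>M) * g y" for y
    by (rule integral_mult_left_zero)
  ultimately show ?thesis by simp
qed

text \<open>Schur's test in additive form, by Young's inequality \<open>2 a b \<le> l a\<^sup>2 + b\<^sup>2/l\<close> under the integral. The weight \<open>l\<close> trades a small
  bound on the rows against a large one on the columns, or conversely.\<close>

lemma young_schur:
  fixes u h :: "_ \<Rightarrow> complex" and k :: "_ \<Rightarrow> _ \<Rightarrow> ennreal"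
  assumes "sigma_finite_measure M" "sigma_finite_measure N"
    and k[measurable]: "case_prod k \<in> borel_measurable (M \<Otimes>\<^sub>M N)"
    and [measurable]: "u \<in> borel_measurable M" "h \<in> borel_measurable N" and l: "l > 0"
  shows "2 * (\<integral>\<^sup>+x. ennreal (cmod (u x)) * (\<integral>\<^sup>+y. k x y * ennreal (cmod (h y)) \<partial>N) \<partial>M)
     \<le> ennreal l * (\<integral>\<^sup>+x. ennreal ((cmod (u x))\<^sup>2) * (\<integral>\<^sup>+y. k x y \<partial>N) \<partial>M)
       + ennreal (1 / l) * (\<integral>\<^sup>+y. ennreal ((cmod (h y))\<^sup>2) * (\<integral>\<^sup>+x. k x y \<partial>M) \<partial>N)"
proof -
  interpret M: sigma_finite_measure M by fact
  interpret N: sigma_finite_measure N by fact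
  interpret P: pair_sigma_finite M N ..
  \<comment> \<open>The pointwise inequality, with the kernel value as a common factor.\<close>
  have young: "2 * (ennreal a * (q * ennreal b)) \<le> ennreal l * (ennreal (a\<^sup>2) * q) + ennreal (1 / l) * (ennreal (b\<^sup>2) * q)"
    if "a \<ge> 0" "b \<ge> 0" for a b q
  proof -
    have "0 \<le> (l * a - b)\<^sup>2 / l" using l by simp
    also have "(l * a - b)\<^sup>2 / l = l * a\<^sup>2 + 1 / l * b\<^sup>2 - 2 * a * b"
      using l by (simp add: power2_diff field_simps power2_eq_square)
    finally have "ennreal (2 * a * b) \<le> ennreal (l * a\<^sup>2 + 1 / l * b\<^sup>2)" by (intro ennreal_leI) simp
    hence "2 * ennreal a * ennreal b \<le> ennreal l * ennreal (a\<^sup>2) + ennreal (1 / l) * ennreal (b\<^sup>2)"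
      using l that by (simp only: ennreal_plus ennreal_mult ennreal_numeral zero_le_power2 mult_nonneg_nonneg less_imp_le zero_le_divide_1_iff zero_le_numeral)
    from mult_right_mono[OF this, of q] show ?thesis by (simp add: distrib_left distrib_right mult_ac)
  qed
  have kx [measurable]: "k x \<in> borel_measurable N" if "x \<in> space M" for x
    using measurable_Pair2[OF k that] by simp
  have "2 * (\<integral>\<^sup>+x. ennreal (cmod (u x)) * (\<integral>\<^sup>+y. k x y * ennreal (cmod (h y)) \<partial>N) \<partial>M)
     = (\<integral>\<^sup>+x. 2 * (ennreal (cmod (u x)) * (\<integral>\<^sup>+y. k x y * ennreal (cmod (h y)) \<partial>N)) \<partial>M)"
    by (rule nn_integral_cmult[symmetric]) measurable
  also have "\<dots> = (\<integral>\<^sup>+x. (\<integral>\<^sup>+y. 2 * (ennreal (cmod (u x)) * (k x y * ennreal (cmod (h y)))) \<partial>N) \<partial>M)"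
    by (intro nn_integral_cong) (simp add: nn_integral_cmult)
  also have "\<dots> \<le> (\<integral>\<^sup>+x. (\<integral>\<^sup>+y. ennreal l * (ennreal ((cmod (u x))\<^sup>2) * k x y) + ennreal (1 / l) * (ennreal ((cmod (h y))\<^sup>2) * k x y) \<partial>N) \<partial>M)"
    by (intro nn_integral_mono young) auto
  also have "\<dots> = (\<integral>\<^sup>+x. ennreal l * (ennreal ((cmod (u x))\<^sup>2) * (\<integral>\<^sup>+y. k x y \<partial>N)) + ennreal (1 / l) * (\<integral>\<^sup>+y. ennreal ((cmod (h y))\<^sup>2) * k x y \<partial>N) \<partial>M)"
    by (intro nn_integral_cong) (simp add: nn_integral_add nn_integral_cmult)
  also have "\<dots> = ennreal l * (\<integral>\<^sup>+x. ennreal ((cmod (u x))\<^sup>2) * (\<integral>\<^sup>+y. k x y \<partial>N) \<partial>M)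
      + ennreal (1 / l) * (\<integral>\<^sup>+x. (\<integral>\<^sup>+y. ennreal ((cmod (h y))\<^sup>2) * k x y \<partial>N) \<partial>M)"
    by (simp add: nn_integral_add nn_integral_cmult)
  also have "(\<integral>\<^sup>+x. (\<integral>\<^sup>+y. ennreal ((cmod (h y))\<^sup>2) * k x y \<partial>N) \<partial>M) = (\<integral>\<^sup>+y. (\<integral>\<^sup>+x. ennreal ((cmod (h y))\<^sup>2) * k x y \<partial>M) \<partial>N)"
    by (rule P.Fubini'[symmetric]) measurable
  also have "\<dots> = (\<integral>\<^sup>+y. ennreal ((cmod (h y))\<^sup>2) * (\<integral>\<^sup>+x. k x y \<partial>M) \<partial>N)"
    by (intro nn_integral_cong nn_integral_cmult) measurable
  finally show ?thesis .
qed

section \<open>The Hankel transform of integrable functions\<close>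

definition energy :: "real \<Rightarrow> (real \<Rightarrow> complex) \<Rightarrow> ennreal" where
  "energy \<alpha> f = (\<integral>\<^sup>+x. ennreal ((cmod (f x))\<^sup>2) \<partial>mu \<alpha>)"

lemma l2_norm_sq_on_eq: "l2_norm_sq_on \<alpha> {0..} f = energy \<alpha> f"
  unfolding l2_norm_sq_on_def energy_def by (intro nn_integral_cong) auto

lemma l2_norm_eq: "l2_norm \<alpha> f = (if energy \<alpha> f = \<infinity> then \<infinity> else ennreal (sqrt (enn2real (energy \<alpha> f))))"
  by (simp add: l2_norm_def Let_def l2_norm_sq_on_eq)

lemma l2_norm_sq: "(l2_norm \<alpha> f)\<^sup>2 = energy \<alpha> f"
proof (cases "energy \<alpha> f = \<infinity>")
  case False
  thus ?thesis by (simp add: l2_norm_eq ennreal_power ennreal_enn2real_if)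
qed (simp add: l2_norm_eq power2_eq_square)

lemma L2_iff: "f \<in> L2 \<alpha> \<longleftrightarrow> f \<in> borel_measurable (mu \<alpha>) \<and> energy \<alpha> f < \<infinity>"
  by (auto simp: L2_def l2_norm_eq less_top)

lemma L1_iff: "f \<in> L1 \<alpha> \<longleftrightarrow> integrable (mu \<alpha>) f"
  by (simp add: L1_def)

lemma hankel_kernel_pair_measurable [measurable]:
  assumes a: "\<alpha> > -1/2"
  shows "(\<lambda>(x, y). complex_of_real (hankel_kernel \<alpha> x y)) \<in> borel_measurable (mu \<alpha> \<Otimes>\<^sub>M mu \<alpha>)"
proof -
  note [measurable] = bessel_j_measurable[OF a] measurable_mu_borel
  show ?thesis by measurable
qed

lemma hankel_kernel_measurable_mu:
  assumes a: "\<alpha> > -1/2"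
  shows "(\<lambda>x. complex_of_real (hankel_kernel \<alpha> x y)) \<in> borel_measurable (mu \<alpha>)"
proof -
  note [measurable] = bessel_j_measurable[OF a] measurable_mu_borel
  show ?thesis by measurable
qed

lemma integrable_bounded_times:
  fixes f k :: "_ \<Rightarrow> complex"
  assumes f: "integrable M f" and k: "k \<in> borel_measurable M" and bd: "\<And>x. norm (k x) \<le> C"
  shows "integrable M (\<lambda>x. f x * k x)"
proof (rule Bochner_Integration.integrable_bound[OF integrable_mult_right[OF f, of "complex_of_real C"]])
  show "(\<lambda>x. f x * k x) \<in> borel_measurable M" using f k by measurable
  have "norm (f x * k x) \<le> \<bar>C\<bar> * norm (f x)" for x
    using bd[of x] mult_left_mono[of "norm (k x)" "\<bar>C\<bar>" "norm (f x)"] by (simp add: norm_mult mult.commute)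
  thus "AE x in M. norm (f x * k x) \<le> norm (complex_of_real C * f x)" by (auto simp: norm_mult)
qed

context
  fixes \<alpha> :: real assumes a: "\<alpha> > -1/2"
begin

interpretation sigma_finite_measure "mu \<alpha>" by (rule sigma_finite_mu[OF a])
interpretation P: pair_sigma_finite "mu \<alpha>" "mu \<alpha>" ..

lemma hankel_L1_integrable:
  assumes "integrable (mu \<alpha>) f"
  shows "integrable (mu \<alpha>) (\<lambda>x. f x * complex_of_real (hankel_kernel \<alpha> x y))"
  using assms hankel_kernel_measurable_mu[OF a] abs_hankel_kernel_le_1[OF a] by (intro integrable_bounded_times[where C = 1]) auto

lemma hankel_L1_bound:
  assumes "integrable (mu \<alpha>) f"
  shows "norm (hankel_L1 \<alpha> f y) \<le> (\<integral>x. norm (f x) \<partial>mu \<alpha>)"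
proof -
  have "norm (hankel_L1 \<alpha> f y) \<le> (\<integral>x. norm (f x * complex_of_real (hankel_kernel \<alpha> x y)) \<partial>mu \<alpha>)"
    unfolding hankel_L1_def by (rule integral_norm_bound)
  also have "\<dots> \<le> (\<integral>x. norm (f x) \<partial>mu \<alpha>)"
    using integrable_norm[OF hankel_L1_integrable[OF assms]] assms abs_hankel_kernel_le_1[OF a]
    by (intro integral_mono) (auto simp: norm_mult mult_left_le)
  finally show ?thesis .
qed

lemma hankel_L1_measurable:
  assumes [measurable]: "f \<in> borel_measurable (mu \<alpha>)"
  shows "hankel_L1 \<alpha> f \<in> borel_measurable (mu \<alpha>)"
proof -
  note [measurable] = bessel_j_measurable[OF a] measurable_mu_borel
  show ?thesis unfolding hankel_L1_def[abs_def] by measurable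
qed

lemma hankel_L1_diff:
  assumes "integrable (mu \<alpha>) f" "integrable (mu \<alpha>) g"
  shows "hankel_L1 \<alpha> (\<lambda>x. f x - g x) y = hankel_L1 \<alpha> f y - hankel_L1 \<alpha> g y"
  unfolding hankel_L1_def using assms hankel_L1_integrable
  by (subst Bochner_Integration.integral_diff[symmetric]) (auto simp: left_diff_distrib)

lemma hankel_L1_add:
  assumes "integrable (mu \<alpha>) f" "integrable (mu \<alpha>) g"
  shows "hankel_L1 \<alpha> (\<lambda>x. f x + g x) y = hankel_L1 \<alpha> f y + hankel_L1 \<alpha> g y"
  unfolding hankel_L1_def using assms hankel_L1_integrable
  by (subst Bochner_Integration.integral_add[symmetric]) (auto simp: distrib_right)

lemma hankel_L1_cmult: "hankel_L1 \<alpha> (\<lambda>x. c * f x) y = c * hankel_L1 \<alpha> f y"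
  unfolding hankel_L1_def by (simp add: mult.assoc)

lemma hankel_L1_cnj: "hankel_L1 \<alpha> (\<lambda>x. cnj (f x)) y = cnj (hankel_L1 \<alpha> f y)"
  unfolding hankel_L1_def by (subst Bochner_Integration.integral_cnj[symmetric]) simp

lemma hankel_L1_mult_formula:
  assumes f: "integrable (mu \<alpha>) f" and g: "integrable (mu \<alpha>) g"
  shows "(\<integral>x. hankel_L1 \<alpha> f x * g x \<partial>mu \<alpha>) = (\<integral>x. f x * hankel_L1 \<alpha> g x \<partial>mu \<alpha>)"
proof -
  have "(\<integral>x. f x * (\<integral>y. complex_of_real (hankel_kernel \<alpha> x y) * g y \<partial>mu \<alpha>) \<partial>mu \<alpha>)
      = (\<integral>y. (\<integral>x. f x * complex_of_real (hankel_kernel \<alpha> x y) \<partial>mu \<alpha>) * g y \<partial>mu \<alpha>)"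
    using abs_hankel_kernel_le_1[OF a] 
    by (intro Fubini_bounded_kernel[where C = 1] sigma_finite_mu[OF a] f g hankel_kernel_pair_measurable[OF a]) simp
  moreover have "complex_of_real (hankel_kernel \<alpha> x y) * g y = g y * complex_of_real (hankel_kernel \<alpha> y x)" for x y
    by (simp only: hankel_kernel_commute[of \<alpha> x y]) (rule mult.commute)
  ultimately show ?thesis by (simp only: hankel_L1_def)
qed

lemma hankel_L1_gauss_hankel_kernel:
  assumes s: "s > 0"
  shows "integrable (mu \<alpha>) (\<lambda>\<xi>. complex_of_real (exp (- pi * s * \<xi>\<^sup>2) * hankel_kernel \<alpha> x \<xi>))"
    and "hankel_L1 \<alpha> (\<lambda>\<xi>. complex_of_real (exp (- pi * s * \<xi>\<^sup>2) * hankel_kernel \<alpha> x \<xi>)) y = complex_of_real (heat \<alpha> s x y)"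
proof -
  show "integrable (mu \<alpha>) (\<lambda>\<xi>. complex_of_real (exp (- pi * s * \<xi>\<^sup>2) * hankel_kernel \<alpha> x \<xi>))"
  proof (rule integrable_of_real)
    show "integrable (mu \<alpha>) (\<lambda>\<xi>. exp (- pi * s * \<xi>\<^sup>2) * hankel_kernel \<alpha> x \<xi>)"
      using heat_as_hankel[OF a s, of x 0] hankel_kernel_eq[OF a, of 0] by (simp add: has_bochner_integral_iff)
  qed
  have "has_bochner_integral (mu \<alpha>) (\<lambda>\<xi>. complex_of_real (exp (- pi * s * \<xi>\<^sup>2) * hankel_kernel \<alpha> x \<xi> * hankel_kernel \<alpha> y \<xi>)) (complex_of_real (heat \<alpha> s x y))"
    by (intro has_bochner_integral_of_real heat_as_hankel a s)
  thus "hankel_L1 \<alpha> (\<lambda>\<xi>. complex_of_real (exp (- pi * s * \<xi>\<^sup>2) * hankel_kernel \<alpha> x \<xi>)) y = complex_of_real (heat \<alpha> s x y)"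
    unfolding hankel_L1_def hankel_kernel_commute[of \<alpha> y] by (simp add: has_bochner_integral_iff)
qed

lemma gauss_regularization:
  assumes f: "integrable (mu \<alpha>) f" and s: "s > 0"
  shows "(\<integral>\<xi>. complex_of_real (exp (- pi * s * \<xi>\<^sup>2)) * hankel_L1 \<alpha> f \<xi> * complex_of_real (hankel_kernel \<alpha> x \<xi>) \<partial>mu \<alpha>)
       = (\<integral>y. complex_of_real (heat \<alpha> s x y) * f y \<partial>mu \<alpha>)"
proof -
  have "(\<integral>\<xi>. hankel_L1 \<alpha> f \<xi> * complex_of_real (exp (- pi * s * \<xi>\<^sup>2) * hankel_kernel \<alpha> x \<xi>) \<partial>mu \<alpha>)
    = (\<integral>y. f y * hankel_L1 \<alpha> (\<lambda>\<xi>. complex_of_real (exp (- pi * s * \<xi>\<^sup>2) * hankel_kernel \<alpha> x \<xi>)) y \<partial>mu \<alpha>)"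
    by (rule hankel_L1_mult_formula[OF f hankel_L1_gauss_hankel_kernel(1)[OF s]])
  thus ?thesis unfolding hankel_L1_gauss_hankel_kernel(2)[OF s] by (simp add: mult_ac)
qed

lemma heat_times_hankel_L1:
  assumes g: "integrable (mu \<alpha>) g" and s: "s > 0"
  shows "(\<integral>\<xi>. complex_of_real (exp (- pi * s * \<xi>\<^sup>2) * hankel_kernel \<alpha> x \<xi>) * g \<xi> \<partial>mu \<alpha>)
       = (\<integral>y. complex_of_real (heat \<alpha> s x y) * hankel_L1 \<alpha> g y \<partial>mu \<alpha>)"
proof -
  have h: "integrable (mu \<alpha>) (\<lambda>y. complex_of_real (heat \<alpha> s x y))"
    using hankel_of_heat[OF a s, of x 0] hankel_kernel_eq[OF a, of _ 0] by (simp add: has_bochner_integral_iff)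
  have "has_bochner_integral (mu \<alpha>) (\<lambda>y. complex_of_real (heat \<alpha> s x y * hankel_kernel \<alpha> y \<xi>)) (complex_of_real (exp (- pi * s * \<xi>\<^sup>2) * hankel_kernel \<alpha> x \<xi>))" for \<xi>
    by (intro has_bochner_integral_of_real hankel_of_heat a s)
  hence "hankel_L1 \<alpha> (\<lambda>y. complex_of_real (heat \<alpha> s x y)) \<xi> = complex_of_real (exp (- pi * s * \<xi>\<^sup>2) * hankel_kernel \<alpha> x \<xi>)" for \<xi>
    unfolding hankel_L1_def by (simp add: has_bochner_integral_iff)
  with hankel_L1_mult_formula[OF h g] show ?thesis by simp
qed

lemma heat_mass_fst:
  assumes s: "s > 0" shows "(\<integral>\<^sup>+x. ennreal (heat \<alpha> s x y) \<partial>mu \<alpha>) = 1"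
  using heat_mass[OF a s, of y] by (simp add: heat_sym[of \<alpha> s y])

lemma heat_pair_measurable:
  "(\<lambda>(x,y). ennreal (heat \<alpha> s x y)) \<in> borel_measurable (mu \<alpha> \<Otimes>\<^sub>M mu \<alpha>)"
proof -
  note [measurable] = heat_measurable[OF a] measurable_mu_borel
  show ?thesis by measurable
qed

lemma heat_form_le:
  assumes [measurable]: "f \<in> borel_measurable (mu \<alpha>)" and s: "s > 0"
  shows "(\<integral>\<^sup>+x. ennreal (cmod (f x)) * (\<integral>\<^sup>+y. ennreal (heat \<alpha> s x y) * ennreal (cmod (f y)) \<partial>mu \<alpha>) \<partial>mu \<alpha>) \<le> energy \<alpha> f"
proof -
  have "2 * (\<integral>\<^sup>+x. ennreal (cmod (f x)) * (\<integral>\<^sup>+y. ennreal (heat \<alpha> s x y) * ennreal (cmod (f y)) \<partial>mu \<alpha>) \<partial>mu \<alpha>)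
    \<le> ennreal 1 * (\<integral>\<^sup>+x. ennreal ((cmod (f x))\<^sup>2) * (\<integral>\<^sup>+y. ennreal (heat \<alpha> s x y) \<partial>mu \<alpha>) \<partial>mu \<alpha>)
    + ennreal (1 / 1) * (\<integral>\<^sup>+y. ennreal ((cmod (f y))\<^sup>2) * (\<integral>\<^sup>+x. ennreal (heat \<alpha> s x y) \<partial>mu \<alpha>) \<partial>mu \<alpha>)"
    by (rule young_schur[OF sigma_finite_mu[OF a] sigma_finite_mu[OF a] heat_pair_measurable]) auto
  also have "\<dots> = 2 * energy \<alpha> f"
    by (simp add: heat_mass[OF a s] heat_mass_fst[OF s] energy_def flip: mult_2)
  finally show ?thesis by (simp add: ennreal_mult_le_mult_iff)
qed

text \<open>By the multiplication formula the energy of the transform, damped by a Gaussian, is the quadratic form of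
  the heat kernel at \<open>f\<close>. Rows and columns of the heat kernel have mass one, so that form is at most the energy
  of \<open>f\<close>. Fatou's lemma removes the damping.\<close>

lemma hankel_L1_contraction:
  assumes f: "integrable (mu \<alpha>) f"
  shows "energy \<alpha> (hankel_L1 \<alpha> f) \<le> energy \<alpha> f"
proof -
  have fm: "f \<in> borel_measurable (mu \<alpha>)" using f by auto
  have Hm [measurable]: "hankel_L1 \<alpha> f \<in> borel_measurable (mu \<alpha>)" by (rule hankel_L1_measurable[OF fm])
  note [measurable] = measurable_mu_borel
  have reg: "(\<integral>\<^sup>+\<xi>. ennreal ((cmod (hankel_L1 \<alpha> f \<xi>))\<^sup>2 * exp (- pi * s * \<xi>\<^sup>2)) \<partial>mu \<alpha>) \<le> energy \<alpha> f" if s: "s > 0" for s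
  proof -
    define C where "C = (\<integral>x. norm (f x) \<partial>mu \<alpha>)"
    have [measurable]: "(\<lambda>\<xi>. cnj (hankel_L1 \<alpha> f \<xi>)) \<in> borel_measurable (mu \<alpha>)"
      by (rule measurable_compose[OF Hm]) (intro borel_measurable_continuous_onI continuous_intros)
    let ?g = "\<lambda>\<xi>. complex_of_real (exp (- pi * s * \<xi>\<^sup>2)) * cnj (hankel_L1 \<alpha> f \<xi>)"
    have e: "integrable (mu \<alpha>) (\<lambda>\<xi>. complex_of_real (exp (- pi * s * \<xi>\<^sup>2)))"
      using hankel_L1_gauss_hankel_kernel(1)[OF s, of 0] hankel_kernel_eq[OF a, of 0] by simp
    have g: "integrable (mu \<alpha>) ?g"
      using hankel_L1_bound[OF f] by (intro integrable_bounded_times[OF e, where C = C]) (auto simp: C_def)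
    have Hg: "hankel_L1 \<alpha> ?g x = (\<integral>y. complex_of_real (heat \<alpha> s x y) * cnj (f y) \<partial>mu \<alpha>)" for x
    proof -
      have "hankel_L1 \<alpha> ?g x = (\<integral>\<xi>. complex_of_real (exp (- pi * s * \<xi>\<^sup>2)) * hankel_L1 \<alpha> (\<lambda>x. cnj (f x)) \<xi> * complex_of_real (hankel_kernel \<alpha> x \<xi>) \<partial>mu \<alpha>)"
        unfolding hankel_L1_def[of \<alpha> ?g] hankel_L1_cnj hankel_kernel_commute[of \<alpha> _ x] ..
      also have "\<dots> = (\<integral>y. complex_of_real (heat \<alpha> s x y) * cnj (f y) \<partial>mu \<alpha>)"
        using f by (intro gauss_regularization s) simp
      finally show ?thesis .
    qed
    have gi: "integrable (mu \<alpha>) (\<lambda>\<xi>. hankel_L1 \<alpha> f \<xi> * ?g \<xi>)"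
      using integrable_bounded_times[OF g Hm, where C = C] hankel_L1_bound[OF f] by (simp add: C_def mult.commute)
    have sq: "hankel_L1 \<alpha> f \<xi> * ?g \<xi> = complex_of_real ((cmod (hankel_L1 \<alpha> f \<xi>))\<^sup>2 * exp (- pi * s * \<xi>\<^sup>2))" for \<xi>
      unfolding of_real_mult complex_norm_square by (simp add: mult_ac)
    have ri: "integrable (mu \<alpha>) (\<lambda>\<xi>. (cmod (hankel_L1 \<alpha> f \<xi>))\<^sup>2 * exp (- pi * s * \<xi>\<^sup>2))"
      using gi unfolding sq by (simp only: complex_of_real_integrable_eq)
    have "(\<integral>\<^sup>+\<xi>. ennreal ((cmod (hankel_L1 \<alpha> f \<xi>))\<^sup>2 * exp (- pi * s * \<xi>\<^sup>2)) \<partial>mu \<alpha>)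
       = ennreal (\<integral>\<xi>. (cmod (hankel_L1 \<alpha> f \<xi>))\<^sup>2 * exp (- pi * s * \<xi>\<^sup>2) \<partial>mu \<alpha>)"
      by (rule nn_integral_eq_integral[OF ri]) auto
    also have "(\<integral>\<xi>. (cmod (hankel_L1 \<alpha> f \<xi>))\<^sup>2 * exp (- pi * s * \<xi>\<^sup>2) \<partial>mu \<alpha>) \<le> norm (\<integral>\<xi>. hankel_L1 \<alpha> f \<xi> * ?g \<xi> \<partial>mu \<alpha>)"
      unfolding sq integral_complex_of_real by simp
    also have "(\<integral>\<xi>. hankel_L1 \<alpha> f \<xi> * ?g \<xi> \<partial>mu \<alpha>) = (\<integral>x. f x * hankel_L1 \<alpha> ?g x \<partial>mu \<alpha>)"
      by (rule hankel_L1_mult_formula[OF f g])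
    also have "ennreal (norm \<dots>) \<le> (\<integral>\<^sup>+x. ennreal (norm (f x * hankel_L1 \<alpha> ?g x)) \<partial>mu \<alpha>)"
      by (rule norm_integral_le_nn_integral)
    also have "\<dots> \<le> (\<integral>\<^sup>+x. ennreal (cmod (f x)) * (\<integral>\<^sup>+y. ennreal (heat \<alpha> s x y) * ennreal (cmod (f y)) \<partial>mu \<alpha>) \<partial>mu \<alpha>)"
    proof (intro nn_integral_mono)
      fix x
      have "ennreal (norm (hankel_L1 \<alpha> ?g x)) \<le> (\<integral>\<^sup>+y. ennreal (norm (complex_of_real (heat \<alpha> s x y) * cnj (f y))) \<partial>mu \<alpha>)"
        unfolding Hg by (rule norm_integral_le_nn_integral)
      also have "\<dots> = (\<integral>\<^sup>+y. ennreal (heat \<alpha> s x y) * ennreal (cmod (f y)) \<partial>mu \<alpha>)"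
        using heat_nonneg[OF a] by (simp add: norm_mult ennreal_mult)
      finally show "ennreal (norm (f x * hankel_L1 \<alpha> ?g x)) \<le> ennreal (cmod (f x)) * (\<integral>\<^sup>+y. ennreal (heat \<alpha> s x y) * ennreal (cmod (f y)) \<partial>mu \<alpha>)"
        unfolding norm_mult by (subst ennreal_mult) (auto intro: mult_left_mono)
    qed
    also have "\<dots> \<le> energy \<alpha> f" by (rule heat_form_le[OF fm s])
    finally show ?thesis by (simp add: ennreal_leI)
  qed
  have lim: "(\<lambda>n. ennreal ((cmod (hankel_L1 \<alpha> f \<xi>))\<^sup>2 * exp (- pi * (1 / real (Suc n)) * \<xi>\<^sup>2))) \<longlonglongrightarrow> ennreal ((cmod (hankel_L1 \<alpha> f \<xi>))\<^sup>2)" for \<xi>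
  proof -
    have "(\<lambda>n. (cmod (hankel_L1 \<alpha> f \<xi>))\<^sup>2 * exp (- pi * (1 / real (Suc n)) * \<xi>\<^sup>2)) \<longlonglongrightarrow> (cmod (hankel_L1 \<alpha> f \<xi>))\<^sup>2 * exp (- pi * 0 * \<xi>\<^sup>2)"
      by (intro tendsto_intros LIMSEQ_Suc[OF lim_1_over_n])
    thus ?thesis by (intro tendsto_ennrealI) simp
  qed
  have "energy \<alpha> (hankel_L1 \<alpha> f) = (\<integral>\<^sup>+\<xi>. liminf (\<lambda>n. ennreal ((cmod (hankel_L1 \<alpha> f \<xi>))\<^sup>2 * exp (- pi * (1 / real (Suc n)) * \<xi>\<^sup>2))) \<partial>mu \<alpha>)"
    unfolding energy_def using lim_imp_Liminf[OF _ lim] by simp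
  also have "\<dots> \<le> liminf (\<lambda>n. \<integral>\<^sup>+\<xi>. ennreal ((cmod (hankel_L1 \<alpha> f \<xi>))\<^sup>2 * exp (- pi * (1 / real (Suc n)) * \<xi>\<^sup>2)) \<partial>mu \<alpha>)"
    by (intro nn_integral_liminf) measurable
  also have "\<dots> \<le> liminf (\<lambda>n. energy \<alpha> f)"
    by (intro Liminf_mono always_eventually allI reg) simp
  also have "\<dots> = energy \<alpha> f" by (simp add: Liminf_const)
  finally show ?thesis .
qed

end

section \<open>Norm, triangle inequality and completeness\<close>

text \<open>The real-valued norm. It is meaningful on functions of finite energy only, since \<^const>\<open>enn2real\<close> sends \<open>\<infinity>\<close> to \<open>0\<close>.\<close>

definition rnorm :: "real \<Rightarrow> (real \<Rightarrow> complex) \<Rightarrow> real" where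
  "rnorm \<alpha> f = sqrt (enn2real (energy \<alpha> f))"

lemma rnorm_nonneg [simp]: "rnorm \<alpha> f \<ge> 0" by (simp add: rnorm_def)

lemma rnorm_sq: "(rnorm \<alpha> f)\<^sup>2 = enn2real (energy \<alpha> f)" by (simp add: rnorm_def)

lemma energy_eq_rn: "energy \<alpha> f < \<infinity> \<Longrightarrow> energy \<alpha> f = ennreal ((rnorm \<alpha> f)\<^sup>2)"
  by (simp add: rnorm_sq)

lemma l2_norm_eq_rn: "energy \<alpha> f < \<infinity> \<Longrightarrow> l2_norm \<alpha> f = ennreal (rnorm \<alpha> f)"
  by (auto simp: l2_norm_eq rnorm_def)

lemma rnorm_le_iff: "energy \<alpha> f < \<infinity> \<Longrightarrow> c \<ge> 0 \<Longrightarrow> rnorm \<alpha> f \<le> c \<longleftrightarrow> energy \<alpha> f \<le> ennreal (c\<^sup>2)"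
  by (subst energy_eq_rn) auto

lemma L2_measurable: "f \<in> L2 \<alpha> \<Longrightarrow> f \<in> borel_measurable (mu \<alpha>)" by (simp add: L2_iff)
lemma L2_finite: "f \<in> L2 \<alpha> \<Longrightarrow> energy \<alpha> f < \<infinity>" by (simp add: L2_iff)

lemma energy_mono: "(\<And>x. x \<ge> 0 \<Longrightarrow> cmod (f x) \<le> cmod (g x)) \<Longrightarrow> energy \<alpha> f \<le> energy \<alpha> g"
  unfolding energy_def by (intro nn_integral_mono ennreal_leI power_mono) auto

lemma energy_cong: "(\<And>x. x \<ge> 0 \<Longrightarrow> cmod (f x) = cmod (g x)) \<Longrightarrow> energy \<alpha> f = energy \<alpha> g"
  unfolding energy_def by (intro nn_integral_cong) auto

lemma energy_cmult: "f \<in> borel_measurable (mu \<alpha>) \<Longrightarrow> energy \<alpha> (\<lambda>x. c * f x) = ennreal ((cmod c)\<^sup>2) * energy \<alpha> f"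
  unfolding energy_def by (subst nn_integral_cmult[symmetric]) (auto simp: norm_mult power_mult_distrib ennreal_mult)

lemma energy_add_le:
  assumes [measurable]: "f \<in> borel_measurable (mu \<alpha>)" "g \<in> borel_measurable (mu \<alpha>)" and k: "\<kappa> > 0"
  shows "energy \<alpha> (\<lambda>x. f x + g x) \<le> ennreal (1 + \<kappa>) * energy \<alpha> f + ennreal (1 + 1 / \<kappa>) * energy \<alpha> g"
proof -
  have "(cmod (z + w))\<^sup>2 \<le> (1 + \<kappa>) * (cmod z)\<^sup>2 + (1 + 1 / \<kappa>) * (cmod w)\<^sup>2" for z w
  proof -
    have "(cmod (z + w))\<^sup>2 \<le> (cmod z + cmod w)\<^sup>2" by (intro power_mono norm_triangle_ineq) auto
    also have "\<dots> = (1 + \<kappa>) * (cmod z)\<^sup>2 + (1 + 1 / \<kappa>) * (cmod w)\<^sup>2 - (\<kappa> * cmod z - cmod w)\<^sup>2 / \<kappa>"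
      using k by (simp add: power2_eq_square field_simps)
    also have "\<dots> \<le> (1 + \<kappa>) * (cmod z)\<^sup>2 + (1 + 1 / \<kappa>) * (cmod w)\<^sup>2" using k by simp
    finally show ?thesis .
  qed
  hence "energy \<alpha> (\<lambda>x. f x + g x) \<le> (\<integral>\<^sup>+x. ennreal ((1 + \<kappa>) * (cmod (f x))\<^sup>2 + (1 + 1 / \<kappa>) * (cmod (g x))\<^sup>2) \<partial>mu \<alpha>)"
    unfolding energy_def by (intro nn_integral_mono ennreal_leI) auto
  also have "\<dots> = (\<integral>\<^sup>+x. ennreal (1 + \<kappa>) * ennreal ((cmod (f x))\<^sup>2) + ennreal (1 + 1 / \<kappa>) * ennreal ((cmod (g x))\<^sup>2) \<partial>mu \<alpha>)"
    using k by (intro nn_integral_cong) (simp add: ennreal_mult ennreal_plus)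
  also have "\<dots> = ennreal (1 + \<kappa>) * energy \<alpha> f + ennreal (1 + 1 / \<kappa>) * energy \<alpha> g"
    unfolding energy_def by (simp add: nn_integral_add nn_integral_cmult)
  finally show ?thesis .
qed

lemma L2_add: "f \<in> L2 \<alpha> \<Longrightarrow> g \<in> L2 \<alpha> \<Longrightarrow> (\<lambda>x. f x + g x) \<in> L2 \<alpha>"
proof -
  assume f: "f \<in> L2 \<alpha>" and g: "g \<in> L2 \<alpha>"
  note [measurable] = L2_measurable[OF f] L2_measurable[OF g]
  have "energy \<alpha> (\<lambda>x. f x + g x) \<le> ennreal (1 + 1) * energy \<alpha> f + ennreal (1 + 1 / 1) * energy \<alpha> g"
    by (rule energy_add_le) auto
  also have "\<dots> < \<infinity>" using L2_finite[OF f] L2_finite[OF g] by (simp add: ennreal_mult_less_top)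
  finally show ?thesis by (simp add: L2_iff)
qed

lemma L2_cmult: "f \<in> L2 \<alpha> \<Longrightarrow> (\<lambda>x. c * f x) \<in> L2 \<alpha>"
  by (auto simp: L2_iff energy_cmult ennreal_mult_less_top)

lemma L2_diff: "f \<in> L2 \<alpha> \<Longrightarrow> g \<in> L2 \<alpha> \<Longrightarrow> (\<lambda>x. f x - g x) \<in> L2 \<alpha>"
  using L2_add[of f \<alpha> "\<lambda>x. (-1) * g x"] L2_cmult[of g \<alpha> "-1"] by simp

lemma L2_dominated: "g \<in> L2 \<alpha> \<Longrightarrow> f \<in> borel_measurable (mu \<alpha>) \<Longrightarrow> (\<And>x. x \<ge> 0 \<Longrightarrow> cmod (f x) \<le> cmod (g x)) \<Longrightarrow> f \<in> L2 \<alpha>"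
  using order.strict_trans1[OF energy_mono[of f g \<alpha>] L2_finite] by (simp add: L2_iff)

text \<open>Optimise \<open>\<kappa>\<close> in \<open>energy_add_le\<close>: the best value is the quotient of the two norms. Both norms are first enlarged by
  \<open>e/2\<close> to make the quotient well defined.\<close>

lemma rnorm_triangle:
  assumes f: "f \<in> L2 \<alpha>" and g: "g \<in> L2 \<alpha>"
  shows "rnorm \<alpha> (\<lambda>x. f x + g x) \<le> rnorm \<alpha> f + rnorm \<alpha> g"
proof (rule field_le_epsilon)
  fix e :: real assume e: "e > 0"
  define A where "A = rnorm \<alpha> f + e/2"
  define B where "B = rnorm \<alpha> g + e/2"
  have AB: "A > 0" "B > 0" using e rnorm_nonneg[of \<alpha> f] rnorm_nonneg[of \<alpha> g] unfolding A_def B_def by linarith+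
  have "energy \<alpha> (\<lambda>x. f x + g x) \<le> ennreal (1 + B/A) * energy \<alpha> f + ennreal (1 + 1 / (B/A)) * energy \<alpha> g"
    using f g AB by (intro energy_add_le) (auto simp: L2_iff)
  also have "\<dots> \<le> ennreal (1 + B/A) * ennreal (A\<^sup>2) + ennreal (1 + 1 / (B/A)) * ennreal (B\<^sup>2)"
    using e rnorm_le_iff[OF L2_finite[OF f], of A] rnorm_le_iff[OF L2_finite[OF g], of B] AB
    by (intro add_mono mult_left_mono) (auto simp: A_def B_def)
  also have "\<dots> = ennreal ((1 + B/A) * A\<^sup>2 + (1 + 1 / (B/A)) * B\<^sup>2)"
    using AB by (simp add: ennreal_mult ennreal_plus)
  also have "(1 + B/A) * A\<^sup>2 + (1 + 1 / (B/A)) * B\<^sup>2 = (A + B)\<^sup>2"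
    using AB by (simp add: power2_eq_square field_simps)
  finally have "rnorm \<alpha> (\<lambda>x. f x + g x) \<le> A + B"
    using L2_finite[OF L2_add[OF f g]] AB by (subst rnorm_le_iff) auto
  thus "rnorm \<alpha> (\<lambda>x. f x + g x) \<le> rnorm \<alpha> f + rnorm \<alpha> g + e" by (simp add: A_def B_def)
qed

lemma rnorm_minus_commute: "rnorm \<alpha> (\<lambda>x. f x - g x) = rnorm \<alpha> (\<lambda>x. g x - f x)"
  unfolding rnorm_def by (subst energy_cong[of _ "\<lambda>x. g x - f x"]) (auto simp: norm_minus_commute)

lemma rnorm_diff_abs:
  assumes f: "f \<in> L2 \<alpha>" and g: "g \<in> L2 \<alpha>"
  shows "\<bar>rnorm \<alpha> f - rnorm \<alpha> g\<bar> \<le> rnorm \<alpha> (\<lambda>x. f x - g x)"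
  using rnorm_triangle[OF L2_diff[OF f g] g] rnorm_triangle[OF L2_diff[OF g f] f] rnorm_minus_commute[of \<alpha> f g] by simp

lemma rnorm_triangle3:
  assumes "f \<in> L2 \<alpha>" "g \<in> L2 \<alpha>" "h \<in> L2 \<alpha>"
  shows "rnorm \<alpha> (\<lambda>x. f x - h x) \<le> rnorm \<alpha> (\<lambda>x. f x - g x) + rnorm \<alpha> (\<lambda>x. g x - h x)"
  using rnorm_triangle[OF L2_diff[OF assms(1,2)] L2_diff[OF assms(2,3)]] by simp

lemma rnorm_tendsto:
  assumes "\<And>n. f n \<in> L2 \<alpha>" "g \<in> L2 \<alpha>" and l: "(\<lambda>n. rnorm \<alpha> (\<lambda>x. f n x - g x)) \<longlonglongrightarrow> 0"
  shows "(\<lambda>n. rnorm \<alpha> (f n)) \<longlonglongrightarrow> rnorm \<alpha> g"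
proof (rule LIM_zero_cancel, rule tendsto_rabs_zero_cancel, rule tendsto_sandwich[OF _ _ tendsto_const l])
  show "\<forall>\<^sub>F n in sequentially. \<bar>rnorm \<alpha> (f n) - rnorm \<alpha> g\<bar> \<le> rnorm \<alpha> (\<lambda>x. f n x - g x)"
    using rnorm_diff_abs assms by (intro always_eventually) auto
qed auto

lemma rnorm_tendsto_0_iff:
  assumes "\<And>n. f n \<in> L2 \<alpha>"
  shows "(\<lambda>n. l2_norm \<alpha> (f n)) \<longlonglongrightarrow> 0 \<longleftrightarrow> (\<lambda>n. rnorm \<alpha> (f n)) \<longlonglongrightarrow> 0"
proof -
  have "(\<lambda>n. l2_norm \<alpha> (f n)) = (\<lambda>n. ennreal (rnorm \<alpha> (f n)))"
    using l2_norm_eq_rn[OF L2_finite[OF assms]] by simp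
  thus ?thesis by (simp add: tendsto_ennreal_iff flip: ennreal_0)
qed

lemma energy_dominated_tendsto:
  assumes "\<And>n. f n \<in> L2 \<alpha>" "g \<in> L2 \<alpha>"
    and dom: "\<And>n x. x \<ge> 0 \<Longrightarrow> cmod (f n x) \<le> w x" and dom_g: "\<And>x. x \<ge> 0 \<Longrightarrow> cmod (g x) \<le> w x"
    and w: "(\<lambda>x. complex_of_real (w x)) \<in> L2 \<alpha>"
    and lim: "AE x in mu \<alpha>. (\<lambda>n. f n x) \<longlonglongrightarrow> g x"
  shows "(\<lambda>n. rnorm \<alpha> (\<lambda>x. f n x - g x)) \<longlonglongrightarrow> 0"
proof -
  have fm [measurable]: "f n \<in> borel_measurable (mu \<alpha>)" "g \<in> borel_measurable (mu \<alpha>)" for n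
    using assms(1,2) by (auto simp: L2_iff)
  have w2: "(\<lambda>x. complex_of_real (2 * w x)) \<in> L2 \<alpha>" using L2_cmult[OF w, of 2] by simp
  have [measurable]: "w \<in> borel_measurable (mu \<alpha>)"
    using measurable_compose[OF L2_measurable[OF w] borel_measurable_Re] by simp
  have "(\<lambda>n. \<integral>\<^sup>+x. ennreal ((cmod (f n x - g x))\<^sup>2) \<partial>mu \<alpha>) \<longlonglongrightarrow> (\<integral>\<^sup>+x. 0 \<partial>mu \<alpha>)"
  proof (rule nn_integral_dominated_convergence[where w = "\<lambda>x. ennreal ((cmod (complex_of_real (2 * w x)))\<^sup>2)"])
    show "AE x in mu \<alpha>. ennreal ((cmod (f j x - g x))\<^sup>2) \<le> ennreal ((cmod (complex_of_real (2 * w x)))\<^sup>2)" for j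
    proof (rule AE_I2, rule ennreal_leI, rule power_mono)
      fix x assume "x \<in> space (mu \<alpha>)"
      hence "cmod (f j x) \<le> w x" "cmod (g x) \<le> w x" using dom dom_g by auto
      thus "cmod (f j x - g x) \<le> cmod (complex_of_real (2 * w x))"
        using norm_triangle_ineq4[of "f j x" "g x"] unfolding norm_of_real by linarith
    qed auto
    show "(\<integral>\<^sup>+x. ennreal ((cmod (complex_of_real (2 * w x)))\<^sup>2) \<partial>mu \<alpha>) < \<infinity>"
      using L2_finite[OF w2] by (simp add: energy_def)
    show "AE x in mu \<alpha>. (\<lambda>i. ennreal ((cmod (f i x - g x))\<^sup>2)) \<longlonglongrightarrow> 0"
      using lim
    proof eventually_elim
      case (elim x)
      hence "(\<lambda>n. (cmod (f n x - g x))\<^sup>2) \<longlonglongrightarrow> (cmod (g x - g x))\<^sup>2" by (intro tendsto_intros)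
      thus ?case by (simp add: tendsto_ennreal_iff flip: ennreal_0)
    qed
  qed auto
  hence "(\<lambda>n. energy \<alpha> (\<lambda>x. f n x - g x)) \<longlonglongrightarrow> 0" by (simp add: energy_def)
  hence "(\<lambda>n. enn2real (energy \<alpha> (\<lambda>x. f n x - g x))) \<longlonglongrightarrow> enn2real 0" by (intro tendsto_enn2real) auto
  hence "(\<lambda>n. sqrt (enn2real (energy \<alpha> (\<lambda>x. f n x - g x)))) \<longlonglongrightarrow> sqrt 0" by (intro tendsto_real_sqrt) simp
  thus ?thesis by (simp add: rnorm_def)
qed

lemma L2_indicator:
  assumes "f \<in> L2 \<alpha>" "A \<in> sets (mu \<alpha>)"
  shows "(\<lambda>x. indicator A x * f x) \<in> L2 \<alpha>"
proof -
  have [measurable]: "f \<in> borel_measurable (mu \<alpha>)" "A \<in> sets (mu \<alpha>)" using assms by (auto simp: L2_iff)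
  show ?thesis by (rule L2_dominated[OF assms(1)]) (measurable, auto split: split_indicator)
qed

text \<open>Along a subsequence with increments \<open>d\<^sub>k\<close> of norm at most \<open>4\<^sup>-\<^sup>k\<close> the sum of \<open>4\<^sup>k \<bar>d\<^sub>k\<bar>\<^sup>2\<close> is integrable. Hence \<open>\<bar>d\<^sub>k\<bar>\<close> is
  almost everywhere bounded by a constant times \<open>2\<^sup>-\<^sup>k\<close>, and the subsequence converges there. Fatou's lemma identifies the
  limit in norm.\<close>

lemma L2_complete:
  assumes h: "\<And>n. h n \<in> L2 \<alpha>"
    and cauchy: "\<And>e. e > 0 \<Longrightarrow> \<exists>N. \<forall>m\<ge>N. \<forall>n\<ge>N. rnorm \<alpha> (\<lambda>x. h m x - h n x) \<le> e"
  shows "\<exists>g\<in>L2 \<alpha>. (\<lambda>n. rnorm \<alpha> (\<lambda>x. h n x - g x)) \<longlonglongrightarrow> 0"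
proof -
  have hm [measurable]: "h n \<in> borel_measurable (mu \<alpha>)" for n using h by (rule L2_measurable)
  have "\<exists>N. \<forall>k. N k < N (Suc k) \<and> (\<forall>m\<ge>N k. \<forall>n\<ge>N k. rnorm \<alpha> (\<lambda>x. h m x - h n x) \<le> (1/4) ^ k)"
  proof -
    have "\<exists>N. \<forall>k. (\<forall>m\<ge>N k. \<forall>n\<ge>N k. rnorm \<alpha> (\<lambda>x. h m x - h n x) \<le> (1/4) ^ k) \<and> N k < N (Suc k)"
    proof (rule dependent_nat_choice)
      show "\<exists>x. \<forall>m\<ge>x. \<forall>n\<ge>x. rnorm \<alpha> (\<lambda>z. h m z - h n z) \<le> (1/4) ^ 0" using cauchy[of 1] by simp
    next
      fix M k
      obtain N where "\<forall>m\<ge>N. \<forall>n\<ge>N. rnorm \<alpha> (\<lambda>x. h m x - h n x) \<le> (1/4) ^ Suc k"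
        using cauchy[of "(1/4) ^ Suc k"] by auto
      thus "\<exists>y. (\<forall>m\<ge>y. \<forall>n\<ge>y. rnorm \<alpha> (\<lambda>x. h m x - h n x) \<le> (1/4) ^ Suc k) \<and> M < y"
        by (intro exI[of _ "max N (Suc M)"]) auto
    qed
    thus ?thesis by blast
  qed
  then obtain N where N: "\<And>k. N k < N (Suc k)" "\<And>k m n. m \<ge> N k \<Longrightarrow> n \<ge> N k \<Longrightarrow> rnorm \<alpha> (\<lambda>x. h m x - h n x) \<le> (1/4) ^ k"
    by blast
  define d where "d = (\<lambda>k x. h (N (Suc k)) x - h (N k) x)"
  have dL: "energy \<alpha> (d k) \<le> ennreal (((1/4) ^ k)\<^sup>2)" for k
  proof -
    have "d k \<in> L2 \<alpha>" unfolding d_def by (intro L2_diff h)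
    moreover have "rnorm \<alpha> (d k) \<le> (1/4) ^ k" unfolding d_def using N(1)[of k] by (intro N(2)) auto
    ultimately show ?thesis using rnorm_le_iff[OF L2_finite] by simp
  qed
  have dm [measurable]: "d k \<in> borel_measurable (mu \<alpha>)" for k unfolding d_def by measurable
  have "(\<integral>\<^sup>+x. (\<Sum>k. ennreal (4 ^ k) * ennreal ((cmod (d k x))\<^sup>2)) \<partial>mu \<alpha>) = (\<Sum>k. \<integral>\<^sup>+x. ennreal (4 ^ k) * ennreal ((cmod (d k x))\<^sup>2) \<partial>mu \<alpha>)"
    by (rule nn_integral_suminf) measurable
  also have "\<dots> = (\<Sum>k. ennreal (4 ^ k) * energy \<alpha> (d k))" unfolding energy_def by (simp add: nn_integral_cmult)
  also have "\<dots> \<le> (\<Sum>k. ennreal ((1/4) ^ k))"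
  proof (rule suminf_le)
    fix k
    have "ennreal (4 ^ k) * energy \<alpha> (d k) \<le> ennreal (4 ^ k) * ennreal (((1/4) ^ k)\<^sup>2)" by (intro mult_left_mono dL) auto
    also have "\<dots> = ennreal (4 ^ k * ((1/4) ^ k)\<^sup>2)" by (simp add: ennreal_mult)
    also have "4 ^ k * ((1/4) ^ k)\<^sup>2 = ((1/4)::real) ^ k"
      by (simp add: power2_eq_square flip: power_mult_distrib)
    finally show "ennreal (4 ^ k) * energy \<alpha> (d k) \<le> ennreal ((1/4) ^ k)" .
  qed auto
  also have "\<dots> < \<infinity>" by (subst suminf_ennreal2) (auto intro!: summable_geometric)
  finally have "(\<integral>\<^sup>+x. (\<Sum>k. ennreal (4 ^ k) * ennreal ((cmod (d k x))\<^sup>2)) \<partial>mu \<alpha>) \<noteq> \<infinity>" by simp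
  hence "AE x in mu \<alpha>. (\<Sum>k. ennreal (4 ^ k) * ennreal ((cmod (d k x))\<^sup>2)) \<noteq> \<infinity>"
    by (intro nn_integral_PInf_AE) auto
  hence conv: "AE x in mu \<alpha>. convergent (\<lambda>k. h (N k) x)"
  proof eventually_elim
    case (elim x)
    define S where "S = (\<Sum>k. ennreal (4 ^ k) * ennreal ((cmod (d k x))\<^sup>2))"
    have b: "cmod (d k x) \<le> sqrt (enn2real S) * (1/2) ^ k" for k
    proof -
      have "ennreal (4 ^ k * (cmod (d k x))\<^sup>2) \<le> S"
        using sum_le_suminf[of "\<lambda>k. ennreal (4 ^ k) * ennreal ((cmod (d k x))\<^sup>2)" "{k}"]
        unfolding S_def by (simp add: ennreal_mult)
      hence "4 ^ k * (cmod (d k x))\<^sup>2 \<le> enn2real S" using elim unfolding S_def[symmetric]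
        by (metis enn2real_ennreal enn2real_mono infinity_ennreal_def less_top mult_nonneg_nonneg zero_le_numeral zero_le_power zero_le_power2)
      hence "sqrt (4 ^ k * (cmod (d k x))\<^sup>2) \<le> sqrt (enn2real S)" by (rule real_sqrt_le_mono)
      moreover have "sqrt (4 ^ k * (cmod (d k x))\<^sup>2) = 2 ^ k * cmod (d k x)"
        by (simp add: real_sqrt_mult real_sqrt_power)
      ultimately show ?thesis by (simp add: field_simps power_divide)
    qed
    have "summable (\<lambda>k. d k x)"
      by (rule summable_comparison_test'[of "\<lambda>k. sqrt (enn2real S) * (1/2) ^ k" 0])
         (auto intro!: summable_mult summable_geometric b)
    hence "convergent (\<lambda>n. \<Sum>k<n. d k x)" by (simp add: summable_iff_convergent)
    moreover have "(\<Sum>k<n. d k x) = h (N n) x - h (N 0) x" for n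
      unfolding d_def by (rule sum_lessThan_telescope)
    ultimately have "convergent (\<lambda>n. h (N n) x - h (N 0) x)" by simp
    from convergent_add[OF this convergent_const[of "h (N 0) x"]] show ?case by simp
  qed
  define g where "g = (\<lambda>x. lim (\<lambda>k. h (N k) x))"
  have gm [measurable]: "g \<in> borel_measurable (mu \<alpha>)" unfolding g_def by measurable
  have key: "energy \<alpha> (\<lambda>x. h n x - g x) \<le> ennreal (((1/4) ^ j)\<^sup>2)" if n: "n \<ge> N j" for n j
  proof -
    have mono: "N j \<le> N k" if "j \<le> k" for k using lift_Suc_mono_le[of N] N(1) that by (metis less_imp_le)
    have "energy \<alpha> (\<lambda>x. h n x - g x) = (\<integral>\<^sup>+x. liminf (\<lambda>k. ennreal ((cmod (h n x - h (N k) x))\<^sup>2)) \<partial>mu \<alpha>)"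
      unfolding energy_def
    proof (intro nn_integral_cong_AE)
      show "AE x in mu \<alpha>. ennreal ((cmod (h n x - g x))\<^sup>2) = liminf (\<lambda>k. ennreal ((cmod (h n x - h (N k) x))\<^sup>2))"
        using conv
      proof eventually_elim
        case (elim x)
        hence "(\<lambda>k. h (N k) x) \<longlonglongrightarrow> g x" unfolding g_def by (rule convergent_LIMSEQ_iff[THEN iffD1])
        hence "(\<lambda>k. ennreal ((cmod (h n x - h (N k) x))\<^sup>2)) \<longlonglongrightarrow> ennreal ((cmod (h n x - g x))\<^sup>2)"
          by (intro tendsto_ennrealI tendsto_intros)
        from lim_imp_Liminf[OF _ this] show ?case by simp
      qed
    qed
    also have "\<dots> \<le> liminf (\<lambda>k. \<integral>\<^sup>+x. ennreal ((cmod (h n x - h (N k) x))\<^sup>2) \<partial>mu \<alpha>)"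
      by (intro nn_integral_liminf) measurable
    also have "\<dots> \<le> liminf (\<lambda>k::nat. ennreal (((1/4) ^ j)\<^sup>2))"
    proof (rule Liminf_mono, rule eventually_mono[OF eventually_ge_at_top[of j]])
      fix k assume "j \<le> k"
      hence "rnorm \<alpha> (\<lambda>x. h n x - h (N k) x) \<le> (1/4) ^ j" using n mono by (intro N(2)) auto
      thus "(\<integral>\<^sup>+x. ennreal ((cmod (h n x - h (N k) x))\<^sup>2) \<partial>mu \<alpha>) \<le> ennreal (((1/4) ^ j)\<^sup>2)"
        using rnorm_le_iff[OF L2_finite[OF L2_diff[OF h h]], of "(1/4) ^ j" n "N k"] by (simp add: energy_def)
    qed
    also have "\<dots> = ennreal (((1/4) ^ j)\<^sup>2)" by (simp add: Liminf_const)
    finally show ?thesis .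
  qed
  have diffL: "(\<lambda>x. h n x - g x) \<in> L2 \<alpha>" if "n \<ge> N 0" for n
    using order.strict_trans1[OF key[OF that] ennreal_less_top] hm gm by (simp add: L2_iff)
  have gL: "g \<in> L2 \<alpha>" using L2_diff[OF h[of "N 0"] diffL[of "N 0"]] by simp
  have "(\<lambda>n. rnorm \<alpha> (\<lambda>x. h n x - g x)) \<longlonglongrightarrow> 0"
  proof (rule LIMSEQ_I)
    fix e :: real assume "e > 0"
    then obtain j where j: "(1/4) ^ j < e" using real_arch_pow_inv[of e "1/4"] by auto
    have "rnorm \<alpha> (\<lambda>x. h n x - g x) \<le> (1/4) ^ j" if "n \<ge> N j" for n
      using key[OF that] rnorm_le_iff[OF L2_finite[OF L2_diff[OF h gL]], of "(1/4) ^ j" n] by simp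
    thus "\<exists>no. \<forall>n\<ge>no. norm (rnorm \<alpha> (\<lambda>x. h n x - g x) - 0) < e"
      using j by (intro exI[of _ "N j"]) (auto intro: le_less_trans)
  qed
  thus ?thesis using gL by blast
qed

section \<open>Plancherel's theorem for integrable functions\<close>

context
  fixes \<alpha> :: real assumes a: "\<alpha> > -1/2"
begin

text \<open>The functions on which the transform is pointwise its own inverse. They include all Gaussians.\<close>

definition inversion_class :: "(real \<Rightarrow> complex) set" where
  "inversion_class = {f \<in> L2 \<alpha>. integrable (mu \<alpha>) f \<and> integrable (mu \<alpha>) (hankel_L1 \<alpha> f) \<and> (\<forall>y. hankel_L1 \<alpha> (hankel_L1 \<alpha> f) y = f y)}"

lemma hankel_L1_L2:
  assumes "integrable (mu \<alpha>) f" "f \<in> L2 \<alpha>" shows "hankel_L1 \<alpha> f \<in> L2 \<alpha>"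
  using order.strict_trans1[OF hankel_L1_contraction[OF a assms(1)] L2_finite[OF assms(2)]] hankel_L1_measurable[OF a L2_measurable[OF assms(2)]]
  by (simp add: L2_iff)

text \<open>The multiplication formula for \<open>f\<close> and the complex conjugate of its transform; the transform of the latter is
  the conjugate of \<open>f\<close>.\<close>

lemma inversion_class_isometry:
  assumes f: "f \<in> inversion_class"
  shows "energy \<alpha> (hankel_L1 \<alpha> f) = energy \<alpha> f"
proof -
  have f1: "integrable (mu \<alpha>) f" and f2: "f \<in> L2 \<alpha>" and Hf: "integrable (mu \<alpha>) (hankel_L1 \<alpha> f)" and inv: "\<And>y. hankel_L1 \<alpha> (hankel_L1 \<alpha> f) y = f y"
    using f by (auto simp: inversion_class_def)
  let ?g = "hankel_L1 \<alpha> (\<lambda>x. cnj (f x))"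
  have ge: "?g = (\<lambda>y. cnj (hankel_L1 \<alpha> f y))" by (rule ext) (rule hankel_L1_cnj[OF a])
  have g: "integrable (mu \<alpha>) ?g" unfolding ge using Hf by simp
  have Hg: "hankel_L1 \<alpha> ?g y = cnj (f y)" for y unfolding ge hankel_L1_cnj[OF a] inv ..
  have mult: "(\<integral>x. hankel_L1 \<alpha> f x * cnj (hankel_L1 \<alpha> f x) \<partial>mu \<alpha>) = (\<integral>x. f x * cnj (f x) \<partial>mu \<alpha>)"
    using hankel_L1_mult_formula[OF a f1 g] unfolding Hg by (simp only: ge)
  have E: "energy \<alpha> h = ennreal (norm (\<integral>x. h x * cnj (h x) \<partial>mu \<alpha>))" if "h \<in> L2 \<alpha>" for h
  proof -
    have [measurable]: "h \<in> borel_measurable (mu \<alpha>)" using that by (rule L2_measurable)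
    have i: "integrable (mu \<alpha>) (\<lambda>x. (cmod (h x))\<^sup>2)"
      using L2_finite[OF that] unfolding energy_def by (intro integrableI_nonneg) auto
    have "energy \<alpha> h = ennreal (\<integral>x. (cmod (h x))\<^sup>2 \<partial>mu \<alpha>)"
      unfolding energy_def by (rule nn_integral_eq_integral[OF i]) auto
    also have "(\<integral>x. (cmod (h x))\<^sup>2 \<partial>mu \<alpha>) = norm (\<integral>x. complex_of_real ((cmod (h x))\<^sup>2) \<partial>mu \<alpha>)"
      unfolding integral_complex_of_real by simp
    finally show ?thesis by (simp only: complex_norm_square)
  qed
  show ?thesis unfolding E[OF hankel_L1_L2[OF f1 f2]] E[OF f2] mult ..
qed

lemma inversion_class_add:
  assumes "f \<in> inversion_class" "g \<in> inversion_class" shows "(\<lambda>x. f x + g x) \<in> inversion_class"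
proof -
  have f: "f \<in> L2 \<alpha>" "integrable (mu \<alpha>) f" "integrable (mu \<alpha>) (hankel_L1 \<alpha> f)" "\<And>y. hankel_L1 \<alpha> (hankel_L1 \<alpha> f) y = f y"
   and g: "g \<in> L2 \<alpha>" "integrable (mu \<alpha>) g" "integrable (mu \<alpha>) (hankel_L1 \<alpha> g)" "\<And>y. hankel_L1 \<alpha> (hankel_L1 \<alpha> g) y = g y"
    using assms by (auto simp: inversion_class_def)
  have e: "hankel_L1 \<alpha> (\<lambda>x. f x + g x) = (\<lambda>y. hankel_L1 \<alpha> f y + hankel_L1 \<alpha> g y)"
    by (rule ext) (rule hankel_L1_add[OF a f(2) g(2)])
  show ?thesis unfolding inversion_class_def mem_Collect_eq e
    using f g by (auto simp: hankel_L1_add[OF a] intro!: L2_add)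
qed

lemma inversion_class_cmult:
  assumes "f \<in> inversion_class" shows "(\<lambda>x. c * f x) \<in> inversion_class"
proof -
  have f: "f \<in> L2 \<alpha>" "integrable (mu \<alpha>) f" "integrable (mu \<alpha>) (hankel_L1 \<alpha> f)" "\<And>y. hankel_L1 \<alpha> (hankel_L1 \<alpha> f) y = f y"
    using assms by (auto simp: inversion_class_def)
  have e: "hankel_L1 \<alpha> (\<lambda>x. c * f x) = (\<lambda>y. c * hankel_L1 \<alpha> f y)"
    by (rule ext) (rule hankel_L1_cmult[OF a])
  show ?thesis unfolding inversion_class_def mem_Collect_eq e
    using f by (auto simp: hankel_L1_cmult[OF a] intro!: L2_cmult)
qed

abbreviation gaussian :: "real \<Rightarrow> real \<Rightarrow> complex" where
  "gaussian t \<equiv> \<lambda>x. complex_of_real (exp (- pi * t * x\<^sup>2))"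

lemma gaussian_integrable: "t > 0 \<Longrightarrow> integrable (mu \<alpha>) (gaussian t)"
  using hankel_L1_gauss_hankel_kernel(1)[OF a, of t 0] hankel_kernel_eq[OF a, of 0] by simp

lemma hankel_L1_gaussian: assumes t: "t > 0" shows "hankel_L1 \<alpha> (gaussian t) = (\<lambda>y. complex_of_real (t powr (- (\<alpha> + 1))) * gaussian (1 / t) y)"
proof (rule ext)
  fix y
  show "hankel_L1 \<alpha> (gaussian t) y = complex_of_real (t powr (- (\<alpha> + 1))) * gaussian (1 / t) y"
    using hankel_L1_gauss_hankel_kernel(2)[OF a t, of 0 y] hankel_kernel_eq[OF a, of 0] by (simp add: heat_def)
qed

lemma gaussian_inversion_class: assumes t: "t > 0" shows "gaussian t \<in> inversion_class"
proof -
  have "gaussian t \<in> L2 \<alpha>" unfolding L2_iff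
  proof
    show m: "gaussian t \<in> borel_measurable (mu \<alpha>)" using gaussian_integrable[OF t] by auto
    have "energy \<alpha> (gaussian t) \<le> (\<integral>\<^sup>+x. ennreal (norm (gaussian t x)) \<partial>mu \<alpha>)"
      unfolding energy_def using t by (intro nn_integral_mono ennreal_leI) (auto simp: power2_eq_square mult_le_cancel_right1)
    also have "\<dots> < \<infinity>" using gaussian_integrable[OF t] by (simp add: integrable_iff_bounded)
    finally show "energy \<alpha> (gaussian t) < \<infinity>" .
  qed
  moreover have "hankel_L1 \<alpha> (hankel_L1 \<alpha> (gaussian t)) y = gaussian t y" for y
  proof -
    have t': "1 / t > 0" using t by simp
    have "t powr (- (\<alpha> + 1)) * (1 / t) powr (- (\<alpha> + 1)) = (t * (1 / t)) powr (- (\<alpha> + 1))"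
      using t by (intro powr_mult[symmetric])
    also have "\<dots> = 1" using t by simp
    finally have "complex_of_real (t powr (- (\<alpha> + 1))) * complex_of_real ((1 / t) powr (- (\<alpha> + 1))) = 1"
      by (simp only: of_real_mult[symmetric] of_real_1)
    thus ?thesis unfolding hankel_L1_gaussian[OF t] hankel_L1_cmult[OF a] hankel_L1_gaussian[OF t']
      by (simp only: mult.assoc[symmetric]) simp
  qed
  moreover have "integrable (mu \<alpha>) (hankel_L1 \<alpha> (gaussian t))"
    unfolding hankel_L1_gaussian[OF t] using t by (intro integrable_mult_right gaussian_integrable) simp
  ultimately show ?thesis using gaussian_integrable[OF t] by (simp only: inversion_class_def mem_Collect_eq) blast
qed

lemma inversion_class_sum:
  fixes n :: nat
  assumes "\<And>i. f i \<in> inversion_class" shows "(\<lambda>x. \<Sum>i\<le>n. f i x) \<in> inversion_class"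
  by (induction n) (auto intro: assms inversion_class_add)

definition inversion_closure :: "(real \<Rightarrow> complex) set" where
  "inversion_closure = {f \<in> L2 \<alpha>. \<forall>d>0. \<exists>g\<in>inversion_class. rnorm \<alpha> (\<lambda>x. f x - g x) \<le> d}"

lemma inversion_class_L2: "f \<in> inversion_class \<Longrightarrow> f \<in> L2 \<alpha>" by (simp add: inversion_class_def)

lemma inversion_closure_add:
  assumes "f \<in> inversion_closure" "g \<in> inversion_closure" shows "(\<lambda>x. f x + g x) \<in> inversion_closure"
proof -
  have f: "f \<in> L2 \<alpha>" and g: "g \<in> L2 \<alpha>" using assms by (auto simp: inversion_closure_def)
  have "\<exists>h\<in>inversion_class. rnorm \<alpha> (\<lambda>x. f x + g x - h x) \<le> d" if "d > 0" for d
  proof -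
    obtain f' g' where 1: "f' \<in> inversion_class" "rnorm \<alpha> (\<lambda>x. f x - f' x) \<le> d/2" and 2: "g' \<in> inversion_class" "rnorm \<alpha> (\<lambda>x. g x - g' x) \<le> d/2"
      using assms \<open>d > 0\<close> unfolding inversion_closure_def mem_Collect_eq by (meson half_gt_zero)
    have "rnorm \<alpha> (\<lambda>x. (f x - f' x) + (g x - g' x)) \<le> d"
      using rnorm_triangle[OF L2_diff[OF f inversion_class_L2[OF 1(1)]] L2_diff[OF g inversion_class_L2[OF 2(1)]]] 1(2) 2(2) by simp
    moreover have "(f x - f' x) + (g x - g' x) = f x + g x - (f' x + g' x)" for x by simp
    ultimately show ?thesis using inversion_class_add[OF 1(1) 2(1)] by (intro bexI[of _ "\<lambda>x. f' x + g' x"]) auto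
  qed
  thus ?thesis using L2_add[OF f g] by (simp add: inversion_closure_def)
qed

lemma rnorm_cmult: "f \<in> L2 \<alpha> \<Longrightarrow> rnorm \<alpha> (\<lambda>x. c * f x) = cmod c * rnorm \<alpha> f"
  unfolding rnorm_def by (simp add: energy_cmult[OF L2_measurable] enn2real_mult real_sqrt_mult)

lemma inversion_closure_times_ii:
  assumes "f \<in> inversion_closure" shows "(\<lambda>x. \<i> * f x) \<in> inversion_closure"
proof -
  have f: "f \<in> L2 \<alpha>" using assms by (auto simp: inversion_closure_def)
  have "\<exists>h\<in>inversion_class. rnorm \<alpha> (\<lambda>x. \<i> * f x - h x) \<le> d" if d: "d > 0" for d
  proof -
    obtain g where g: "g \<in> inversion_class" "rnorm \<alpha> (\<lambda>x. f x - g x) \<le> d"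
      using assms d unfolding inversion_closure_def by auto
    have "rnorm \<alpha> (\<lambda>x. \<i> * f x - \<i> * g x) = rnorm \<alpha> (\<lambda>x. \<i> * (f x - g x))" by (simp add: right_diff_distrib)
    also have "\<dots> \<le> d" using g by (subst rnorm_cmult) (auto intro: L2_diff f inversion_class_L2)
    finally show ?thesis using inversion_class_cmult[OF g(1), of \<i>] by auto
  qed
  thus ?thesis using L2_cmult[OF f] by (simp add: inversion_closure_def)
qed

lemma inversion_closure_closed:
  assumes f: "\<And>n. f n \<in> inversion_closure" and g: "g \<in> L2 \<alpha>" and lim: "(\<lambda>n. rnorm \<alpha> (\<lambda>x. f n x - g x)) \<longlonglongrightarrow> 0"
  shows "g \<in> inversion_closure"
proof -
  have "\<exists>h\<in>inversion_class. rnorm \<alpha> (\<lambda>x. g x - h x) \<le> d" if d: "d > 0" for d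
  proof -
    have "\<forall>\<^sub>F n in sequentially. rnorm \<alpha> (\<lambda>x. f n x - g x) < d/2"
      using order_tendstoD(2)[OF lim, of "d/2"] d by simp
    then obtain n where n: "rnorm \<alpha> (\<lambda>x. f n x - g x) < d/2"
      using eventually_happens'[OF sequentially_bot] by blast
    obtain h where h: "h \<in> inversion_class" "rnorm \<alpha> (\<lambda>x. f n x - h x) \<le> d/2"
      using f[of n] d unfolding inversion_closure_def mem_Collect_eq by (meson half_gt_zero)
    have fn: "f n \<in> L2 \<alpha>" using f[of n] by (simp add: inversion_closure_def)
    have "rnorm \<alpha> (\<lambda>x. g x - h x) \<le> rnorm \<alpha> (\<lambda>x. g x - f n x) + rnorm \<alpha> (\<lambda>x. f n x - h x)"
      by (rule rnorm_triangle3[OF g fn inversion_class_L2[OF h(1)]])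
    thus ?thesis using n h rnorm_minus_commute[of \<alpha> g "f n"] by (intro bexI[OF _ h(1)]) simp
  qed
  thus ?thesis using g by (simp add: inversion_closure_def)
qed

lemma bounded_support_L2:
  assumes [measurable]: "f \<in> borel_measurable (mu \<alpha>)" and bd: "\<And>x. x \<ge> 0 \<Longrightarrow> cmod (f x) \<le> B" and supp: "\<And>x. x > R \<Longrightarrow> f x = 0"
  shows "f \<in> L2 \<alpha>"
proof -
  have "energy \<alpha> f \<le> (\<integral>\<^sup>+x. ennreal (B\<^sup>2) * indicator {0..R} x \<partial>mu \<alpha>)"
    unfolding energy_def
  proof (intro nn_integral_mono)
    fix x assume "x \<in> space (mu \<alpha>)"
    hence x: "x \<ge> 0" by simp
    show "ennreal ((cmod (f x))\<^sup>2) \<le> ennreal (B\<^sup>2) * indicator {0..R} x"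
      using supp[of x] bd[OF x] x by (cases "x \<le> R") (auto intro!: ennreal_leI power_mono)
  qed
  also have "\<dots> = ennreal (B\<^sup>2) * emeasure (mu \<alpha>) {0..R}"
    by (intro nn_integral_cmult_indicator sets_mu_borel) auto
  also have "\<dots> < \<infinity>" using emeasure_mu_bounded[OF a, of R] by (simp add: ennreal_mult_less_top)
  finally show ?thesis by (simp add: L2_iff)
qed

text \<open>The map \<open>u = exp (- \<pi> x\<^sup>2)\<close> takes the half-line to the interval \<open>(0,1]\<close>, and \<open>h(x)/u\<close> becomes a continuous function of \<open>u\<close>
  that vanishes near \<open>0\<close>. If a polynomial \<open>p\<close> approximates it up to \<open>e\<close>, then \<open>u p(u)\<close> is a combination of Gaussians
  that differs from \<open>h\<close> by at most \<open>e u\<close>, and \<open>u\<close> is square-integrable.\<close>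

lemma inversion_closure_continuous:
  fixes h :: "real \<Rightarrow> real"
  assumes h: "continuous_on UNIV h" and R: "R > 0" "\<And>x. x \<ge> R \<Longrightarrow> h x = 0"
  shows "(\<lambda>x. complex_of_real (h x)) \<in> inversion_closure"
proof -
  \<comment> \<open>The value of u at R; below it the function of u vanishes.\<close>
  define u0 where "u0 = exp (- pi * R\<^sup>2)"
  have u0: "u0 > 0" by (simp add: u0_def)
  define q where "q = (\<lambda>u. h (sqrt (- ln (max u u0) / pi)) / max u u0)"
  have qc: "continuous_on {0..1} q"
    unfolding q_def using u0 by (intro continuous_intros continuous_on_compose2[OF h]) (auto simp: max_def)
  have qh: "exp (- pi * x\<^sup>2) * q (exp (- pi * x\<^sup>2)) = h x" if x: "x \<ge> 0" for x
  proof (cases "x \<le> R")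
    case True
    hence "x\<^sup>2 \<le> R\<^sup>2" using x by (intro power_mono) auto
    hence "max (exp (- pi * x\<^sup>2)) u0 = exp (- pi * x\<^sup>2)" by (auto simp: u0_def max_def)
    thus ?thesis using x by (simp add: q_def)
  next
    case False
    hence "R\<^sup>2 \<le> x\<^sup>2" using R by (intro power_mono) auto
    hence "max (exp (- pi * x\<^sup>2)) u0 = u0" by (auto simp: u0_def max_def)
    moreover have "sqrt (- ln u0 / pi) = R" using R by (simp add: u0_def)
    ultimately show ?thesis using False R by (simp add: q_def)
  qed
  have hm: "(\<lambda>x. complex_of_real (h x)) \<in> borel_measurable (mu \<alpha>)"
    using h by (intro measurable_mu_borel_comp borel_measurable_continuous_onI continuous_intros)
  obtain B where B: "\<And>x. x \<in> {0..R} \<Longrightarrow> \<bar>h x\<bar> \<le> B"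
  proof -
    have "compact (h ` {0..R})" using h by (intro compact_continuous_image continuous_on_subset[OF h]) auto
    hence "bounded (h ` {0..R})" by (rule compact_imp_bounded)
    then obtain B where "\<forall>y\<in>h ` {0..R}. norm y \<le> B" unfolding bounded_iff by blast
    thus ?thesis using that[of B] by simp
  qed
  have hL: "(\<lambda>x. complex_of_real (h x)) \<in> L2 \<alpha>"
  proof (rule bounded_support_L2[OF hm, of "\<bar>B\<bar>" R])
    fix x :: real assume "x \<ge> 0"
    thus "cmod (complex_of_real (h x)) \<le> \<bar>B\<bar>" using B[of x] R(2)[of x] by (cases "x \<le> R") auto
  qed (use R in auto)
  have gL: "gaussian 1 \<in> L2 \<alpha>" using gaussian_inversion_class[of 1] by (simp add: inversion_class_L2)
  have "\<exists>g\<in>inversion_class. rnorm \<alpha> (\<lambda>x. complex_of_real (h x) - g x) \<le> d" if d: "d > 0" for d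
  proof -
    define e where "e = d / (rnorm \<alpha> (gaussian 1) + 1)"
    have e: "e > 0" "e * rnorm \<alpha> (gaussian 1) \<le> d"
    proof -
      have r: "rnorm \<alpha> (gaussian 1) + 1 > 0" using rnorm_nonneg[of \<alpha> "gaussian 1"] by linarith
      show "e > 0" unfolding e_def using r d by (rule divide_pos_pos[rotated])
      moreover have "e * (rnorm \<alpha> (gaussian 1) + 1) = d" using r by (simp add: e_def)
      ultimately show "e * rnorm \<alpha> (gaussian 1) \<le> d" by (simp add: distrib_left)
    qed
    obtain p where p: "real_polynomial_function p" "\<And>u. u \<in> {0..1} \<Longrightarrow> \<bar>q u - p u\<bar> < e"
      using Stone_Weierstrass_real_polynomial_function[OF compact_Icc qc e(1)] by blast
    obtain b n where pn: "p = (\<lambda>u. \<Sum>i\<le>n. b i * u ^ i)"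
      using p(1) unfolding real_polynomial_function_iff_sum by blast
    let ?g = "\<lambda>x. \<Sum>i\<le>n. complex_of_real (b i) * gaussian (real (Suc i)) x"
    have g: "?g \<in> inversion_class" by (intro inversion_class_sum inversion_class_cmult gaussian_inversion_class) simp
    have gp: "?g x = complex_of_real (exp (- pi * x\<^sup>2) * p (exp (- pi * x\<^sup>2)))" for x
    proof -
      have "exp (- pi * real (Suc i) * x\<^sup>2) = exp (- pi * x\<^sup>2) * exp (- pi * x\<^sup>2) ^ i" for i
        unfolding exp_of_nat_mult[symmetric] exp_add[symmetric] by (simp add: algebra_simps)
      hence "(\<Sum>i\<le>n. b i * exp (- pi * real (Suc i) * x\<^sup>2)) = exp (- pi * x\<^sup>2) * p (exp (- pi * x\<^sup>2))"
        unfolding pn by (simp add: sum_distrib_left mult_ac)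
      moreover have "?g x = complex_of_real (\<Sum>i\<le>n. b i * exp (- pi * real (Suc i) * x\<^sup>2))"
        by (simp only: of_real_sum of_real_mult)
      ultimately show ?thesis by (simp only:)
    qed
    have "energy \<alpha> (\<lambda>x. complex_of_real (h x) - ?g x) \<le> energy \<alpha> (\<lambda>x. complex_of_real e * gaussian 1 x)"
    proof (rule energy_mono)
      fix x :: real assume x: "x \<ge> 0"
      let ?u = "exp (- pi * x\<^sup>2)"
      have "cmod (complex_of_real (h x) - ?g x) = \<bar>?u * q ?u - ?u * p ?u\<bar>"
        unfolding gp qh[OF x] of_real_diff[symmetric] norm_of_real ..
      also have "\<dots> = ?u * \<bar>q ?u - p ?u\<bar>" by (simp add: abs_mult flip: right_diff_distrib)
      also have "\<dots> \<le> ?u * e" using p(2)[of ?u] by (intro mult_left_mono) auto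
      finally show "cmod (complex_of_real (h x) - ?g x) \<le> cmod (complex_of_real e * gaussian 1 x)"
        using e by (simp add: norm_mult mult.commute)
    qed
    hence "rnorm \<alpha> (\<lambda>x. complex_of_real (h x) - ?g x) \<le> rnorm \<alpha> (\<lambda>x. complex_of_real e * gaussian 1 x)"
      unfolding rnorm_def using L2_finite[OF L2_cmult[OF gL]] by (intro real_sqrt_le_mono enn2real_mono) auto
    also have "\<dots> = e * rnorm \<alpha> (gaussian 1)" using e by (subst rnorm_cmult[OF gL]) simp
    finally show ?thesis using e g by (intro bexI[OF _ g]) linarith
  qed
  thus ?thesis using hL by (simp add: inversion_closure_def)
qed

lemma AE_mu_of_negligible:
  assumes "negligible N" shows "AE x in mu \<alpha>. x \<notin> N"
proof -
  have "AE x in lebesgue. x \<notin> N" using assms AE_not_in by (auto simp: negligible_iff_null_sets)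
  hence "AE x in lebesgue_on {0..}. x \<notin> N" by (auto simp: AE_restrict_space_iff elim: eventually_mono)
  thus ?thesis unfolding mu_alt by (subst AE_density) auto
qed

text \<open>A Lebesgue measurable function is almost everywhere a limit of continuous functions. Clipping their values and
  cutting them off beyond \<open>R\<close> makes the convergence dominated.\<close>

lemma inversion_closure_bounded:
  assumes f: "f \<in> borel_measurable (mu \<alpha>)" and B: "B > 0" "\<And>x. x \<ge> 0 \<Longrightarrow> cmod (f x) \<le> B" and R: "R > 0" "\<And>x. x > R \<Longrightarrow> f x = 0"
  shows "f \<in> inversion_closure"
proof -
  have "f measurable_on {0..}"
    using f by (subst measurable_on_iff_borel_measurable) (auto simp: borel_measurable_mu_iff)
  then obtain N g where N: "negligible N" and gc: "\<And>n. continuous_on UNIV (g n)"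
    and lim: "\<And>x. x \<notin> N \<Longrightarrow> (\<lambda>n. g n x) \<longlonglongrightarrow> (if x \<in> {0..} then f x else 0)"
    unfolding measurable_on_def by blast
  define chi where "chi = (\<lambda>x::real. max 0 (min 1 (R + 1 - x)))"
  define clip where "clip = (\<lambda>z. complex_of_real (B / max B (cmod z)) * z)"
  have clip_bd: "cmod (clip z) \<le> B" for z
  proof -
    have "cmod (clip z) = B * (cmod z / max B (cmod z))" unfolding clip_def norm_mult norm_of_real using B by simp
    also have "\<dots> \<le> B * 1" using B by (intro mult_left_mono) (auto simp: field_simps max_def)
    finally show ?thesis by simp
  qed
  have clip_id: "clip z = z" if "cmod z \<le> B" for z using that B by (simp add: clip_def max_def)
  have clip_c: "continuous_on UNIV clip"
    unfolding clip_def using B by (intro continuous_intros) (auto simp: max_def)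
  \<comment> \<open>Bounded by the constant B, supported in [0, R+1], and still converging to f.\<close>
  define h where "h = (\<lambda>n x. complex_of_real (chi x) * clip (g n x))"
  have hc: "continuous_on UNIV (h n)" for n
    unfolding h_def chi_def by (intro continuous_intros continuous_on_compose2[OF clip_c] gc) auto
  have hs: "h n x = 0" if "x \<ge> R + 1" for n x using that by (simp add: h_def chi_def)
  have hb: "cmod (h n x) \<le> B" for n x
  proof -
    have "cmod (h n x) = chi x * cmod (clip (g n x))" by (simp add: h_def norm_mult chi_def)
    also have "\<dots> \<le> 1 * B" by (intro mult_mono clip_bd) (auto simp: chi_def)
    finally show ?thesis by simp
  qed
  have happ: "h n \<in> inversion_closure" for n
  proof -
    have "(\<lambda>x. complex_of_real (Re (h n x)) + \<i> * complex_of_real (Im (h n x))) \<in> inversion_closure"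
      using hs R by (intro inversion_closure_add inversion_closure_times_ii inversion_closure_continuous[where R = "R + 1"] continuous_intros hc) auto
    thus ?thesis by (simp flip: complex_eq)
  qed
  have fL: "f \<in> L2 \<alpha>" by (rule bounded_support_L2[OF f B(2) R(2)])
  show ?thesis
  proof (rule inversion_closure_closed[OF happ fL])
    show "(\<lambda>n. rnorm \<alpha> (\<lambda>x. h n x - f x)) \<longlonglongrightarrow> 0"
    proof (rule energy_dominated_tendsto[where w = "\<lambda>x. B * indicator {..R+1} x"])
      show "h n \<in> L2 \<alpha>" for n using happ by (simp add: inversion_closure_def)
      show "f \<in> L2 \<alpha>" by (rule fL)
      show "(\<lambda>x. complex_of_real (B * indicator {..R+1} x)) \<in> L2 \<alpha>"
        by (rule bounded_support_L2[of _ B "R+1"]) (use B in \<open>auto intro!: measurable_mu_borel_comp split: split_indicator\<close>)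
      show "cmod (h n x) \<le> B * indicator {..R+1} x" for n x using hb[of n x] hs[of x n] by (cases "x \<le> R + 1") auto
      show "cmod (f x) \<le> B * indicator {..R+1} x" if "x \<ge> 0" for x using B(2)[OF that] R(2)[of x] by (cases "x \<le> R + 1") auto
      show "AE x in mu \<alpha>. (\<lambda>n. h n x) \<longlonglongrightarrow> f x"
        using AE_mu_of_negligible[OF N]  AE_space
      proof eventually_elim
        case (elim x)
        hence x: "x \<ge> 0" by simp
        have "(\<lambda>n. g n x) \<longlonglongrightarrow> f x" using lim[of x] elim x by simp
        hence "(\<lambda>n. clip (g n x)) \<longlonglongrightarrow> clip (f x)"
          using clip_c by (intro isCont_tendsto_compose[of _ clip]) (auto simp: continuous_on_eq_continuous_at)
        hence "(\<lambda>n. h n x) \<longlonglongrightarrow> complex_of_real (chi x) * clip (f x)"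
          unfolding h_def by (intro tendsto_intros)
        also have "clip (f x) = f x" using B(2)[OF x] by (rule clip_id)
        also have "complex_of_real (chi x) * f x = f x" using R(2)[of x] by (cases "x \<le> R") (auto simp: chi_def)
        finally show ?case .
      qed
    qed
  qed
qed

lemma inversion_closure_all:
  assumes f: "f \<in> L2 \<alpha>" shows "f \<in> inversion_closure"
proof -
  have [measurable]: "f \<in> borel_measurable (mu \<alpha>)" using f by (rule L2_measurable)
  note [measurable] = measurable_mu_borel
  define F where "F = (\<lambda>n x. if x \<le> real (Suc n) \<and> cmod (f x) \<le> real (Suc n) then f x else 0)"
  have Fm: "F n \<in> borel_measurable (mu \<alpha>)" for n unfolding F_def by measurable
  have Fa: "F n \<in> inversion_closure" for n
    by (rule inversion_closure_bounded[OF Fm, of "real (Suc n)" _ "real (Suc n)"]) (auto simp: F_def)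
  show ?thesis
  proof (rule inversion_closure_closed[OF Fa f], rule energy_dominated_tendsto[where w = "\<lambda>x. cmod (f x)"])
    show "F n \<in> L2 \<alpha>" for n using Fa by (simp add: inversion_closure_def)
    show "(\<lambda>x. complex_of_real (cmod (f x))) \<in> L2 \<alpha>" by (rule L2_dominated[OF f]) auto
    show "AE x in mu \<alpha>. (\<lambda>n. F n x) \<longlonglongrightarrow> f x"
    proof (rule AE_I2, rule tendsto_eventually)
      fix x
      obtain m where m: "real m \<ge> max x (cmod (f x))" using real_arch_simple by blast
      show "\<forall>\<^sub>F n in sequentially. F n x = f x"
        using eventually_ge_at_top[of m] by eventually_elim (use m in \<open>auto simp: F_def\<close>)
    qed
  qed (auto simp: F_def f)
qed

theorem plancherel_L1_L2:
  assumes f1: "integrable (mu \<alpha>) f" and f2: "f \<in> L2 \<alpha>"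
  shows "rnorm \<alpha> (hankel_L1 \<alpha> f) = rnorm \<alpha> f"
proof -
  have "\<exists>g\<in>inversion_class. rnorm \<alpha> (\<lambda>x. f x - g x) \<le> 1 / real (Suc n)" for n
    using inversion_closure_all[OF f2] by (simp add: inversion_closure_def)
  then obtain g where g: "\<And>n. g n \<in> inversion_class" and d: "\<And>n. rnorm \<alpha> (\<lambda>x. f x - g n x) \<le> 1 / real (Suc n)" by metis
  have gL: "g n \<in> L2 \<alpha>" and g1: "integrable (mu \<alpha>) (g n)" for n using g[of n] by (auto simp: inversion_class_def)
  have d': "rnorm \<alpha> (\<lambda>x. g n x - f x) \<le> 1 / real (Suc n)" for n
    using d[of n] by (simp only: rnorm_minus_commute[of \<alpha> "g n" f])
  have lim: "(\<lambda>n. rnorm \<alpha> (\<lambda>x. g n x - f x)) \<longlonglongrightarrow> 0"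
    by (rule tendsto_sandwich[OF _ _ tendsto_const LIMSEQ_Suc[OF lim_1_over_n]]) (use d' in auto)
  have le: "rnorm \<alpha> (\<lambda>y. hankel_L1 \<alpha> (g n) y - hankel_L1 \<alpha> f y) \<le> rnorm \<alpha> (\<lambda>x. g n x - f x)" for n
  proof -
    have "rnorm \<alpha> (hankel_L1 \<alpha> (\<lambda>x. g n x - f x)) \<le> rnorm \<alpha> (\<lambda>x. g n x - f x)"
      unfolding rnorm_def using hankel_L1_contraction[OF a, of "\<lambda>x. g n x - f x"] g1 f1 L2_finite[OF L2_diff[OF gL f2]]
      by (intro real_sqrt_le_mono enn2real_mono) auto
    moreover have "hankel_L1 \<alpha> (\<lambda>x. g n x - f x) = (\<lambda>y. hankel_L1 \<alpha> (g n) y - hankel_L1 \<alpha> f y)"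
      by (rule ext) (rule hankel_L1_diff[OF a g1 f1])
    ultimately show ?thesis by simp
  qed
  have lim': "(\<lambda>n. rnorm \<alpha> (\<lambda>y. hankel_L1 \<alpha> (g n) y - hankel_L1 \<alpha> f y)) \<longlonglongrightarrow> 0"
    by (rule tendsto_sandwich[OF _ _ tendsto_const lim]) (use le in auto)
  have "rnorm \<alpha> (hankel_L1 \<alpha> (g n)) = rnorm \<alpha> (g n)" for n unfolding rnorm_def by (simp add: inversion_class_isometry[OF g])
  with rnorm_tendsto[OF hankel_L1_L2[OF g1 gL] hankel_L1_L2[OF f1 f2] lim'] rnorm_tendsto[OF gL f2 lim]
  show ?thesis by (simp add: LIMSEQ_unique)
qed

end

section \<open>The transform on square-integrable functions\<close>

context
  fixes \<alpha> :: real assumes a: "\<alpha> > -1/2"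
begin

text \<open>Truncations lie in both spaces, which makes them the approximating sequence for the extension of the transform.\<close>

lemma truncation:
  assumes f: "f \<in> L2 \<alpha>"
  defines "F \<equiv> \<lambda>(n::nat) x. indicator {..real n} x * f x"
  shows "F n \<in> L2 \<alpha>" "integrable (mu \<alpha>) (F n)" "(\<lambda>n. rnorm \<alpha> (\<lambda>x. F n x - f x)) \<longlonglongrightarrow> 0"
proof -
  have fm [measurable]: "f \<in> borel_measurable (mu \<alpha>)" using f by (rule L2_measurable)
  note [measurable] = measurable_mu_borel
  have Fm [measurable]: "F n \<in> borel_measurable (mu \<alpha>)" for n unfolding F_def by measurable
  show FL: "F n \<in> L2 \<alpha>" for n
    by (rule L2_dominated[OF f Fm]) (auto simp: F_def split: split_indicator)
  have sq: "integrable (mu \<alpha>) (\<lambda>x. (cmod (f x))\<^sup>2)"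
    using L2_finite[OF f] unfolding energy_def by (intro integrableI_nonneg) auto
  have ind: "integrable (mu \<alpha>) (indicator {0..real n} :: real \<Rightarrow> real)" for n
    using emeasure_mu_bounded[OF a, of "real n"] by (intro integrable_real_indicator sets_mu_borel) auto
  show "integrable (mu \<alpha>) (F n)" for n
  proof (rule Bochner_Integration.integrable_bound[OF Bochner_Integration.integrable_add[OF ind[of n] sq] Fm])
    have "z \<le> 1 + z\<^sup>2" for z :: real
      using zero_le_power2[of "z - 1/2"] by (simp add: power2_eq_square algebra_simps)
    thus "AE x in mu \<alpha>. norm (F n x) \<le> norm (indicator {0..real n} x + (cmod (f x))\<^sup>2)"
      by (auto simp: F_def split: split_indicator)
  qed
  show "(\<lambda>n. rnorm \<alpha> (\<lambda>x. F n x - f x)) \<longlonglongrightarrow> 0"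
  proof (rule energy_dominated_tendsto[OF FL f, where w = "\<lambda>x. cmod (f x)"])
    show "(\<lambda>x. complex_of_real (cmod (f x))) \<in> L2 \<alpha>" by (rule L2_dominated[OF f]) auto
    show "AE x in mu \<alpha>. (\<lambda>n. F n x) \<longlonglongrightarrow> f x"
    proof (rule AE_I2, rule tendsto_eventually)
      fix x
      obtain m where m: "real m \<ge> x" using real_arch_simple by blast
      show "\<forall>\<^sub>F n in sequentially. F n x = f x"
        using eventually_ge_at_top[of m] by eventually_elim (use m in \<open>auto simp: F_def\<close>)
    qed
  qed (auto simp: F_def split: split_indicator)
qed

lemma is_hankel_iff:
  assumes f: "f \<in> L2 \<alpha>"
  shows "is_hankel_L2 \<alpha> f g \<longleftrightarrow> g \<in> L2 \<alpha> \<and> (\<exists>u. (\<forall>n::nat. integrable (mu \<alpha>) (u n) \<and> u n \<in> L2 \<alpha>) \<and>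
     (\<lambda>n. rnorm \<alpha> (\<lambda>x. u n x - f x)) \<longlonglongrightarrow> 0 \<and> (\<lambda>n. rnorm \<alpha> (\<lambda>y. hankel_L1 \<alpha> (u n) y - g y)) \<longlonglongrightarrow> 0)"
proof -
  have 1: "(\<lambda>n. l2_norm \<alpha> (\<lambda>x. u n x - f x)) \<longlonglongrightarrow> 0 \<longleftrightarrow> (\<lambda>n. rnorm \<alpha> (\<lambda>x. u n x - f x)) \<longlonglongrightarrow> 0"
    if "\<forall>n. integrable (mu \<alpha>) (u n) \<and> u n \<in> L2 \<alpha>" for u
    using that f by (intro rnorm_tendsto_0_iff L2_diff) auto
  have 2: "(\<lambda>n. l2_norm \<alpha> (\<lambda>y. hankel_L1 \<alpha> (u n) y - g y)) \<longlonglongrightarrow> 0 \<longleftrightarrow> (\<lambda>n. rnorm \<alpha> (\<lambda>y. hankel_L1 \<alpha> (u n) y - g y)) \<longlonglongrightarrow> 0"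
    if "\<forall>n. integrable (mu \<alpha>) (u n) \<and> u n \<in> L2 \<alpha>" "g \<in> L2 \<alpha>" for u
    using that by (intro rnorm_tendsto_0_iff L2_diff hankel_L1_L2[OF a]) auto
  show ?thesis unfolding is_hankel_L2_def Int_iff L1_iff using 1 2 by blast
qed

lemma is_hankel_norm:
  assumes f: "f \<in> L2 \<alpha>" and h: "is_hankel_L2 \<alpha> f g"
  shows "rnorm \<alpha> g = rnorm \<alpha> f"
proof -
  obtain u where g: "g \<in> L2 \<alpha>" and u: "\<And>n. integrable (mu \<alpha>) (u n)" "\<And>n::nat. u n \<in> L2 \<alpha>"
    and l1: "(\<lambda>n. rnorm \<alpha> (\<lambda>x. u n x - f x)) \<longlonglongrightarrow> 0" and l2: "(\<lambda>n. rnorm \<alpha> (\<lambda>y. hankel_L1 \<alpha> (u n) y - g y)) \<longlonglongrightarrow> 0"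
    using h unfolding is_hankel_iff[OF f] by blast
  have "(\<lambda>n. rnorm \<alpha> (hankel_L1 \<alpha> (u n))) \<longlonglongrightarrow> rnorm \<alpha> g" by (rule rnorm_tendsto[OF hankel_L1_L2[OF a u] g l2])
  moreover have "(\<lambda>n. rnorm \<alpha> (u n)) \<longlonglongrightarrow> rnorm \<alpha> f" by (rule rnorm_tendsto[OF u(2) f l1])
  ultimately show ?thesis using plancherel_L1_L2[OF a u] by (simp add: LIMSEQ_unique)
qed

lemma is_hankel_diff:
  assumes f: "f \<in> L2 \<alpha>" "is_hankel_L2 \<alpha> f g" and f': "f' \<in> L2 \<alpha>" "is_hankel_L2 \<alpha> f' g'"
  shows "is_hankel_L2 \<alpha> (\<lambda>x. f x - f' x) (\<lambda>x. g x - g' x)"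
proof -
  obtain u where g: "g \<in> L2 \<alpha>" and u: "\<And>n. integrable (mu \<alpha>) (u n)" "\<And>n::nat. u n \<in> L2 \<alpha>"
    and l: "(\<lambda>n. rnorm \<alpha> (\<lambda>x. u n x - f x)) \<longlonglongrightarrow> 0" "(\<lambda>n. rnorm \<alpha> (\<lambda>y. hankel_L1 \<alpha> (u n) y - g y)) \<longlonglongrightarrow> 0"
    using f unfolding is_hankel_iff[OF f(1)] by blast
  obtain u' where g': "g' \<in> L2 \<alpha>" and u': "\<And>n. integrable (mu \<alpha>) (u' n)" "\<And>n::nat. u' n \<in> L2 \<alpha>"
    and l': "(\<lambda>n. rnorm \<alpha> (\<lambda>x. u' n x - f' x)) \<longlonglongrightarrow> 0" "(\<lambda>n. rnorm \<alpha> (\<lambda>y. hankel_L1 \<alpha> (u' n) y - g' y)) \<longlonglongrightarrow> 0"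
    using f' unfolding is_hankel_iff[OF f'(1)] by blast
  have sum0: "(\<lambda>n. rnorm \<alpha> (\<lambda>x. (p n x - p' n x) - (q x - q' x))) \<longlonglongrightarrow> 0"
    if "\<And>n::nat. p n \<in> L2 \<alpha>" "\<And>n. p' n \<in> L2 \<alpha>" "q \<in> L2 \<alpha>" "q' \<in> L2 \<alpha>"
      "(\<lambda>n. rnorm \<alpha> (\<lambda>x. p n x - q x)) \<longlonglongrightarrow> 0" "(\<lambda>n. rnorm \<alpha> (\<lambda>x. p' n x - q' x)) \<longlonglongrightarrow> 0" for p p' q q'
  proof (rule tendsto_sandwich[OF _ _ tendsto_const])
    show "(\<lambda>n. rnorm \<alpha> (\<lambda>x. p n x - q x) + rnorm \<alpha> (\<lambda>x. p' n x - q' x)) \<longlonglongrightarrow> 0"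
      using tendsto_add[OF that(5,6)] by simp
    have "rnorm \<alpha> (\<lambda>x. (p n x - p' n x) - (q x - q' x)) \<le> rnorm \<alpha> (\<lambda>x. p n x - q x) + rnorm \<alpha> (\<lambda>x. p' n x - q' x)" for n
    proof -
      have "(\<lambda>x. (p n x - p' n x) - (q x - q' x)) = (\<lambda>x. (p n x - q x) + (q' x - p' n x))" by (simp add: fun_eq_iff)
      thus ?thesis
        using rnorm_triangle[OF L2_diff[OF that(1,3)] L2_diff[OF that(4,2)], of n n] rnorm_minus_commute[of \<alpha> q' "p' n"] by simp
    qed
    thus "\<forall>\<^sub>F n in sequentially. rnorm \<alpha> (\<lambda>x. (p n x - p' n x) - (q x - q' x)) \<le> rnorm \<alpha> (\<lambda>x. p n x - q x) + rnorm \<alpha> (\<lambda>x. p' n x - q' x)"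
      by simp
  qed auto
  have "(\<lambda>n. rnorm \<alpha> (\<lambda>y. hankel_L1 \<alpha> (\<lambda>x. u n x - u' n x) y - (g y - g' y))) \<longlonglongrightarrow> 0"
    unfolding hankel_L1_diff[OF a u(1) u'(1)] by (intro sum0 hankel_L1_L2[OF a] u u' g g' l l')
  moreover have "(\<lambda>n. rnorm \<alpha> (\<lambda>x. (u n x - u' n x) - (f x - f' x))) \<longlonglongrightarrow> 0"
    by (intro sum0 u u' f f' l l')
  ultimately show ?thesis
    using u u' L2_diff[OF g g'] unfolding is_hankel_iff[OF L2_diff[OF f(1) f'(1)]]
    by (intro conjI exI[of _ "\<lambda>n x. u n x - u' n x"] allI L2_diff Bochner_Integration.integrable_diff g g' u u')
qed

lemma is_hankel_hankel_L1:
  assumes "integrable (mu \<alpha>) f" "f \<in> L2 \<alpha>" shows "is_hankel_L2 \<alpha> f (hankel_L1 \<alpha> f)"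
proof -
  have "rnorm \<alpha> (\<lambda>x. 0) = 0" by (simp add: rnorm_def energy_def)
  thus ?thesis unfolding is_hankel_iff[OF assms(2)] using assms hankel_L1_L2[OF a assms] by (intro conjI exI[of _ "\<lambda>_. f"]) auto
qed

lemma is_hankel_exists:
  assumes f: "f \<in> L2 \<alpha>" shows "\<exists>g. is_hankel_L2 \<alpha> f g"
proof -
  define F where "F = (\<lambda>(n::nat) x. indicator {..real n} x * f x)"
  have F: "F n \<in> L2 \<alpha>" "integrable (mu \<alpha>) (F n)" "(\<lambda>n. rnorm \<alpha> (\<lambda>x. F n x - f x)) \<longlonglongrightarrow> 0" for n
    using truncation[OF f] by (simp_all only: F_def)
  have "\<exists>g\<in>L2 \<alpha>. (\<lambda>n. rnorm \<alpha> (\<lambda>x. hankel_L1 \<alpha> (F n) x - g x)) \<longlonglongrightarrow> 0"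
  proof (rule L2_complete[where h = "\<lambda>n. hankel_L1 \<alpha> (F n)"])
    show "hankel_L1 \<alpha> (F n) \<in> L2 \<alpha>" for n by (rule hankel_L1_L2[OF a F(2,1)])
  next
    fix e :: real assume e: "e > 0"
    have "\<forall>\<^sub>F n in sequentially. rnorm \<alpha> (\<lambda>x. F n x - f x) < e/2"
      using order_tendstoD(2)[OF F(3), of "e/2"] e by simp
    then obtain N where N: "\<And>n. n \<ge> N \<Longrightarrow> rnorm \<alpha> (\<lambda>x. F n x - f x) < e/2" unfolding eventually_sequentially by blast
    have "rnorm \<alpha> (\<lambda>x. hankel_L1 \<alpha> (F m) x - hankel_L1 \<alpha> (F n) x) \<le> e" if "m \<ge> N" "n \<ge> N" for m n
    proof -
      have "(\<lambda>x. hankel_L1 \<alpha> (F m) x - hankel_L1 \<alpha> (F n) x) = hankel_L1 \<alpha> (\<lambda>x. F m x - F n x)"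
        by (rule ext) (rule hankel_L1_diff[OF a F(2) F(2), symmetric])
      hence "rnorm \<alpha> (\<lambda>x. hankel_L1 \<alpha> (F m) x - hankel_L1 \<alpha> (F n) x) = rnorm \<alpha> (\<lambda>x. F m x - F n x)"
        using plancherel_L1_L2[OF a Bochner_Integration.integrable_diff[OF F(2) F(2)] L2_diff[OF F(1) F(1)]] by simp
      also have "\<dots> \<le> rnorm \<alpha> (\<lambda>x. F m x - f x) + rnorm \<alpha> (\<lambda>x. f x - F n x)" by (rule rnorm_triangle3[OF F(1) f F(1)])
      also have "\<dots> \<le> e" using N[OF that(1)] N[OF that(2)] rnorm_minus_commute[of \<alpha> f "F n"] by simp
      finally show ?thesis .
    qed
    thus "\<exists>N. \<forall>m\<ge>N. \<forall>n\<ge>N. rnorm \<alpha> (\<lambda>x. hankel_L1 \<alpha> (F m) x - hankel_L1 \<alpha> (F n) x) \<le> e" by blast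
  qed
  thus ?thesis unfolding is_hankel_iff[OF f] using F by blast
qed

lemma hankel_is_hankel: "f \<in> L2 \<alpha> \<Longrightarrow> is_hankel_L2 \<alpha> f (hankel \<alpha> f)"
  unfolding hankel_def using is_hankel_exists by (rule someI_ex)

lemma hankel_L2: "f \<in> L2 \<alpha> \<Longrightarrow> hankel \<alpha> f \<in> L2 \<alpha>"
  using hankel_is_hankel is_hankel_L2_def by blast

lemma hankel_norm: "f \<in> L2 \<alpha> \<Longrightarrow> rnorm \<alpha> (hankel \<alpha> f) = rnorm \<alpha> f"
  using is_hankel_norm hankel_is_hankel by blast

text \<open>\<^const>\<open>hankel\<close> chooses representatives and is additive only up to null sets; this is expressed by norms of differences.\<close>

lemma hankel_diff_norm:
  assumes "f \<in> L2 \<alpha>" "g \<in> L2 \<alpha>" "h \<in> L2 \<alpha>"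
  shows "rnorm \<alpha> (\<lambda>y. (hankel \<alpha> f y - hankel \<alpha> g y) - hankel \<alpha> h y) = rnorm \<alpha> (\<lambda>x. (f x - g x) - h x)"
  by (intro is_hankel_norm is_hankel_diff hankel_is_hankel L2_diff assms)

lemma hankel_L1_approx_norm:
  assumes "f \<in> L2 \<alpha>" "g \<in> L2 \<alpha>" "integrable (mu \<alpha>) g"
  shows "rnorm \<alpha> (\<lambda>y. hankel_L1 \<alpha> g y - hankel \<alpha> f y) = rnorm \<alpha> (\<lambda>x. g x - f x)"
  by (intro is_hankel_norm is_hankel_diff hankel_is_hankel is_hankel_hankel_L1 L2_diff assms)

end

section \<open>Thin sets and a covering of the half-line by cells\<close>

text \<open>Endpoints of consecutive cells: the windows \<open>[0,1]\<close> and \<open>[x, x + 1/x]\<close> from the definition of thinness, laid end to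
  end.\<close>

primrec cell_point :: "nat \<Rightarrow> real" where
  "cell_point 0 = 0"
| "cell_point (Suc n) = cell_point n + (if n = 0 then 1 else 1 / cell_point n)"

declare cell_point.simps(2) [simp del]

lemma cell_point_1: "cell_point (Suc 0) = 1"
  by (simp add: cell_point.simps)

lemma cell_point_Suc: "n > 0 \<Longrightarrow> cell_point (Suc n) = cell_point n + 1 / cell_point n"
  by (simp add: cell_point.simps)

lemma cell_point_ge_1: "cell_point (Suc n) \<ge> 1"
proof (induction n)
  case (Suc n)
  have "1 / cell_point (Suc n) \<ge> 0" using Suc by simp
  thus ?case using Suc cell_point_Suc[of "Suc n"] by linarith
qed (simp add: cell_point_1)

lemma cell_point_less: "cell_point n < cell_point (Suc n)"
proof (cases n)
  case (Suc k)
  have "1 / cell_point n > 0" using cell_point_ge_1[of k] Suc by simp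
  thus ?thesis using cell_point_Suc[of n] Suc by simp
qed (simp add: cell_point_1)

text \<open>Since \<open>(x + 1/x)\<^sup>2 \<ge> x\<^sup>2 + 2\<close>, the cells exhaust the half-line.\<close>

lemma cell_point_sq: "(cell_point (Suc n))\<^sup>2 \<ge> 1 + 2 * real n"
proof (induction n)
  case (Suc n)
  have "(c + 1 / c)\<^sup>2 \<ge> c\<^sup>2 + 2" if "c > 0" for c :: real
  proof -
    have "(c + 1 / c)\<^sup>2 = c\<^sup>2 + 2 + (1 / c)\<^sup>2" using that by (simp add: power2_eq_square field_simps)
    thus ?thesis by simp
  qed
  from this[of "cell_point (Suc n)"] have "(cell_point (Suc (Suc n)))\<^sup>2 \<ge> (cell_point (Suc n))\<^sup>2 + 2"
    using cell_point_ge_1[of n] cell_point_Suc[of "Suc n"] by simp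
  thus ?case using Suc by simp
qed (simp add: cell_point_1)

lemma cell_point_cover:
  assumes "x \<ge> 0" shows "\<exists>n. x \<in> {cell_point n..<cell_point (Suc n)}"
proof -
  obtain m :: nat where m: "real m \<ge> x\<^sup>2" using real_arch_simple by blast
  have "x\<^sup>2 < (cell_point (Suc m))\<^sup>2" using cell_point_sq[of m] m zero_le_power2[of x] by linarith
  hence ex: "\<exists>n. x < cell_point (Suc n)" using cell_point_ge_1[of m] by (intro exI[of _ m]) (auto intro: power2_less_imp_less)
  define n where "n = (LEAST n. x < cell_point (Suc n))"
  have n: "x < cell_point (Suc n)" unfolding n_def by (rule LeastI_ex[OF ex])
  have "cell_point n \<le> x"
  proof (cases n)
    case (Suc k)
    hence "k < n" by simp
    hence "\<not> x < cell_point (Suc k)" unfolding n_def by (rule not_less_Least)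
    thus ?thesis using Suc by simp
  qed (use assms in simp)
  thus ?thesis using n by auto
qed

lemma cell_point_mono: "m \<le> n \<Longrightarrow> cell_point m \<le> cell_point n"
  using lift_Suc_mono_le[of cell_point m n] cell_point_less by (simp add: less_imp_le)

lemma cell_point_nonneg: "cell_point n \<ge> 0"
  using cell_point_mono[of 0 n] by simp

text \<open>On each cell \<open>D\<close> is at most the infimum of \<open>E\<close>, and \<open>S\<close> occupies at most the fraction \<open>\<epsilon>\<close> of the cell. Half-open
  cells are disjoint and differ from closed ones by a null set.\<close>

lemma thin_cover:
  assumes th: "thin \<epsilon> \<alpha> S" 
    and D [measurable]: "D \<in> borel_measurable (mu \<alpha>)" and E [measurable]: "E \<in> borel_measurable (mu \<alpha>)"
    and DE: "\<And>n x x'. x \<in> {cell_point n..cell_point (Suc n)} \<Longrightarrow> x' \<in> {cell_point n..cell_point (Suc n)} \<Longrightarrow> D x \<le> E x'"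
  shows "(\<integral>\<^sup>+x. D x * indicator S x \<partial>mu \<alpha>) \<le> ennreal \<epsilon> * (\<integral>\<^sup>+x. E x \<partial>mu \<alpha>)"
proof -
  have S [measurable]: "S \<in> sets (mu \<alpha>)" using th by (simp add: thin_def)
  define J where "J = (\<lambda>n. {cell_point n..<cell_point (Suc n)})"
  define I where "I = (\<lambda>n. {cell_point n..cell_point (Suc n)})"
  have JI: "I n = insert (cell_point (Suc n)) (J n)" for n
    using cell_point_less[of n] by (auto simp: I_def J_def)
  have Js [measurable]: "J n \<in> sets (mu \<alpha>)" and Is [measurable]: "I n \<in> sets (mu \<alpha>)" for n
    unfolding J_def I_def using cell_point_nonneg[of n] by (auto intro!: sets_mu_borel)
  have disj: "disjoint_family J"
  proof -
    have "J m \<inter> J n = {}" if "m < n" for m n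
    proof -
      have "cell_point (Suc m) \<le> cell_point n" using that by (intro cell_point_mono) simp
      thus ?thesis by (auto simp: J_def)
    qed
    thus ?thesis unfolding disjoint_family_on_def by (metis inf_commute linorder_neqE_nat)
  qed
  have one: "(\<Sum>n. indicator (J n) x :: ennreal) = 1" if "x \<in> space (mu \<alpha>)" for x
  proof -
    have "x \<in> (\<Union>n. J n)" using cell_point_cover[of x] that by (auto simp: J_def)
    thus ?thesis using suminf_indicator[OF disj, of x] by simp
  qed
  have split: "(\<integral>\<^sup>+x. h x \<partial>mu \<alpha>) = (\<Sum>n. \<integral>\<^sup>+x. h x * indicator (J n) x \<partial>mu \<alpha>)"
    if [measurable]: "h \<in> borel_measurable (mu \<alpha>)" for h :: "real \<Rightarrow> ennreal"
  proof -
    have "(\<integral>\<^sup>+x. h x \<partial>mu \<alpha>) = (\<integral>\<^sup>+x. (\<Sum>n. h x * indicator (J n) x) \<partial>mu \<alpha>)"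
      by (intro nn_integral_cong) (simp only: ennreal_suminf_cmult one mult_1_right)
    also have "\<dots> = (\<Sum>n. \<integral>\<^sup>+x. h x * indicator (J n) x \<partial>mu \<alpha>)" by (rule nn_integral_suminf) measurable
    finally show ?thesis .
  qed
  have thin_cell: "emeasure (mu \<alpha>) (S \<inter> I n) \<le> ennreal \<epsilon> * emeasure (mu \<alpha>) (I n)" for n
  proof (cases n)
    case 0
    thus ?thesis using th unfolding thin_def I_def by (auto simp: cell_point_1 dest!: spec[of _ "0::real"])
  next
    case (Suc k)
    have "1 \<le> cell_point n" using cell_point_ge_1[of k] Suc by simp
    moreover have "cell_point (Suc n) = cell_point n + 1 / cell_point n" using Suc by (simp add: cell_point_Suc)
    ultimately show ?thesis using th unfolding thin_def I_def by (auto)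
  qed
  have cell: "(\<integral>\<^sup>+x. D x * indicator S x * indicator (J n) x \<partial>mu \<alpha>) \<le> ennreal \<epsilon> * (\<integral>\<^sup>+x. E x * indicator (J n) x \<partial>mu \<alpha>)" for n
  proof -
    \<comment> \<open>An infimum over the closed cell serves both endpoints.\<close>
    define Q where "Q = (INF x\<in>I n. E x)"
    have "(\<integral>\<^sup>+x. D x * indicator S x * indicator (J n) x \<partial>mu \<alpha>) \<le> (\<integral>\<^sup>+x. Q * indicator (S \<inter> I n) x \<partial>mu \<alpha>)"
    proof (intro nn_integral_mono)
      fix x
      show "D x * indicator S x * indicator (J n) x \<le> Q * indicator (S \<inter> I n) x"
      proof (cases "x \<in> J n \<and> x \<in> S")
        case True
        hence "D x \<le> Q" unfolding Q_def using DE[of x n] True by (intro INF_greatest) (auto simp: I_def J_def)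
        thus ?thesis using True JI[of n] by simp
      qed auto
    qed
    also have "\<dots> = Q * emeasure (mu \<alpha>) (S \<inter> I n)" by (rule nn_integral_cmult_indicator) measurable
    also have "\<dots> \<le> Q * (ennreal \<epsilon> * emeasure (mu \<alpha>) (I n))" by (intro mult_left_mono thin_cell) auto
    also have "emeasure (mu \<alpha>) (I n) \<le> emeasure (mu \<alpha>) {cell_point (Suc n)} + emeasure (mu \<alpha>) (J n)"
    proof -
      have "I n = {cell_point (Suc n)} \<union> J n" using JI by auto
      thus ?thesis using emeasure_subadditive[of "{cell_point (Suc n)}" "mu \<alpha>" "J n"] cell_point_nonneg[of "Suc n"] Js
          sets_mu_borel[of "{cell_point (Suc n)}" \<alpha>] by simp
    qed
    hence "Q * (ennreal \<epsilon> * emeasure (mu \<alpha>) (I n)) \<le> Q * (ennreal \<epsilon> * emeasure (mu \<alpha>) (J n))"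
      using emeasure_mu_singleton[OF cell_point_nonneg[of "Suc n"], of \<alpha>] by (intro mult_left_mono) (auto)
    also have "\<dots> = ennreal \<epsilon> * (\<integral>\<^sup>+x. Q * indicator (J n) x \<partial>mu \<alpha>)"
      by (subst nn_integral_cmult_indicator) (auto simp: mult_ac)
    also have "\<dots> \<le> ennreal \<epsilon> * (\<integral>\<^sup>+x. E x * indicator (J n) x \<partial>mu \<alpha>)"
    proof (intro mult_left_mono nn_integral_mono)
      have "Q \<le> E x" if "x \<in> J n" for x unfolding Q_def using JI[of n] that by (intro INF_lower) auto
      thus "Q * indicator (J n) x \<le> E x * indicator (J n) x" for x by (auto split: split_indicator)
    qed auto
    finally show ?thesis .
  qed
  have "(\<integral>\<^sup>+x. D x * indicator S x \<partial>mu \<alpha>) = (\<Sum>n. \<integral>\<^sup>+x. D x * indicator S x * indicator (J n) x \<partial>mu \<alpha>)"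
    by (rule split) measurable
  also have "\<dots> \<le> (\<Sum>n. ennreal \<epsilon> * (\<integral>\<^sup>+x. E x * indicator (J n) x \<partial>mu \<alpha>))"
    by (intro suminf_le cell) auto
  also have "\<dots> = ennreal \<epsilon> * (\<integral>\<^sup>+x. E x \<partial>mu \<alpha>)" by (subst ennreal_suminf_cmult) (simp add: split[OF E])
  finally show ?thesis .
qed

section \<open>Band kernels\<close>

text \<open>The density in \<open>s\<close> of the Gaussian multipliers \<open>exp (- \<pi> s \<xi>\<^sup>2)\<close> at position \<open>x\<close>: the part of
  \<open>- d/ds exp (- \<pi> s (2 + x\<^sup>2 + \<xi>\<^sup>2))\<close> that carries the factor \<open>1 + x\<^sup>2\<close>, without \<open>exp (- \<pi> s \<xi>\<^sup>2)\<close>.\<close>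

definition band_weight :: "real \<Rightarrow> real \<Rightarrow> real" where
  "band_weight s x = pi * (1 + x\<^sup>2) * exp (- pi * s * (2 + x\<^sup>2))"

lemma band_weight_nonneg: "band_weight s x \<ge> 0" by (simp add: band_weight_def)

lemma band_weight_measurable [measurable (raw)]:
  assumes [measurable]: "f \<in> borel_measurable M" "g \<in> borel_measurable M"
  shows "(\<lambda>z. band_weight (f z) (g z)) \<in> borel_measurable M"
  unfolding band_weight_def by measurable

text \<open>The superposition of the heat kernels over those times that \<open>P\<close> admits at the point \<open>x\<close>.\<close>

definition band_kern :: "real \<Rightarrow> (real \<Rightarrow> real \<Rightarrow> bool) \<Rightarrow> real \<Rightarrow> real \<Rightarrow> ennreal" where
  "band_kern \<alpha> P x y = (\<integral>\<^sup>+s. (if P s x then ennreal (band_weight s x * heat \<alpha> s x y) else 0) \<partial>lborel)"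

text \<open>A majorant of the band kernels. The time is scaled by \<open>k\<close> because the Harnack inequality doubles it.\<close>

definition envelope :: "real \<Rightarrow> real \<Rightarrow> real \<Rightarrow> real \<Rightarrow> ennreal" where
  "envelope \<alpha> k y x = (\<integral>\<^sup>+s. (if 0 < s \<and> s \<le> 1 then ennreal (pi * (1 + x\<^sup>2) * exp (- pi * s * x\<^sup>2) * heat \<alpha> (k * s) x y) else 0) \<partial>lborel)"

context
  fixes \<alpha> :: real assumes a: "\<alpha> > -1/2"
begin

interpretation M: sigma_finite_measure "mu \<alpha>" by (rule sigma_finite_mu[OF a])
interpretation P: pair_sigma_finite lborel "mu \<alpha>" ..
interpretation MM: pair_sigma_finite "mu \<alpha>" "mu \<alpha>" ..

lemma band_kern_measurable_pair:
  assumes P: "Measurable.pred (borel \<Otimes>\<^sub>M borel) (\<lambda>(s, x). P s x)"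
  shows "case_prod (band_kern \<alpha> P) \<in> borel_measurable (mu \<alpha> \<Otimes>\<^sub>M mu \<alpha>)"
proof -
  note [measurable] = heat_measurable[OF a] measurable_mu_borel
  let ?N = "(mu \<alpha> \<Otimes>\<^sub>M mu \<alpha>) \<Otimes>\<^sub>M lborel"
  have x [measurable]: "(\<lambda>z. fst (fst z)) \<in> borel_measurable ?N" and y [measurable]: "(\<lambda>z. snd (fst z)) \<in> borel_measurable ?N"
    by (rule measurable_compose[OF measurable_compose[OF measurable_fst measurable_fst] measurable_mu_borel],
        rule measurable_compose[OF measurable_compose[OF measurable_fst measurable_snd] measurable_mu_borel])
  have s [measurable]: "snd \<in> borel_measurable ?N" by measurable
  have "Measurable.pred ?N (\<lambda>z. P (snd z) (fst (fst z)))"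
    using measurable_compose[OF measurable_Pair[OF s x] P] by simp
  moreover have "(\<lambda>z. ennreal (band_weight (snd z) (fst (fst z)) * heat \<alpha> (snd z) (fst (fst z)) (snd (fst z)))) \<in> borel_measurable ?N"
    using heat_measurable[OF a s x y] by measurable
  ultimately have "(\<lambda>z. if P (snd z) (fst (fst z)) then ennreal (band_weight (snd z) (fst (fst z)) * heat \<alpha> (snd z) (fst (fst z)) (snd (fst z))) else 0) \<in> borel_measurable ?N"
    by measurable
  hence "(\<lambda>z. \<integral>\<^sup>+s. (if P s (fst z) then ennreal (band_weight s (fst z) * heat \<alpha> s (fst z) (snd z)) else 0) \<partial>lborel) \<in> borel_measurable (mu \<alpha> \<Otimes>\<^sub>M mu \<alpha>)"
    by (intro lborel.borel_measurable_nn_integral) (simp add: case_prod_unfold)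
  thus ?thesis by (simp add: band_kern_def case_prod_unfold)
qed

lemma band_kern_row:
  assumes P: "Measurable.pred (borel \<Otimes>\<^sub>M borel) (\<lambda>(s, x). P s x)" and pos: "\<And>s x. P s x \<Longrightarrow> s > 0"
  shows "(\<integral>\<^sup>+y. band_kern \<alpha> P x y \<partial>mu \<alpha>) = (\<integral>\<^sup>+s. (if P s x then ennreal (band_weight s x) else 0) \<partial>lborel)"
proof -
  note [measurable] = heat_measurable[OF a] measurable_mu_borel
  have Px [measurable]: "Measurable.pred borel (\<lambda>s. P s x)"
    using measurable_compose[OF _ P, of "\<lambda>s. (s,x)" borel] by simp
  have "(\<integral>\<^sup>+y. band_kern \<alpha> P x y \<partial>mu \<alpha>) = (\<integral>\<^sup>+s. (\<integral>\<^sup>+y. (if P s x then ennreal (band_weight s x * heat \<alpha> s x y) else 0) \<partial>mu \<alpha>) \<partial>lborel)"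
    unfolding band_kern_def by (rule P.Fubini') measurable
  also have "\<dots> = (\<integral>\<^sup>+s. (if P s x then ennreal (band_weight s x) else 0) \<partial>lborel)"
  proof (intro nn_integral_cong)
    fix s
    show "(\<integral>\<^sup>+y. (if P s x then ennreal (band_weight s x * heat \<alpha> s x y) else 0) \<partial>mu \<alpha>) = (if P s x then ennreal (band_weight s x) else 0)"
      using heat_mass[OF a pos, of s x x] by (simp add: ennreal_mult' band_weight_nonneg nn_integral_cmult)
  qed
  finally show ?thesis .
qed

lemma band_kern_row_le_1:
  assumes P: "Measurable.pred (borel \<Otimes>\<^sub>M borel) (\<lambda>(s, x). P s x)" and pos: "\<And>s x. P s x \<Longrightarrow> 0 < s \<and> s \<le> T" and T: "T > 0"
  shows "(\<integral>\<^sup>+y. band_kern \<alpha> P x y \<partial>mu \<alpha>) \<le> 1"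
proof -
  have "(\<integral>\<^sup>+y. band_kern \<alpha> P x y \<partial>mu \<alpha>) = (\<integral>\<^sup>+s. (if P s x then ennreal (band_weight s x) else 0) \<partial>lborel)"
    using pos by (intro band_kern_row[OF P]) auto
  also have "\<dots> \<le> (\<integral>\<^sup>+s. ennreal (pi * (2 + x\<^sup>2) * exp (- pi * s * (2 + x\<^sup>2))) * indicator {0..T} s \<partial>lborel)"
  proof (intro nn_integral_mono)
    fix s
    show "(if P s x then ennreal (band_weight s x) else 0) \<le> ennreal (pi * (2 + x\<^sup>2) * exp (- pi * s * (2 + x\<^sup>2))) * indicator {0..T} s"
    proof (cases "P s x")
      case True
      hence "0 < s" "s \<le> T" using pos by auto
      moreover have "band_weight s x \<le> pi * (2 + x\<^sup>2) * exp (- pi * s * (2 + x\<^sup>2))"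
        unfolding band_weight_def by (intro mult_right_mono mult_left_mono) auto
      ultimately show ?thesis by (simp add: ennreal_leI)
    qed simp
  qed
  also have "\<dots> = ennreal (- exp (- pi * T * (2 + x\<^sup>2)) - (- exp (- pi * 0 * (2 + x\<^sup>2))))"
    using T by (intro nn_integral_FTC_Icc) (auto intro!: derivative_eq_intros)
  also have "\<dots> \<le> 1" by (simp add: ennreal_le_1)
  finally show ?thesis .
qed

lemma band_kern_row_small:
  assumes P: "Measurable.pred (borel \<Otimes>\<^sub>M borel) (\<lambda>(s, x). P s x)" and pos: "\<And>s x. P s x \<Longrightarrow> 0 < s \<and> s * (1 + x\<^sup>2) < \<eta>" and \<eta>: "\<eta> > 0"
  shows "(\<integral>\<^sup>+y. band_kern \<alpha> P x y \<partial>mu \<alpha>) \<le> ennreal (pi * \<eta>)"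
proof -
  have q: "1 + x\<^sup>2 > 0" by (simp add: add_pos_nonneg)
  have "(\<integral>\<^sup>+y. band_kern \<alpha> P x y \<partial>mu \<alpha>) = (\<integral>\<^sup>+s. (if P s x then ennreal (band_weight s x) else 0) \<partial>lborel)"
    using pos by (intro band_kern_row[OF P]) auto
  also have "\<dots> \<le> (\<integral>\<^sup>+s. ennreal (pi * (1 + x\<^sup>2)) * indicator {0..\<eta> / (1 + x\<^sup>2)} s \<partial>lborel)"
  proof (intro nn_integral_mono)
    fix s
    show "(if P s x then ennreal (band_weight s x) else 0) \<le> ennreal (pi * (1 + x\<^sup>2)) * indicator {0..\<eta> / (1 + x\<^sup>2)} s"
    proof (cases "P s x")
      case True
      hence s: "0 < s" "s \<le> \<eta> / (1 + x\<^sup>2)" using pos[OF True] q by (auto simp: pos_le_divide_eq)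
      have "band_weight s x \<le> pi * (1 + x\<^sup>2) * 1" unfolding band_weight_def using s by (intro mult_left_mono) auto
      thus ?thesis using True s by (auto intro: ennreal_leI)
    qed simp
  qed
  also have "\<dots> = ennreal (pi * (1 + x\<^sup>2)) * ennreal (\<eta> / (1 + x\<^sup>2))"
    using \<eta> q by (subst nn_integral_cmult_indicator) auto
  also have "\<dots> = ennreal (pi * \<eta>)" using q \<eta> by (simp flip: ennreal_mult)
  finally show ?thesis .
qed

lemma envelope_measurable: "envelope \<alpha> k y \<in> borel_measurable (mu \<alpha>)"
proof -
  note [measurable] = heat_measurable[OF a] measurable_mu_borel
  show ?thesis unfolding envelope_def[abs_def] by measurable
qed

text \<open>By \<open>heat_gauss_moments\<close> the integral over \<open>x\<close> is a constant plus \<open>y\<^sup>2 exp (- s y\<^sup>2)\<close>, up to constants. The second term is not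
  bounded uniformly in \<open>y\<close> and \<open>s\<close>, but its integral over \<open>s\<close> is at most one.\<close>

lemma envelope_column:
  assumes k: "0 < k" "k \<le> 2"
  shows "(\<integral>\<^sup>+x. envelope \<alpha> k y x \<partial>mu \<alpha>) \<le> ennreal (2 * pi * (\<alpha> + 2))"
proof -
  note [measurable] = heat_measurable[OF a] measurable_mu_borel
  let ?c = "\<alpha> + 1"
  have "(\<integral>\<^sup>+x. envelope \<alpha> k y x \<partial>mu \<alpha>) = (\<integral>\<^sup>+s. (\<integral>\<^sup>+x. (if 0 < s \<and> s \<le> 1 then ennreal (pi * (1 + x\<^sup>2) * exp (- pi * s * x\<^sup>2) * heat \<alpha> (k * s) x y) else 0) \<partial>mu \<alpha>) \<partial>lborel)"
    unfolding envelope_def by (rule P.Fubini') measurable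
  also have "\<dots> \<le> (\<integral>\<^sup>+s. ennreal (pi * (1 + 2 * ?c)) * indicator {0..1} s + ennreal pi * (ennreal (y\<^sup>2 * exp (- s * y\<^sup>2)) * indicator {0..1} s) \<partial>lborel)"
  proof (intro nn_integral_mono)
    fix s :: real
    show "(\<integral>\<^sup>+x. (if 0 < s \<and> s \<le> 1 then ennreal (pi * (1 + x\<^sup>2) * exp (- pi * s * x\<^sup>2) * heat \<alpha> (k * s) x y) else 0) \<partial>mu \<alpha>)
       \<le> ennreal (pi * (1 + 2 * ?c)) * indicator {0..1} s + ennreal pi * (ennreal (y\<^sup>2 * exp (- s * y\<^sup>2)) * indicator {0..1} s)"
    proof (cases "0 < s \<and> s \<le> 1")
      case True
      have ks: "k * s > 0" "k * s \<le> 2" using k True mult_mono[of k 2 s 1] by auto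
      have "(\<integral>\<^sup>+x. ennreal (pi * (1 + x\<^sup>2) * exp (- pi * s * x\<^sup>2) * heat \<alpha> (k * s) x y) \<partial>mu \<alpha>)
        = ennreal pi * (\<integral>\<^sup>+x. ennreal ((1 + x\<^sup>2) * exp (- pi * s * x\<^sup>2) * heat \<alpha> (k * s) x y) \<partial>mu \<alpha>)"
        by (subst nn_integral_cmult[symmetric]) (auto simp: ennreal_mult'[symmetric] mult.assoc)
      also have "\<dots> \<le> ennreal pi * ennreal ((1 + ?c * (k * s) + y\<^sup>2) * exp (- (pi * s * y\<^sup>2 / (1 + s * (k * s)))))"
        using True by (intro mult_left_mono heat_gauss_moments[OF a ks(1)]) auto
      finally have up: "(\<integral>\<^sup>+x. ennreal (pi * (1 + x\<^sup>2) * exp (- pi * s * x\<^sup>2) * heat \<alpha> (k * s) x y) \<partial>mu \<alpha>)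
         \<le> ennreal pi * ennreal ((1 + ?c * (k * s) + y\<^sup>2) * exp (- (pi * s * y\<^sup>2 / (1 + s * (k * s)))))" .
      have "(1 + ?c * (k * s) + y\<^sup>2) * exp (- (pi * s * y\<^sup>2 / (1 + s * (k * s)))) \<le> (1 + 2 * ?c + y\<^sup>2) * exp (- s * y\<^sup>2)"
      proof (intro mult_mono)
        have "?c * (k * s) \<le> ?c * 2" using ks a by (intro mult_left_mono) auto
        thus "1 + ?c * (k * s) + y\<^sup>2 \<le> 1 + 2 * ?c + y\<^sup>2" by (simp add: mult.commute)
        have "s * (k * s) \<le> 1 * 2" using True ks by (intro mult_mono) auto
        hence "1 + s * (k * s) \<le> pi" using pi_gt3 by linarith
        moreover have d: "1 + s * (k * s) > 0" using True ks by (intro add_pos_nonneg) auto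
        ultimately have "s * y\<^sup>2 * (1 + s * (k * s)) \<le> s * y\<^sup>2 * pi" using True by (intro mult_left_mono) auto
        hence "s * y\<^sup>2 \<le> pi * s * y\<^sup>2 / (1 + s * (k * s))" using d by (simp add: pos_le_divide_eq mult_ac)
        thus "exp (- (pi * s * y\<^sup>2 / (1 + s * (k * s)))) \<le> exp (- s * y\<^sup>2)" by simp
      qed (use a in auto)
      also have "(1 + 2 * ?c + y\<^sup>2) * exp (- s * y\<^sup>2) \<le> (1 + 2 * ?c) + y\<^sup>2 * exp (- s * y\<^sup>2)"
      proof -
        have "(1 + 2 * ?c) * exp (- s * y\<^sup>2) \<le> (1 + 2 * ?c) * 1" using True a by (intro mult_left_mono) auto
        thus ?thesis by (simp add: distrib_right)
      qed
      finally have "(1 + ?c * (k * s) + y\<^sup>2) * exp (- (pi * s * y\<^sup>2 / (1 + s * (k * s)))) \<le> (1 + 2 * ?c) + y\<^sup>2 * exp (- s * y\<^sup>2)" .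
      note order_trans[OF up mult_left_mono[OF ennreal_leI[OF this], of "ennreal pi"]]
      also have "ennreal pi * ennreal ((1 + 2 * ?c) + y\<^sup>2 * exp (- s * y\<^sup>2)) = ennreal (pi * (1 + 2 * ?c)) + ennreal pi * ennreal (y\<^sup>2 * exp (- s * y\<^sup>2))"
      proof -
        have "ennreal ((1 + 2 * ?c) + y\<^sup>2 * exp (- s * y\<^sup>2)) = ennreal (1 + 2 * ?c) + ennreal (y\<^sup>2 * exp (- s * y\<^sup>2))"
          using a by (intro ennreal_plus) auto
        moreover have "ennreal (pi * (1 + 2 * ?c)) = ennreal pi * ennreal (1 + 2 * ?c)" by (intro ennreal_mult') simp
        ultimately show ?thesis by (simp only: distrib_left)
      qed
      finally show ?thesis using True by simp
    qed auto
  qed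
  also have "\<dots> = ennreal (pi * (1 + 2 * ?c)) + ennreal pi * (\<integral>\<^sup>+s. ennreal (y\<^sup>2 * exp (- s * y\<^sup>2)) * indicator {0..1} s \<partial>lborel)"
    by (subst nn_integral_add) (auto simp: nn_integral_cmult nn_integral_cmult_indicator)
  also have "(\<integral>\<^sup>+s. ennreal (y\<^sup>2 * exp (- s * y\<^sup>2)) * indicator {0..1} s \<partial>lborel) = ennreal (- exp (- 1 * y\<^sup>2) - (- exp (- 0 * y\<^sup>2)))"
    by (intro nn_integral_FTC_Icc) (auto intro!: derivative_eq_intros)
  also have "ennreal (- exp (- 1 * y\<^sup>2) - (- exp (- 0 * y\<^sup>2))) \<le> ennreal 1" by (intro ennreal_leI) simp
  hence "ennreal (pi * (1 + 2 * ?c)) + ennreal pi * ennreal (- exp (- 1 * y\<^sup>2) - (- exp (- 0 * y\<^sup>2))) \<le> ennreal (pi * (1 + 2 * ?c)) + ennreal pi * ennreal 1"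
    by (intro add_left_mono mult_left_mono) auto
  also have "\<dots> = ennreal (pi * (1 + 2 * ?c) + pi)" using a by (subst ennreal_plus) auto
  also have "pi * (1 + 2 * ?c) + pi = 2 * pi * (\<alpha> + 2)" by (simp add: algebra_simps)
  finally show ?thesis .
qed

lemma band_kern_le_envelope:
  assumes "\<And>s x. P s x \<Longrightarrow> 0 < s \<and> s \<le> 1"
  shows "band_kern \<alpha> P x y \<le> envelope \<alpha> 1 y x"
  unfolding band_kern_def envelope_def
proof (intro nn_integral_mono)
  fix s
  show "(if P s x then ennreal (band_weight s x * heat \<alpha> s x y) else 0) \<le> (if 0 < s \<and> s \<le> 1 then ennreal (pi * (1 + x\<^sup>2) * exp (- pi * s * x\<^sup>2) * heat \<alpha> (1 * s) x y) else 0)"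
  proof (cases "P s x")
    case True
    hence s: "0 < s" "s \<le> 1" using assms by auto
    have "band_weight s x \<le> pi * (1 + x\<^sup>2) * exp (- pi * s * x\<^sup>2)"
      unfolding band_weight_def using s by (intro mult_left_mono) auto
    hence "band_weight s x * heat \<alpha> s x y \<le> pi * (1 + x\<^sup>2) * exp (- pi * s * x\<^sup>2) * heat \<alpha> s x y"
      by (intro mult_right_mono heat_nonneg a)
    thus ?thesis using s by (simp add: ennreal_leI)
  qed simp
qed

lemma band_kern_column:
  assumes "\<And>s x. P s x \<Longrightarrow> 0 < s \<and> s \<le> 1"
  shows "(\<integral>\<^sup>+x. band_kern \<alpha> P x y \<partial>mu \<alpha>) \<le> ennreal (2 * pi * (\<alpha> + 2))"
  by (rule order_trans[OF nn_integral_mono[OF band_kern_le_envelope[OF assms]] envelope_column]) auto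

text \<open>In a cell of length \<open>r\<close> the product \<open>(1 + x\<^sup>2) r\<^sup>2\<close> and the oscillation of \<open>x\<^sup>2\<close> are bounded by absolute constants.\<close>

lemma cell_geometry:
  assumes x: "x \<in> {cell_point n..cell_point (Suc n)}" and x': "x' \<in> {cell_point n..cell_point (Suc n)}"
  defines "r \<equiv> cell_point (Suc n) - cell_point n"
  shows "x \<ge> 0" "x' \<ge> 0" "\<bar>x - x'\<bar> \<le> r" "0 \<le> r" "r \<le> 1" "(1 + x\<^sup>2) * r\<^sup>2 \<le> 5" "1 + x\<^sup>2 \<le> 5 * (1 + x'\<^sup>2)" "x'\<^sup>2 \<le> x\<^sup>2 + 3"
proof -
  define l where "l = cell_point n"
  have l0: "l \<ge> 0" unfolding l_def by (rule cell_point_nonneg)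
  show x0: "x \<ge> 0" and x0': "x' \<ge> 0" using x x' l0 by (auto simp: l_def)
  show "\<bar>x - x'\<bar> \<le> r" "0 \<le> r" using x x' by (auto simp: r_def)
  have "r \<le> 1 \<and> (1 + x\<^sup>2) * r\<^sup>2 \<le> 5 \<and> 1 + x\<^sup>2 \<le> 5 * (1 + x'\<^sup>2) \<and> x'\<^sup>2 \<le> x\<^sup>2 + 3"
  proof (cases "n = 0")
    case True
    hence r: "r = 1" and "x \<le> 1" "x' \<le> 1" using x x' by (auto simp: r_def cell_point_1)
    hence "x\<^sup>2 \<le> 1" "x'\<^sup>2 \<le> 1" using x0 x0' by (auto simp: power_le_one)
    thus ?thesis unfolding r one_power2 mult_1_right using zero_le_power2[of x] zero_le_power2[of x']
      by argo
  next
    case False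
    then obtain k where k: "n = Suc k" by (cases n) auto
    have l1: "l \<ge> 1" unfolding l_def k by (rule cell_point_ge_1)
    have r: "r = 1 / l" unfolding r_def l_def using cell_point_Suc[of n] False by simp
    have l2: "l\<^sup>2 \<ge> 1" using l1 by simp
    have bd: "l\<^sup>2 \<le> z\<^sup>2 \<and> z\<^sup>2 \<le> l\<^sup>2 + 3" if z: "z \<in> {cell_point n..cell_point (Suc n)}" for z
    proof
      show "l\<^sup>2 \<le> z\<^sup>2" using z l0 by (intro power_mono) (auto simp: l_def)
      have "z \<le> l + 1 / l" using z r by (auto simp: r_def l_def)
      hence "z\<^sup>2 \<le> (l + 1 / l)\<^sup>2" using z l0 by (intro power_mono) (auto simp: l_def)
      also have "\<dots> = l\<^sup>2 + 2 + (1 / l)\<^sup>2" using l1 by (simp add: power2_eq_square field_simps)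
      also have "(1 / l)\<^sup>2 \<le> 1" using l1 by (simp add: power_le_one)
      finally show "z\<^sup>2 \<le> l\<^sup>2 + 3" by simp
    qed
    have "(1 + x\<^sup>2) * r\<^sup>2 \<le> (5 * l\<^sup>2) * r\<^sup>2" using bd[OF x] l2 by (intro mult_right_mono) auto
    also have "\<dots> = 5" using l1 by (simp add: r power_divide)
    finally have "(1 + x\<^sup>2) * r\<^sup>2 \<le> 5" .
    moreover have "r \<le> 1" using l1 r by simp
    ultimately show ?thesis using bd[OF x] bd[OF x'] l2 by auto
  qed
  thus "r \<le> 1" "(1 + x\<^sup>2) * r\<^sup>2 \<le> 5" "1 + x\<^sup>2 \<le> 5 * (1 + x'\<^sup>2)" "x'\<^sup>2 \<le> x\<^sup>2 + 3" by auto
qed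

definition harnack_const :: "real \<Rightarrow> real" where
  "harnack_const \<eta> = 5 * exp pi * (2 powr (\<alpha> + 1) * exp (5 * pi / \<eta>))"

text \<open>For times with \<open>s (1 + x\<^sup>2) \<ge> \<eta>\<close> the factor \<open>exp (\<pi> r\<^sup>2/s)\<close> in \<open>heat_harnack\<close> stays bounded when the point moves within a
  cell.\<close>

lemma band_kern_harnack:
  assumes P: "\<And>s x. P s x \<Longrightarrow> 0 < s \<and> s \<le> 1 \<and> \<eta> \<le> s * (1 + x\<^sup>2)" and \<eta>: "\<eta> > 0"
    and x: "x \<in> {cell_point n..cell_point (Suc n)}" and x': "x' \<in> {cell_point n..cell_point (Suc n)}" and y: "y \<ge> 0"
  shows "band_kern \<alpha> P x y \<le> ennreal (harnack_const \<eta>) * envelope \<alpha> 2 y x'"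
proof -
  note [measurable] = heat_measurable[OF a]
  define r where "r = cell_point (Suc n) - cell_point n"
  note g = cell_geometry[OF x x', folded r_def]
  have C: "harnack_const \<eta> \<ge> 0" by (simp add: harnack_const_def)
  have "band_kern \<alpha> P x y \<le> (\<integral>\<^sup>+s. ennreal (harnack_const \<eta>) * (if 0 < s \<and> s \<le> 1 then ennreal (pi * (1 + x'\<^sup>2) * exp (- pi * s * x'\<^sup>2) * heat \<alpha> (2 * s) x' y) else 0) \<partial>lborel)"
    unfolding band_kern_def
  proof (intro nn_integral_mono)
    fix s
    show "(if P s x then ennreal (band_weight s x * heat \<alpha> s x y) else 0) \<le> ennreal (harnack_const \<eta>) * (if 0 < s \<and> s \<le> 1 then ennreal (pi * (1 + x'\<^sup>2) * exp (- pi * s * x'\<^sup>2) * heat \<alpha> (2 * s) x' y) else 0)"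
    proof (cases "P s x")
      case True
      hence s: "0 < s" "s \<le> 1" and h: "\<eta> \<le> s * (1 + x\<^sup>2)" using P by auto
      have "\<eta> * r\<^sup>2 \<le> s * (1 + x\<^sup>2) * r\<^sup>2" using h by (intro mult_right_mono) auto
      also have "\<dots> \<le> s * 5" unfolding mult.assoc using s g(6) by (intro mult_left_mono) auto
      finally have "r\<^sup>2 / s \<le> 5 / \<eta>" using s \<eta> by (simp add: field_simps)
      hence "pi * (r\<^sup>2 / s) \<le> pi * (5 / \<eta>)" by (intro mult_left_mono) auto
      hence rs: "exp (pi * r\<^sup>2 / s) \<le> exp (5 * pi / \<eta>)" by (simp add: mult.commute)
      have "heat \<alpha> s x y \<le> 2 powr (\<alpha> + 1) * exp (pi * r\<^sup>2 / s) * heat \<alpha> (2 * s) x' y"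
        by (rule heat_harnack[OF a s(1) g(1,2) y g(3)])
      also have "\<dots> \<le> 2 powr (\<alpha> + 1) * exp (5 * pi / \<eta>) * heat \<alpha> (2 * s) x' y"
        using rs by (intro mult_right_mono mult_left_mono heat_nonneg a) auto
      finally have H: "heat \<alpha> s x y \<le> 2 powr (\<alpha> + 1) * exp (5 * pi / \<eta>) * heat \<alpha> (2 * s) x' y" .
      have "band_weight s x \<le> pi * (5 * (1 + x'\<^sup>2)) * (exp pi * exp (- pi * s * x'\<^sup>2))"
        unfolding band_weight_def
      proof (intro mult_mono)
        have "s * x'\<^sup>2 \<le> s * (x\<^sup>2 + 3)" using g(8) s by (intro mult_left_mono) auto
        hence "s * x'\<^sup>2 - 1 \<le> s * (2 + x\<^sup>2)" using s by (simp add: algebra_simps)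
        hence "pi * (s * x'\<^sup>2 - 1) \<le> pi * (s * (2 + x\<^sup>2))" by (intro mult_left_mono) auto
        thus "exp (- pi * s * (2 + x\<^sup>2)) \<le> exp pi * exp (- pi * s * x'\<^sup>2)"
          by (simp add: algebra_simps flip: exp_add)
      qed (use g in auto)
      hence "band_weight s x * heat \<alpha> s x y \<le> (pi * (5 * (1 + x'\<^sup>2)) * (exp pi * exp (- pi * s * x'\<^sup>2))) * (2 powr (\<alpha> + 1) * exp (5 * pi / \<eta>) * heat \<alpha> (2 * s) x' y)"
        using H by (intro mult_mono heat_nonneg a) auto
      also have "\<dots> = harnack_const \<eta> * (pi * (1 + x'\<^sup>2) * exp (- pi * s * x'\<^sup>2) * heat \<alpha> (2 * s) x' y)"
        by (simp add: harnack_const_def mult_ac)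
      finally have "ennreal (band_weight s x * heat \<alpha> s x y) \<le> ennreal (harnack_const \<eta> * (pi * (1 + x'\<^sup>2) * exp (- pi * s * x'\<^sup>2) * heat \<alpha> (2 * s) x' y))"
        by (rule ennreal_leI)
      thus ?thesis using True s by (simp add: ennreal_mult'[OF C])
    qed simp
  qed
  also have "\<dots> = ennreal (harnack_const \<eta>) * envelope \<alpha> 2 y x'"
    unfolding envelope_def by (rule nn_integral_cmult) measurable
  finally show ?thesis .
qed

lemma band_kern_column_thin:
  assumes meas: "Measurable.pred (borel \<Otimes>\<^sub>M borel) (\<lambda>(s, x). P s x)"
    and P: "\<And>s x. P s x \<Longrightarrow> 0 < s \<and> s \<le> 1 \<and> \<eta> \<le> s * (1 + x\<^sup>2)" and \<eta>: "\<eta> > 0"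
    and th: "thin \<epsilon> \<alpha> S" and y: "y \<ge> 0"
  shows "(\<integral>\<^sup>+x. band_kern \<alpha> P x y * indicator S x \<partial>mu \<alpha>) \<le> ennreal (\<epsilon> * (harnack_const \<eta> * (2 * pi * (\<alpha> + 2))))"
proof -
  note [measurable] = heat_measurable[OF a] measurable_mu_borel
  have \<epsilon>: "\<epsilon> > 0" using th by (simp add: thin_def)
  have C: "harnack_const \<eta> \<ge> 0" by (simp add: harnack_const_def)
  have km: "(\<lambda>x. band_kern \<alpha> P x y) \<in> borel_measurable (mu \<alpha>)"
    using measurable_Pair1[OF band_kern_measurable_pair[OF meas], of y] y by simp
  have "(\<integral>\<^sup>+x. band_kern \<alpha> P x y * indicator S x \<partial>mu \<alpha>) \<le> ennreal \<epsilon> * (\<integral>\<^sup>+x. ennreal (harnack_const \<eta>) * envelope \<alpha> 2 y x \<partial>mu \<alpha>)"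
    using band_kern_harnack[OF P \<eta> _ _ y] envelope_measurable by (intro thin_cover[OF th km]) auto
  also have "(\<integral>\<^sup>+x. ennreal (harnack_const \<eta>) * envelope \<alpha> 2 y x \<partial>mu \<alpha>) = ennreal (harnack_const \<eta>) * (\<integral>\<^sup>+x. envelope \<alpha> 2 y x \<partial>mu \<alpha>)"
    by (rule nn_integral_cmult[OF envelope_measurable])
  also have "ennreal \<epsilon> * \<dots> \<le> ennreal \<epsilon> * (ennreal (harnack_const \<eta>) * ennreal (2 * pi * (\<alpha> + 2)))"
    by (intro mult_left_mono envelope_column) auto
  also have "\<dots> = ennreal (\<epsilon> * (harnack_const \<eta> * (2 * pi * (\<alpha> + 2))))"
    using \<epsilon> C a by (simp add: ennreal_mult'')
  finally show ?thesis .
qed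

lemma heat_column_thin:
  assumes T: "T > 0" and th: "thin \<epsilon> \<alpha> S" and y: "y \<ge> 0"
  shows "(\<integral>\<^sup>+x. ennreal (exp (- pi * T * (2 + x\<^sup>2)) * heat \<alpha> T x y) * indicator S x \<partial>mu \<alpha>) \<le> ennreal (\<epsilon> * (2 powr (\<alpha> + 1) * exp (pi / T)))"
proof -
  note [measurable] = heat_measurable[OF a] measurable_mu_borel
  have \<epsilon>: "\<epsilon> > 0" using th by (simp add: thin_def)
  let ?C = "2 powr (\<alpha> + 1) * exp (pi / T)"
  have "(\<integral>\<^sup>+x. ennreal (exp (- pi * T * (2 + x\<^sup>2)) * heat \<alpha> T x y) * indicator S x \<partial>mu \<alpha>) \<le> ennreal \<epsilon> * (\<integral>\<^sup>+x. ennreal ?C * ennreal (heat \<alpha> (2 * T) x y) \<partial>mu \<alpha>)"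
  proof (rule thin_cover[OF th])
    fix n x x' assume x: "x \<in> {cell_point n..cell_point (Suc n)}" "x' \<in> {cell_point n..cell_point (Suc n)}"
    define r where "r = cell_point (Suc n) - cell_point n"
    note g = cell_geometry[OF x, folded r_def]
    have "r\<^sup>2 \<le> 1" using g by (simp add: power_le_one)
    hence "exp (pi * r\<^sup>2 / T) \<le> exp (pi / T)" using T by (simp add: divide_right_mono)
    hence "2 powr (\<alpha> + 1) * exp (pi * r\<^sup>2 / T) * heat \<alpha> (2 * T) x' y \<le> ?C * heat \<alpha> (2 * T) x' y"
      by (intro mult_right_mono mult_left_mono heat_nonneg a) auto
    with heat_harnack[OF a T g(1,2) y g(3)] have "heat \<alpha> T x y \<le> ?C * heat \<alpha> (2 * T) x' y" by linarith
    moreover have "exp (- pi * T * (2 + x\<^sup>2)) * heat \<alpha> T x y \<le> 1 * heat \<alpha> T x y"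
      using T by (intro mult_right_mono heat_nonneg a) auto
    ultimately have "ennreal (exp (- pi * T * (2 + x\<^sup>2)) * heat \<alpha> T x y) \<le> ennreal (?C * heat \<alpha> (2 * T) x' y)" by (intro ennreal_leI) simp
    thus "ennreal (exp (- pi * T * (2 + x\<^sup>2)) * heat \<alpha> T x y) \<le> ennreal ?C * ennreal (heat \<alpha> (2 * T) x' y)"
      by (subst (asm) ennreal_mult') auto
  qed measurable
  also have "(\<integral>\<^sup>+x. ennreal ?C * ennreal (heat \<alpha> (2 * T) x y) \<partial>mu \<alpha>) = ennreal ?C"
    using heat_mass_fst[OF a, of "2 * T" y] T by (subst nn_integral_cmult) auto
  finally show ?thesis using \<epsilon> by (simp add: ennreal_mult')
qed

end

section \<open>Splitting the bilinear form of the transform\<close>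

context
  fixes \<alpha> :: real assumes a: "\<alpha> > -1/2"
begin

interpretation M: sigma_finite_measure "mu \<alpha>" by (rule sigma_finite_mu[OF a])
interpretation MM: pair_sigma_finite "mu \<alpha>" "mu \<alpha>" ..

text \<open>The integral of \<open>\<pi> (1 + x\<^sup>2) exp (- \<pi> s (2 + x\<^sup>2 + \<xi>\<^sup>2))\<close> over \<open>s \<in> [0,T]\<close>.\<close>

definition band_symbol :: "real \<Rightarrow> real \<Rightarrow> real \<Rightarrow> real" where
  "band_symbol T x \<xi> = (1 + x\<^sup>2) * (1 - exp (- pi * T * (2 + x\<^sup>2 + \<xi>\<^sup>2))) / (2 + x\<^sup>2 + \<xi>\<^sup>2)"

lemma band_symbol_sum: "exp (- pi * T * (2 + x\<^sup>2 + \<xi>\<^sup>2)) + band_symbol T x \<xi> + band_symbol T \<xi> x = 1"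
proof -
  have q: "2 + x\<^sup>2 + \<xi>\<^sup>2 > 0" by (simp add: add_pos_nonneg)
  have "band_symbol T x \<xi> + band_symbol T \<xi> x = ((1 + x\<^sup>2) + (1 + \<xi>\<^sup>2)) * (1 - exp (- pi * T * (2 + x\<^sup>2 + \<xi>\<^sup>2))) / (2 + x\<^sup>2 + \<xi>\<^sup>2)"
    unfolding band_symbol_def by (simp only: distrib_right add_divide_distrib) (simp only: add_ac)
  also have "(1 + x\<^sup>2) + (1 + \<xi>\<^sup>2) = 2 + x\<^sup>2 + \<xi>\<^sup>2" by simp
  finally show ?thesis using q by simp
qed

lemma band_symbol_bound: assumes "T > 0" shows "\<bar>band_symbol T x \<xi>\<bar> \<le> 1"
proof -
  have q: "2 + x\<^sup>2 + \<xi>\<^sup>2 > 0" by (simp add: add_pos_nonneg)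
  have e: "0 \<le> 1 - exp (- pi * T * (2 + x\<^sup>2 + \<xi>\<^sup>2))" using assms q by simp
  have nn: "band_symbol T x \<xi> \<ge> 0" unfolding band_symbol_def using e q by (intro divide_nonneg_pos mult_nonneg_nonneg) auto
  have "band_symbol T \<xi> x \<ge> 0" unfolding band_symbol_def using e q by (intro divide_nonneg_pos mult_nonneg_nonneg) (auto simp: add_ac)
  thus ?thesis using band_symbol_sum[of T x \<xi>] nn by (smt (verit) exp_ge_zero)
qed

lemma band_symbol_integral:
  assumes T: "T > 0"
  shows "has_bochner_integral lborel (\<lambda>s. indicator {0<..T} s * (pi * (1 + x\<^sup>2) * exp (- pi * s * (2 + x\<^sup>2 + \<xi>\<^sup>2)))) (band_symbol T x \<xi>)"
proof -
  let ?q = "2 + x\<^sup>2 + \<xi>\<^sup>2"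
  have q: "?q > 0" by (simp add: add_pos_nonneg)
  let ?F = "\<lambda>s. - ((1 + x\<^sup>2) / ?q) * exp (- pi * s * ?q)"
  have "has_bochner_integral lborel (\<lambda>s. pi * (1 + x\<^sup>2) * exp (- pi * s * ?q) * indicator {0..T} s) (?F T - ?F 0)"
  proof (rule has_bochner_integral_FTC_Icc_real)
    show "DERIV ?F s :> pi * (1 + x\<^sup>2) * exp (- pi * s * ?q)" for s
      using q by (auto intro!: derivative_eq_intros)
  qed (use T in auto)
  moreover have "?F T - ?F 0 = band_symbol T x \<xi>" unfolding band_symbol_def by (simp add: algebra_simps diff_divide_distrib add_divide_distrib)
  moreover have "AE s in lborel. indicator {0<..T} s * (pi * (1 + x\<^sup>2) * exp (- pi * s * ?q)) = pi * (1 + x\<^sup>2) * exp (- pi * s * ?q) * indicator {0..T} s"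
    using AE_lborel_singleton[of 0] by eventually_elim (auto split: split_indicator)
  ultimately show ?thesis by (subst has_bochner_integral_cong_AE) auto
qed

abbreviation full :: "real \<Rightarrow> real \<Rightarrow> real \<Rightarrow> bool" where "full T \<equiv> \<lambda>s x. 0 < s \<and> s \<le> T"

text \<open>By Fubini's theorem the operator with symbol \<open>band_symbol\<close> is a superposition of Gaussian multipliers, and each of these is
  integration of the transform of \<open>g\<close> against a heat kernel.\<close>

lemma band_symbol_transform_bound:
  assumes g: "integrable (mu \<alpha>) g" and T: "T > 0"
  shows "ennreal (norm (\<integral>\<xi>. complex_of_real (band_symbol T x \<xi> * hankel_kernel \<alpha> x \<xi>) * g \<xi> \<partial>mu \<alpha>))
     \<le> (\<integral>\<^sup>+y. band_kern \<alpha> (full T) x y * ennreal (cmod (hankel_L1 \<alpha> g y)) \<partial>mu \<alpha>)"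
proof -
  have gm [measurable]: "g \<in> borel_measurable (mu \<alpha>)" using g by auto
  have Hm [measurable]: "hankel_L1 \<alpha> g \<in> borel_measurable (mu \<alpha>)" by (rule hankel_L1_measurable[OF a gm])
  note [measurable] = heat_measurable[OF a] measurable_mu_borel bessel_j_measurable[OF a]
  let ?C = "pi * (1 + x\<^sup>2)"
  let ?f = "\<lambda>s. complex_of_real (indicator {0<..T} s)"
  let ?k = "\<lambda>s \<xi>. complex_of_real (indicator {0<..T} s * (?C * exp (- pi * s * (2 + x\<^sup>2 + \<xi>\<^sup>2))) * hankel_kernel \<alpha> x \<xi>)"
  have kb: "norm (?k s \<xi>) \<le> ?C" for s \<xi>
  proof (cases "s \<in> {0<..T}")
    case True
    hence "s \<ge> 0" by simp
    hence "exp (- pi * s * (2 + x\<^sup>2 + \<xi>\<^sup>2)) \<le> 1" by simp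
    hence "exp (- pi * s * (2 + x\<^sup>2 + \<xi>\<^sup>2)) * \<bar>hankel_kernel \<alpha> x \<xi>\<bar> \<le> 1 * 1" by (intro mult_mono abs_hankel_kernel_le_1[OF a]) auto
    hence "?C * (exp (- pi * s * (2 + x\<^sup>2 + \<xi>\<^sup>2)) * \<bar>hankel_kernel \<alpha> x \<xi>\<bar>) \<le> ?C * (1 * 1)" by (intro mult_left_mono) auto
    moreover have "norm (?k s \<xi>) = ?C * (exp (- pi * s * (2 + x\<^sup>2 + \<xi>\<^sup>2)) * \<bar>hankel_kernel \<alpha> x \<xi>\<bar>)"
      using True unfolding norm_of_real abs_mult by (simp add: mult.assoc)
    ultimately show ?thesis by simp
  qed simp
  have fub: "(\<integral>s. ?f s * (\<integral>\<xi>. ?k s \<xi> * g \<xi> \<partial>mu \<alpha>) \<partial>lborel) = (\<integral>\<xi>. (\<integral>s. ?f s * ?k s \<xi> \<partial>lborel) * g \<xi> \<partial>mu \<alpha>)"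
  proof (rule Fubini_bounded_kernel[OF lborel.sigma_finite_measure_axioms sigma_finite_mu[OF a] _ g])
    show "integrable lborel ?f" using T by (intro integrable_of_real integrable_real_indicator) auto
    show "(\<lambda>(s, \<xi>). ?k s \<xi>) \<in> borel_measurable (lborel \<Otimes>\<^sub>M mu \<alpha>)" by measurable
  qed (rule kb)
  have in1: "(\<integral>s. ?f s * ?k s \<xi> \<partial>lborel) = complex_of_real (band_symbol T x \<xi> * hankel_kernel \<alpha> x \<xi>)" for \<xi>
  proof -
    have "has_bochner_integral lborel (\<lambda>s. complex_of_real (indicator {0<..T} s * (?C * exp (- pi * s * (2 + x\<^sup>2 + \<xi>\<^sup>2))) * hankel_kernel \<alpha> x \<xi>)) (complex_of_real (band_symbol T x \<xi> * hankel_kernel \<alpha> x \<xi>))"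
      by (intro has_bochner_integral_of_real has_bochner_integral_mult_left band_symbol_integral T)
    moreover have "?f s * ?k s \<xi> = ?k s \<xi>" for s by (simp split: split_indicator)
    ultimately show ?thesis by (simp only: has_bochner_integral_iff)
  qed
  have in2: "ennreal (norm (?f s * (\<integral>\<xi>. ?k s \<xi> * g \<xi> \<partial>mu \<alpha>)))
     \<le> (\<integral>\<^sup>+y. (if full T s x then ennreal (band_weight s x * heat \<alpha> s x y) else 0) * ennreal (cmod (hankel_L1 \<alpha> g y)) \<partial>mu \<alpha>)" for s
  proof (cases "full T s x")
    case True
    have "?k s \<xi> * g \<xi> = complex_of_real (band_weight s x) * (complex_of_real (exp (- pi * s * \<xi>\<^sup>2) * hankel_kernel \<alpha> x \<xi>) * g \<xi>)" for \<xi>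
    proof -
      have "exp (- pi * s * (2 + x\<^sup>2 + \<xi>\<^sup>2)) = exp (- pi * s * (2 + x\<^sup>2)) * exp (- pi * s * \<xi>\<^sup>2)"
        unfolding exp_add[symmetric] by (simp add: algebra_simps)
      thus ?thesis using True by (simp add: band_weight_def mult_ac)
    qed
    hence "(\<integral>\<xi>. ?k s \<xi> * g \<xi> \<partial>mu \<alpha>) = complex_of_real (band_weight s x) * (\<integral>\<xi>. complex_of_real (exp (- pi * s * \<xi>\<^sup>2) * hankel_kernel \<alpha> x \<xi>) * g \<xi> \<partial>mu \<alpha>)"
      by (simp only: integral_mult_right_zero)
    also have "\<dots> = (\<integral>y. complex_of_real (band_weight s x) * (complex_of_real (heat \<alpha> s x y) * hankel_L1 \<alpha> g y) \<partial>mu \<alpha>)"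
      using True by (subst heat_times_hankel_L1[OF a g]) (auto simp: integral_mult_right_zero)
    finally have "ennreal (norm (?f s * (\<integral>\<xi>. ?k s \<xi> * g \<xi> \<partial>mu \<alpha>))) \<le> ennreal (norm (\<integral>y. complex_of_real (band_weight s x) * (complex_of_real (heat \<alpha> s x y) * hankel_L1 \<alpha> g y) \<partial>mu \<alpha>))"
      using True by simp
    also have "\<dots> \<le> (\<integral>\<^sup>+y. ennreal (norm (complex_of_real (band_weight s x) * (complex_of_real (heat \<alpha> s x y) * hankel_L1 \<alpha> g y))) \<partial>mu \<alpha>)"
      by (rule norm_integral_le_nn_integral)
    also have "\<dots> = (\<integral>\<^sup>+y. ennreal (band_weight s x * heat \<alpha> s x y) * ennreal (cmod (hankel_L1 \<alpha> g y)) \<partial>mu \<alpha>)"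
      using band_weight_nonneg heat_nonneg[OF a] by (intro nn_integral_cong) (simp add: norm_mult ennreal_mult' mult.assoc)
    finally show ?thesis using True by simp
  qed auto
  interpret P: pair_sigma_finite lborel "mu \<alpha>" ..
  have "ennreal (norm (\<integral>\<xi>. complex_of_real (band_symbol T x \<xi> * hankel_kernel \<alpha> x \<xi>) * g \<xi> \<partial>mu \<alpha>)) = ennreal (norm (\<integral>s. ?f s * (\<integral>\<xi>. ?k s \<xi> * g \<xi> \<partial>mu \<alpha>) \<partial>lborel))"
    unfolding fub in1 ..
  also have "\<dots> \<le> (\<integral>\<^sup>+s. ennreal (norm (?f s * (\<integral>\<xi>. ?k s \<xi> * g \<xi> \<partial>mu \<alpha>))) \<partial>lborel)"
    by (rule norm_integral_le_nn_integral)
  also have "\<dots> \<le> (\<integral>\<^sup>+s. (\<integral>\<^sup>+y. (if full T s x then ennreal (band_weight s x * heat \<alpha> s x y) else 0) * ennreal (cmod (hankel_L1 \<alpha> g y)) \<partial>mu \<alpha>) \<partial>lborel)"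
    by (intro nn_integral_mono in2)
  also have "\<dots> = (\<integral>\<^sup>+y. (\<integral>\<^sup>+s. (if full T s x then ennreal (band_weight s x * heat \<alpha> s x y) else 0) * ennreal (cmod (hankel_L1 \<alpha> g y)) \<partial>lborel) \<partial>mu \<alpha>)"
    by (rule P.Fubini'[symmetric]) measurable
  also have "\<dots> = (\<integral>\<^sup>+y. band_kern \<alpha> (full T) x y * ennreal (cmod (hankel_L1 \<alpha> g y)) \<partial>mu \<alpha>)"
    unfolding band_kern_def
  proof (intro nn_integral_cong nn_integral_multc)
    note measurable_mu_borel [measurable del]
    fix y
    show "(\<lambda>s. if full T s x then ennreal (band_weight s x * heat \<alpha> s x y) else 0) \<in> borel_measurable lborel" by measurable
  qed
  finally show ?thesis .
qed

definition remainder :: "real \<Rightarrow> real \<Rightarrow> real \<Rightarrow> ennreal" where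
  "remainder T x y = ennreal (exp (- pi * T * (2 + x\<^sup>2)) * heat \<alpha> T x y)"

definition kern_form :: "(real \<Rightarrow> real \<Rightarrow> ennreal) \<Rightarrow> (real \<Rightarrow> complex) \<Rightarrow> (real \<Rightarrow> complex) \<Rightarrow> ennreal" where
  "kern_form k u g = (\<integral>\<^sup>+x. ennreal (cmod (u x)) * (\<integral>\<^sup>+y. k x y * ennreal (cmod (hankel_L1 \<alpha> g y)) \<partial>mu \<alpha>) \<partial>mu \<alpha>)"

text \<open>The remainder at \<open>x\<close> is a single Gaussian multiplier at time \<open>T\<close>, damped by \<open>exp (- \<pi> T (2 + x\<^sup>2))\<close>.\<close>

lemma remainder_transform_bound:
  assumes g: "integrable (mu \<alpha>) g" and T: "T > 0"
  shows "ennreal (norm (\<integral>\<xi>. complex_of_real (exp (- pi * T * (2 + x\<^sup>2 + \<xi>\<^sup>2)) * hankel_kernel \<alpha> x \<xi>) * g \<xi> \<partial>mu \<alpha>))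
     \<le> (\<integral>\<^sup>+y. remainder T x y * ennreal (cmod (hankel_L1 \<alpha> g y)) \<partial>mu \<alpha>)"
proof -
  let ?E = "exp (- pi * T * (2 + x\<^sup>2))"
  have "complex_of_real (exp (- pi * T * (2 + x\<^sup>2 + \<xi>\<^sup>2)) * hankel_kernel \<alpha> x \<xi>) * g \<xi> = complex_of_real ?E * (complex_of_real (exp (- pi * T * \<xi>\<^sup>2) * hankel_kernel \<alpha> x \<xi>) * g \<xi>)" for \<xi>
  proof -
    have "exp (- pi * T * (2 + x\<^sup>2 + \<xi>\<^sup>2)) = ?E * exp (- pi * T * \<xi>\<^sup>2)"
      unfolding exp_add[symmetric] by (simp add: algebra_simps)
    thus ?thesis by (simp only: of_real_mult mult.assoc)
  qed
  hence "(\<integral>\<xi>. complex_of_real (exp (- pi * T * (2 + x\<^sup>2 + \<xi>\<^sup>2)) * hankel_kernel \<alpha> x \<xi>) * g \<xi> \<partial>mu \<alpha>)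
     = (\<integral>y. complex_of_real ?E * (complex_of_real (heat \<alpha> T x y) * hankel_L1 \<alpha> g y) \<partial>mu \<alpha>)"
    by (simp only: integral_mult_right_zero heat_times_hankel_L1[OF a g T])
  hence "ennreal (norm (\<integral>\<xi>. complex_of_real (exp (- pi * T * (2 + x\<^sup>2 + \<xi>\<^sup>2)) * hankel_kernel \<alpha> x \<xi>) * g \<xi> \<partial>mu \<alpha>))
     = ennreal (norm (\<integral>y. complex_of_real ?E * (complex_of_real (heat \<alpha> T x y) * hankel_L1 \<alpha> g y) \<partial>mu \<alpha>))"
    by (rule arg_cong)
  also have "\<dots> \<le> (\<integral>\<^sup>+y. ennreal (norm (complex_of_real ?E * (complex_of_real (heat \<alpha> T x y) * hankel_L1 \<alpha> g y))) \<partial>mu \<alpha>)"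
    by (rule norm_integral_le_nn_integral)
  also have "\<dots> = (\<integral>\<^sup>+y. remainder T x y * ennreal (cmod (hankel_L1 \<alpha> g y)) \<partial>mu \<alpha>)"
  proof (intro nn_integral_cong)
    fix y
    have e: "norm (complex_of_real ?E * (complex_of_real (heat \<alpha> T x y) * hankel_L1 \<alpha> g y)) = (?E * heat \<alpha> T x y) * cmod (hankel_L1 \<alpha> g y)"
      unfolding norm_mult norm_of_real abs_of_nonneg[OF heat_nonneg[OF a]] abs_of_nonneg[OF exp_ge_zero] mult.assoc ..
    show "ennreal (norm (complex_of_real ?E * (complex_of_real (heat \<alpha> T x y) * hankel_L1 \<alpha> g y))) = remainder T x y * ennreal (cmod (hankel_L1 \<alpha> g y))"
      unfolding remainder_def e by (rule ennreal_mult''[OF norm_ge_zero])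
  qed
  finally show ?thesis .
qed

text \<open>The three symbols add up to one (\<open>band_symbol_sum\<close>). In the third, the roles of \<open>x\<close> and \<open>\<xi>\<close>, and with them those of
  \<open>u\<close> and \<open>g\<close>, are exchanged.\<close>

lemma form_decomposition:
  assumes u: "integrable (mu \<alpha>) u" and g: "integrable (mu \<alpha>) g" and T: "T > 0"
  shows "ennreal (norm (\<integral>x. u x * hankel_L1 \<alpha> g x \<partial>mu \<alpha>)) \<le> kern_form (remainder T) u g + kern_form (band_kern \<alpha> (full T)) u g + kern_form (band_kern \<alpha> (full T)) g u"
proof -
  note [measurable] = measurable_mu_borel bessel_j_measurable[OF a]
  have gm [measurable]: "g \<in> borel_measurable (mu \<alpha>)" "u \<in> borel_measurable (mu \<alpha>)" using g u by auto
  let ?R = "\<lambda>x \<xi>. complex_of_real (exp (- pi * T * (2 + x\<^sup>2 + \<xi>\<^sup>2)) * hankel_kernel \<alpha> x \<xi>)"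
  let ?K = "\<lambda>x \<xi>. complex_of_real (band_symbol T x \<xi> * hankel_kernel \<alpha> x \<xi>)"
  let ?L = "\<lambda>x \<xi>. complex_of_real (band_symbol T \<xi> x * hankel_kernel \<alpha> \<xi> x)"
  have meas: "case_prod ?R \<in> borel_measurable (mu \<alpha> \<Otimes>\<^sub>M mu \<alpha>)" "case_prod ?K \<in> borel_measurable (mu \<alpha> \<Otimes>\<^sub>M mu \<alpha>)" "case_prod ?L \<in> borel_measurable (mu \<alpha> \<Otimes>\<^sub>M mu \<alpha>)"
    unfolding band_symbol_def by measurable
  have bd: "norm (?R x \<xi>) \<le> 1" "norm (?K x \<xi>) \<le> 1" "norm (?L x \<xi>) \<le> 1" for x \<xi>
  proof -
    have "2 + x\<^sup>2 + \<xi>\<^sup>2 \<ge> 0" by simp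
    hence "\<bar>exp (- pi * T * (2 + x\<^sup>2 + \<xi>\<^sup>2))\<bar> \<le> 1" using T by simp
    thus "norm (?R x \<xi>) \<le> 1" unfolding norm_of_real abs_mult using abs_hankel_kernel_le_1[OF a] by (intro mult_le_one) auto
    show "norm (?K x \<xi>) \<le> 1" "norm (?L x \<xi>) \<le> 1" unfolding norm_of_real abs_mult
      using abs_hankel_kernel_le_1[OF a] band_symbol_bound[OF T] by (intro mult_le_one; auto)+
  qed
  have inner: "integrable (mu \<alpha>) (\<lambda>\<xi>. m x \<xi> * g \<xi>)" and outer: "integrable (mu \<alpha>) (\<lambda>x. u x * (\<integral>\<xi>. m x \<xi> * g \<xi> \<partial>mu \<alpha>))"
    if m [measurable]: "case_prod m \<in> borel_measurable (mu \<alpha> \<Otimes>\<^sub>M mu \<alpha>)" and mb: "\<And>x \<xi>. norm (m x \<xi>) \<le> 1" and x: "x \<in> space (mu \<alpha>)"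
    for m :: "real \<Rightarrow> real \<Rightarrow> complex" and x
  proof -
    have in': "integrable (mu \<alpha>) (\<lambda>\<xi>. m x \<xi> * g \<xi>)" if x: "x \<in> space (mu \<alpha>)" for x
      using integrable_bounded_times[OF g _ mb[of x]] measurable_Pair2[OF m x] by (simp add: mult.commute)
    thus "integrable (mu \<alpha>) (\<lambda>\<xi>. m x \<xi> * g \<xi>)" using x by blast
    let ?I = "\<lambda>x. indicator {0..} x * (\<integral>\<xi>. m x \<xi> * g \<xi> \<partial>mu \<alpha>)"
    have "integrable (mu \<alpha>) (\<lambda>x. u x * ?I x)"
    proof (rule integrable_bounded_times[OF u])
      have [measurable]: "(indicator {0..} :: real \<Rightarrow> complex) \<in> borel_measurable (mu \<alpha>)"
        by (intro measurable_mu_borel_comp) auto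
      show "?I \<in> borel_measurable (mu \<alpha>)" by measurable
      show "norm (?I x) \<le> (\<integral>\<xi>. norm (g \<xi>) \<partial>mu \<alpha>)" for x
      proof (cases "x \<ge> 0")
        case True
        have "norm (\<integral>\<xi>. m x \<xi> * g \<xi> \<partial>mu \<alpha>) \<le> (\<integral>\<xi>. norm (m x \<xi> * g \<xi>) \<partial>mu \<alpha>)" by (rule integral_norm_bound)
        also have "\<dots> \<le> (\<integral>\<xi>. norm (g \<xi>) \<partial>mu \<alpha>)"
          using True mb[of x] by (intro integral_mono integrable_norm in' g) (auto simp: norm_mult intro: mult_left_le_one_le)
        finally show ?thesis using True by simp
      qed simp
    qed
    thus "integrable (mu \<alpha>) (\<lambda>x. u x * (\<integral>\<xi>. m x \<xi> * g \<xi> \<partial>mu \<alpha>))"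
      by (rule Bochner_Integration.integrable_cong[THEN iffD1, rotated 2]) auto
  qed
  have s0: "(0::real) \<in> space (mu \<alpha>)" by simp
  have split: "hankel_L1 \<alpha> g x = (\<integral>\<xi>. ?R x \<xi> * g \<xi> \<partial>mu \<alpha>) + (\<integral>\<xi>. ?K x \<xi> * g \<xi> \<partial>mu \<alpha>) + (\<integral>\<xi>. ?L x \<xi> * g \<xi> \<partial>mu \<alpha>)" if "x \<in> space (mu \<alpha>)" for x
  proof -
    have ptw: "g \<xi> * complex_of_real (hankel_kernel \<alpha> \<xi> x) = ?R x \<xi> * g \<xi> + ?K x \<xi> * g \<xi> + ?L x \<xi> * g \<xi>" for \<xi>
    proof -
      have "?R x \<xi> + ?K x \<xi> + ?L x \<xi> = complex_of_real ((exp (- pi * T * (2 + x\<^sup>2 + \<xi>\<^sup>2)) + band_symbol T x \<xi> + band_symbol T \<xi> x) * hankel_kernel \<alpha> \<xi> x)"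
        unfolding hankel_kernel_commute[of \<alpha> x \<xi>] by (simp only: of_real_add distrib_right)
      hence e: "?R x \<xi> + ?K x \<xi> + ?L x \<xi> = complex_of_real (hankel_kernel \<alpha> \<xi> x)" by (simp only: band_symbol_sum mult_1)
      have "g \<xi> * complex_of_real (hankel_kernel \<alpha> \<xi> x) = (?R x \<xi> + ?K x \<xi> + ?L x \<xi>) * g \<xi>" unfolding e by (rule mult.commute)
      thus ?thesis by (simp only: distrib_right)
    qed
    have i: "integrable (mu \<alpha>) (\<lambda>\<xi>. ?R x \<xi> * g \<xi>)" "integrable (mu \<alpha>) (\<lambda>\<xi>. ?K x \<xi> * g \<xi>)" "integrable (mu \<alpha>) (\<lambda>\<xi>. ?L x \<xi> * g \<xi>)"
      by (rule inner[OF meas(1) bd(1) that], rule inner[OF meas(2) bd(2) that], rule inner[OF meas(3) bd(3) that])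
    show ?thesis unfolding hankel_L1_def ptw
      by (simp only: Bochner_Integration.integral_add[OF Bochner_Integration.integrable_add[OF i(1,2)] i(3)] Bochner_Integration.integral_add[OF i(1,2)])
  qed
  let ?IR = "\<integral>x. u x * (\<integral>\<xi>. ?R x \<xi> * g \<xi> \<partial>mu \<alpha>) \<partial>mu \<alpha>"
  let ?IK = "\<integral>x. u x * (\<integral>\<xi>. ?K x \<xi> * g \<xi> \<partial>mu \<alpha>) \<partial>mu \<alpha>"
  let ?IL = "\<integral>x. u x * (\<integral>\<xi>. ?L x \<xi> * g \<xi> \<partial>mu \<alpha>) \<partial>mu \<alpha>"
  have "(\<integral>x. u x * hankel_L1 \<alpha> g x \<partial>mu \<alpha>) = (\<integral>x. u x * (\<integral>\<xi>. ?R x \<xi> * g \<xi> \<partial>mu \<alpha>) + u x * (\<integral>\<xi>. ?K x \<xi> * g \<xi> \<partial>mu \<alpha>) + u x * (\<integral>\<xi>. ?L x \<xi> * g \<xi> \<partial>mu \<alpha>) \<partial>mu \<alpha>)"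
    by (intro Bochner_Integration.integral_cong refl) (simp only: split distrib_left)
  also have "\<dots> = ?IR + ?IK + ?IL"
  proof -
    have o: "integrable (mu \<alpha>) (\<lambda>x. u x * (\<integral>\<xi>. ?R x \<xi> * g \<xi> \<partial>mu \<alpha>))" "integrable (mu \<alpha>) (\<lambda>x. u x * (\<integral>\<xi>. ?K x \<xi> * g \<xi> \<partial>mu \<alpha>))"
      "integrable (mu \<alpha>) (\<lambda>x. u x * (\<integral>\<xi>. ?L x \<xi> * g \<xi> \<partial>mu \<alpha>))"
      by (rule outer[OF meas(1) bd(1) s0], rule outer[OF meas(2) bd(2) s0], rule outer[OF meas(3) bd(3) s0])
    show ?thesis
      by (simp only: Bochner_Integration.integral_add[OF Bochner_Integration.integrable_add[OF o(1,2)] o(3)] Bochner_Integration.integral_add[OF o(1,2)])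
  qed
  finally have e: "(\<integral>x. u x * hankel_L1 \<alpha> g x \<partial>mu \<alpha>) = ?IR + ?IK + ?IL" .
  have "norm (\<integral>x. u x * hankel_L1 \<alpha> g x \<partial>mu \<alpha>) \<le> norm ?IR + norm ?IK + norm ?IL"
    unfolding e by (rule order_trans[OF norm_triangle_ineq add_right_mono[OF norm_triangle_ineq]])
  hence "ennreal (norm (\<integral>x. u x * hankel_L1 \<alpha> g x \<partial>mu \<alpha>)) \<le> ennreal (norm ?IR + norm ?IK + norm ?IL)" by (rule ennreal_leI)
  also have "\<dots> = ennreal (norm ?IR) + ennreal (norm ?IK) + ennreal (norm ?IL)"
    by (simp only: ennreal_plus norm_ge_zero add_nonneg_nonneg)
  also have "\<dots> \<le> kern_form (remainder T) u g + kern_form (band_kern \<alpha> (full T)) u g + kern_form (band_kern \<alpha> (full T)) g u"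
  proof (intro add_mono)
    have outerb: "ennreal (norm (\<integral>x. v x * G x \<partial>mu \<alpha>)) \<le> kern_form k v w"
      if "\<And>x. ennreal (norm (G x)) \<le> (\<integral>\<^sup>+y. k x y * ennreal (cmod (hankel_L1 \<alpha> w y)) \<partial>mu \<alpha>)" for v w G k
    proof -
      have "ennreal (norm (\<integral>x. v x * G x \<partial>mu \<alpha>)) \<le> (\<integral>\<^sup>+x. ennreal (norm (v x * G x)) \<partial>mu \<alpha>)" by (rule norm_integral_le_nn_integral)
      also have "\<dots> \<le> kern_form k v w" unfolding kern_form_def norm_mult
        by (intro nn_integral_mono) (auto simp: ennreal_mult' intro: mult_left_mono that)
      finally show ?thesis .
    qed
    show "ennreal (norm ?IR) \<le> kern_form (remainder T) u g" by (intro outerb remainder_transform_bound g T)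
    show "ennreal (norm ?IK) \<le> kern_form (band_kern \<alpha> (full T)) u g" by (intro outerb band_symbol_transform_bound g T)
    have "?IL = (\<integral>\<xi>. (\<integral>x. u x * ?L x \<xi> \<partial>mu \<alpha>) * g \<xi> \<partial>mu \<alpha>)"
      by (rule Fubini_bounded_kernel[OF sigma_finite_mu[OF a] sigma_finite_mu[OF a] u g meas(3) bd(3)])
    also have "\<dots> = (\<integral>\<xi>. g \<xi> * (\<integral>x. ?K \<xi> x * u x \<partial>mu \<alpha>) \<partial>mu \<alpha>)" by (simp only: mult.commute)
    finally show "ennreal (norm ?IL) \<le> kern_form (band_kern \<alpha> (full T)) g u"
      by (simp only:) (intro outerb band_symbol_transform_bound u T)
  qed
  finally show ?thesis .
qed

end

section \<open>Smallness of the form on thin sets\<close>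

context
  fixes \<alpha> :: real assumes a: "\<alpha> > -1/2"
begin

interpretation M: sigma_finite_measure "mu \<alpha>" by (rule sigma_finite_mu[OF a])
interpretation MM: pair_sigma_finite "mu \<alpha>" "mu \<alpha>" ..

lemma kern_form_young:
  assumes k [measurable]: "case_prod k \<in> borel_measurable (mu \<alpha> \<Otimes>\<^sub>M mu \<alpha>)"
    and u: "integrable (mu \<alpha>) u" and g: "integrable (mu \<alpha>) g"
    and S [measurable]: "S \<in> sets (mu \<alpha>)" and supp: "\<And>x. x \<notin> S \<Longrightarrow> u x = 0"
    and row: "\<And>x. x \<ge> 0 \<Longrightarrow> (\<integral>\<^sup>+y. k x y \<partial>mu \<alpha>) \<le> ennreal R" and col: "\<And>y. y \<ge> 0 \<Longrightarrow> (\<integral>\<^sup>+x. k x y * indicator S x \<partial>mu \<alpha>) \<le> ennreal C"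
    and l: "l > 0" and RC: "R \<ge> 0" "C \<ge> 0"
  shows "2 * kern_form \<alpha> k u g \<le> ennreal (l * R) * energy \<alpha> u + ennreal (C / l) * energy \<alpha> g"
proof -
  have [measurable]: "u \<in> borel_measurable (mu \<alpha>)" "g \<in> borel_measurable (mu \<alpha>)" using u g by auto
  have Hm [measurable]: "hankel_L1 \<alpha> g \<in> borel_measurable (mu \<alpha>)" using g by (intro hankel_L1_measurable[OF a]) auto
  let ?k = "\<lambda>x y. k x y * indicator S x"
  have km: "case_prod ?k \<in> borel_measurable (mu \<alpha> \<Otimes>\<^sub>M mu \<alpha>)" by measurable
  have "kern_form \<alpha> k u g = (\<integral>\<^sup>+x. ennreal (cmod (u x)) * (\<integral>\<^sup>+y. ?k x y * ennreal (cmod (hankel_L1 \<alpha> g y)) \<partial>mu \<alpha>) \<partial>mu \<alpha>)"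
    unfolding kern_form_def[OF a] using supp by (intro nn_integral_cong) (auto split: split_indicator)
  hence "2 * kern_form \<alpha> k u g \<le> ennreal l * (\<integral>\<^sup>+x. ennreal ((cmod (u x))\<^sup>2) * (\<integral>\<^sup>+y. ?k x y \<partial>mu \<alpha>) \<partial>mu \<alpha>)
       + ennreal (1 / l) * (\<integral>\<^sup>+y. ennreal ((cmod (hankel_L1 \<alpha> g y))\<^sup>2) * (\<integral>\<^sup>+x. ?k x y \<partial>mu \<alpha>) \<partial>mu \<alpha>)"
    using young_schur[OF sigma_finite_mu[OF a] sigma_finite_mu[OF a] km, of u "hankel_L1 \<alpha> g" l] l by simp
  also have "\<dots> \<le> ennreal l * (\<integral>\<^sup>+x. ennreal ((cmod (u x))\<^sup>2) * ennreal R \<partial>mu \<alpha>)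
       + ennreal (1 / l) * (\<integral>\<^sup>+y. ennreal ((cmod (hankel_L1 \<alpha> g y))\<^sup>2) * ennreal C \<partial>mu \<alpha>)"
  proof (intro add_mono mult_left_mono nn_integral_mono)
    fix x assume "x \<in> space (mu \<alpha>)"
    hence x: "x \<ge> 0" by simp
    have "(\<integral>\<^sup>+y. ?k x y \<partial>mu \<alpha>) \<le> (\<integral>\<^sup>+y. k x y \<partial>mu \<alpha>)"
      by (intro nn_integral_mono) (auto split: split_indicator)
    thus "(\<integral>\<^sup>+y. ?k x y \<partial>mu \<alpha>) \<le> ennreal R" using row[OF x] by (rule order_trans)
  qed (use col in auto)
  also have "\<dots> = ennreal l * (energy \<alpha> u * ennreal R) + ennreal (1 / l) * (energy \<alpha> (hankel_L1 \<alpha> g) * ennreal C)"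
    unfolding energy_def by (simp add: nn_integral_multc)
  also have "\<dots> \<le> ennreal l * (energy \<alpha> u * ennreal R) + ennreal (1 / l) * (energy \<alpha> g * ennreal C)"
    by (intro add_left_mono mult_left_mono mult_right_mono hankel_L1_contraction a g) auto
  also have "\<dots> = ennreal (l * R) * energy \<alpha> u + ennreal (C / l) * energy \<alpha> g"
  proof -
    have "ennreal (l * R) = ennreal l * ennreal R" using l by (intro ennreal_mult') simp
    moreover have "ennreal (C / l) = ennreal (1 / l) * ennreal C" using l by (subst ennreal_mult'[symmetric]) auto
    ultimately show ?thesis by (simp only: mult_ac)
  qed
  finally show ?thesis .
qed

abbreviation low :: "real \<Rightarrow> real \<Rightarrow> real \<Rightarrow> real \<Rightarrow> bool" where
  "low T \<eta> \<equiv> \<lambda>s x. 0 < s \<and> s \<le> T \<and> s * (1 + x\<^sup>2) < \<eta>"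
abbreviation high :: "real \<Rightarrow> real \<Rightarrow> real \<Rightarrow> real \<Rightarrow> bool" where
  "high T \<eta> \<equiv> \<lambda>s x. 0 < s \<and> s \<le> T \<and> \<eta> \<le> s * (1 + x\<^sup>2)"

lemma low_pred: "Measurable.pred (borel \<Otimes>\<^sub>M borel) (\<lambda>(s, x). low T \<eta> s x)"
  and high_pred: "Measurable.pred (borel \<Otimes>\<^sub>M borel) (\<lambda>(s, x). high T \<eta> s x)"
  by measurable

lemma band_kern_split: "band_kern \<alpha> (full T) x y = band_kern \<alpha> (low T \<eta>) x y + band_kern \<alpha> (high T \<eta>) x y"
proof -
  note [measurable] = heat_measurable[OF a]
  have "band_kern \<alpha> (full T) x y = (\<integral>\<^sup>+s. (if low T \<eta> s x then ennreal (band_weight s x * heat \<alpha> s x y) else 0) + (if high T \<eta> s x then ennreal (band_weight s x * heat \<alpha> s x y) else 0) \<partial>lborel)"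
    unfolding band_kern_def by (intro nn_integral_cong) auto
  also have "\<dots> = band_kern \<alpha> (low T \<eta>) x y + band_kern \<alpha> (high T \<eta>) x y"
    unfolding band_kern_def by (rule nn_integral_add) measurable
  finally show ?thesis .
qed

lemma kern_form_add:
  assumes k1 [measurable]: "case_prod k1 \<in> borel_measurable (mu \<alpha> \<Otimes>\<^sub>M mu \<alpha>)"
    and k2 [measurable]: "case_prod k2 \<in> borel_measurable (mu \<alpha> \<Otimes>\<^sub>M mu \<alpha>)"
    and u: "integrable (mu \<alpha>) u" and g: "integrable (mu \<alpha>) g"
  shows "kern_form \<alpha> (\<lambda>x y. k1 x y + k2 x y) u g = kern_form \<alpha> k1 u g + kern_form \<alpha> k2 u g"
proof -
  have [measurable]: "u \<in> borel_measurable (mu \<alpha>)" "g \<in> borel_measurable (mu \<alpha>)" using u g by auto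
  have Hm [measurable]: "hankel_L1 \<alpha> g \<in> borel_measurable (mu \<alpha>)" using g by (intro hankel_L1_measurable[OF a]) auto
  have kx [measurable]: "k1 x \<in> borel_measurable (mu \<alpha>)" "k2 x \<in> borel_measurable (mu \<alpha>)" if "x \<in> space (mu \<alpha>)" for x
    using measurable_Pair2[OF k1 that] measurable_Pair2[OF k2 that] by simp_all
  have "kern_form \<alpha> (\<lambda>x y. k1 x y + k2 x y) u g = (\<integral>\<^sup>+x. ennreal (cmod (u x)) * (\<integral>\<^sup>+y. k1 x y * ennreal (cmod (hankel_L1 \<alpha> g y)) \<partial>mu \<alpha>)
     + ennreal (cmod (u x)) * (\<integral>\<^sup>+y. k2 x y * ennreal (cmod (hankel_L1 \<alpha> g y)) \<partial>mu \<alpha>) \<partial>mu \<alpha>)"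
    unfolding kern_form_def[OF a] by (intro nn_integral_cong) (simp add: distrib_right nn_integral_add distrib_left del: space_mu)
  also have "\<dots> = kern_form \<alpha> k1 u g + kern_form \<alpha> k2 u g" unfolding kern_form_def[OF a] by (rule nn_integral_add) measurable
  finally show ?thesis .
qed

definition col_const :: real where "col_const = 2 * pi * (\<alpha> + 2)"
text \<open>The threshold \<open>\<eta>\<close> for \<open>s (1 + x\<^sup>2)\<close> that balances rows \<open>\<pi> \<eta>\<close> against columns \<open>col_const\<close> in Schur's test to give the bound \<open>d\<close>.\<close>

definition cutoff :: "real \<Rightarrow> real" where "cutoff d = d\<^sup>2 / (4 * pi * col_const)"

lemma col_const_pos: "col_const > 0" using a by (simp add: col_const_def)
lemma cutoff_pos: "d > 0 \<Longrightarrow> cutoff d > 0" using col_const_pos by (simp add: cutoff_def)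

text \<open>Times below the threshold have small rows and bounded columns, times above it have rows at most one and, by assumption,
  small columns. The weights in Schur's test are chosen accordingly.\<close>

lemma full_form_bound:
  assumes u: "integrable (mu \<alpha>) u" and g: "integrable (mu \<alpha>) g" and d: "d > 0" and T: "0 < T" "T \<le> 1"
    and S: "S \<in> sets (mu \<alpha>)" and supp: "\<And>x. x \<notin> S \<Longrightarrow> u x = 0"
    and col: "\<And>y. y \<ge> 0 \<Longrightarrow> (\<integral>\<^sup>+x. band_kern \<alpha> (high T (cutoff d)) x y * indicator S x \<partial>mu \<alpha>) \<le> ennreal (d\<^sup>2 / 4)"
  shows "2 * kern_form \<alpha> (band_kern \<alpha> (full T)) u g \<le> ennreal d * (energy \<alpha> u + energy \<alpha> g)"
proof -
  let ?\<eta> = "cutoff d" and ?C = col_const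
  note eta = cutoff_pos[OF d]
  have ml: "case_prod (band_kern \<alpha> (low T ?\<eta>)) \<in> borel_measurable (mu \<alpha> \<Otimes>\<^sub>M mu \<alpha>)" by (rule band_kern_measurable_pair[OF a low_pred])
  have mh: "case_prod (band_kern \<alpha> (high T ?\<eta>)) \<in> borel_measurable (mu \<alpha> \<Otimes>\<^sub>M mu \<alpha>)" by (rule band_kern_measurable_pair[OF a high_pred])
  have "2 * kern_form \<alpha> (band_kern \<alpha> (low T ?\<eta>)) u g \<le> ennreal ((2 * ?C / d) * (pi * ?\<eta>)) * energy \<alpha> u + ennreal (?C / (2 * ?C / d)) * energy \<alpha> g"
  proof (rule kern_form_young[OF ml u g S supp])
    show "(\<integral>\<^sup>+y. band_kern \<alpha> (low T ?\<eta>) x y \<partial>mu \<alpha>) \<le> ennreal (pi * ?\<eta>)" for x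
      by (rule band_kern_row_small[OF a low_pred _ eta]) auto
    show "(\<integral>\<^sup>+x. band_kern \<alpha> (low T ?\<eta>) x y * indicator S x \<partial>mu \<alpha>) \<le> ennreal ?C" for y
    proof (rule order_trans)
      show "(\<integral>\<^sup>+x. band_kern \<alpha> (low T ?\<eta>) x y * indicator S x \<partial>mu \<alpha>) \<le> (\<integral>\<^sup>+x. band_kern \<alpha> (low T ?\<eta>) x y \<partial>mu \<alpha>)"
        by (intro nn_integral_mono) (auto split: split_indicator)
      show "(\<integral>\<^sup>+x. band_kern \<alpha> (low T ?\<eta>) x y \<partial>mu \<alpha>) \<le> ennreal ?C"
        unfolding col_const_def using T by (intro band_kern_column[OF a]) auto
    qed
  qed (use d eta col_const_pos in auto)
  also have "(2 * ?C / d) * (pi * ?\<eta>) = d / 2" using d col_const_pos by (simp add: cutoff_def field_simps power2_eq_square)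
  also have "?C / (2 * ?C / d) = d / 2" using d col_const_pos by (simp add: field_simps)
  finally have L: "2 * kern_form \<alpha> (band_kern \<alpha> (low T ?\<eta>)) u g \<le> ennreal (d / 2) * energy \<alpha> u + ennreal (d / 2) * energy \<alpha> g" .
  have "2 * kern_form \<alpha> (band_kern \<alpha> (high T ?\<eta>)) u g \<le> ennreal ((d / 2) * 1) * energy \<alpha> u + ennreal ((d\<^sup>2 / 4) / (d / 2)) * energy \<alpha> g"
  proof (rule kern_form_young[OF mh u g S supp])
    show "(\<integral>\<^sup>+y. band_kern \<alpha> (high T ?\<eta>) x y \<partial>mu \<alpha>) \<le> ennreal 1" for x
      using band_kern_row_le_1[OF a high_pred _ T(1), of T ?\<eta> x] by simp
  qed (use d col in auto)
  also have "(d\<^sup>2 / 4) / (d / 2) = d / 2" using d by (simp add: power2_eq_square)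
  finally have H: "2 * kern_form \<alpha> (band_kern \<alpha> (high T ?\<eta>)) u g \<le> ennreal (d / 2) * energy \<alpha> u + ennreal (d / 2) * energy \<alpha> g" by simp
  have "2 * kern_form \<alpha> (band_kern \<alpha> (full T)) u g = 2 * kern_form \<alpha> (band_kern \<alpha> (low T ?\<eta>)) u g + 2 * kern_form \<alpha> (band_kern \<alpha> (high T ?\<eta>)) u g"
  proof -
    have "band_kern \<alpha> (full T) = (\<lambda>x y. band_kern \<alpha> (low T ?\<eta>) x y + band_kern \<alpha> (high T ?\<eta>) x y)" by (intro ext band_kern_split)
    hence "kern_form \<alpha> (band_kern \<alpha> (full T)) u g = kern_form \<alpha> (band_kern \<alpha> (low T ?\<eta>)) u g + kern_form \<alpha> (band_kern \<alpha> (high T ?\<eta>)) u g"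
      using kern_form_add[OF ml mh u g] by (simp only:)
    thus ?thesis by (simp only:) (rule distrib_left)
  qed
  also have "\<dots> \<le> (ennreal (d / 2) * energy \<alpha> u + ennreal (d / 2) * energy \<alpha> g) + (ennreal (d / 2) * energy \<alpha> u + ennreal (d / 2) * energy \<alpha> g)"
    by (rule add_mono[OF L H])
  also have "\<dots> = (ennreal (d / 2) + ennreal (d / 2)) * (energy \<alpha> u + energy \<alpha> g)" by (simp only: distrib_left distrib_right add_ac)
  also have "ennreal (d / 2) + ennreal (d / 2) = ennreal d" using d by (simp flip: ennreal_plus)
  finally show ?thesis .
qed

lemma remainder_form_bound:
  assumes u: "integrable (mu \<alpha>) u" and g: "integrable (mu \<alpha>) g" and d: "d > 0" and T: "0 < T"
    and th: "thin \<epsilon> \<alpha> S" and supp: "\<And>x. x \<notin> S \<Longrightarrow> u x = 0"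
    and eps: "\<epsilon> * (2 powr (\<alpha> + 1) * exp (pi / T)) \<le> d\<^sup>2"
  shows "2 * kern_form \<alpha> (remainder \<alpha> T) u g \<le> ennreal d * (energy \<alpha> u + energy \<alpha> g)"
proof -
  have S: "S \<in> sets (mu \<alpha>)" using th by (simp add: thin_def)
  note [measurable] = heat_measurable[OF a] measurable_mu_borel
  have m: "case_prod (remainder \<alpha> T) \<in> borel_measurable (mu \<alpha> \<Otimes>\<^sub>M mu \<alpha>)"
    unfolding remainder_def[OF a] by measurable
  have "2 * kern_form \<alpha> (remainder \<alpha> T) u g \<le> ennreal (d * 1) * energy \<alpha> u + ennreal (d\<^sup>2 / d) * energy \<alpha> g"
  proof (rule kern_form_young[OF m u g S supp])
    fix x :: real
    have "(\<integral>\<^sup>+y. remainder \<alpha> T x y \<partial>mu \<alpha>) \<le> (\<integral>\<^sup>+y. ennreal (heat \<alpha> T x y) \<partial>mu \<alpha>)"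
      unfolding remainder_def[OF a] using T
      by (intro nn_integral_mono ennreal_leI) (auto intro!: mult_left_le_one_le heat_nonneg a)
    thus "(\<integral>\<^sup>+y. remainder \<alpha> T x y \<partial>mu \<alpha>) \<le> ennreal 1" using heat_mass[OF a T] by simp
  next
    fix y :: real assume y: "y \<ge> 0"
    show "(\<integral>\<^sup>+x. remainder \<alpha> T x y * indicator S x \<partial>mu \<alpha>) \<le> ennreal (d\<^sup>2)"
      unfolding remainder_def[OF a] by (rule order_trans[OF heat_column_thin[OF a T th y] ennreal_leI[OF eps]])
  qed (use d in auto)
  also have "\<dots> = ennreal d * (energy \<alpha> u + energy \<alpha> g)" using d by (simp add: power2_eq_square distrib_left)
  finally show ?thesis .
qed

text \<open>The constants are chosen in the order \<open>cutoff d\<close>, then \<open>T\<close>, then the bound on \<open>\<epsilon>\<close>. The time \<open>T\<close> is so small that no time up to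
  \<open>T\<close> lies above the threshold on \<open>[0,b]\<close>; this is why a bounded interval may be added to one of the two sets.\<close>

lemma small_form:
  assumes d: "d > 0"
  shows "\<exists>\<epsilon>\<^sub>1>0. \<forall>\<epsilon> S\<^sub>1 S\<^sub>2 u g. \<epsilon> < \<epsilon>\<^sub>1 \<longrightarrow> thin \<epsilon> \<alpha> S\<^sub>1 \<longrightarrow> thin \<epsilon> \<alpha> S\<^sub>2 \<longrightarrow>
     integrable (mu \<alpha>) u \<longrightarrow> integrable (mu \<alpha>) g \<longrightarrow> (\<forall>x. x \<notin> S\<^sub>1 \<longrightarrow> u x = 0) \<longrightarrow> (\<forall>x. x \<notin> {0..b} \<union> S\<^sub>2 \<longrightarrow> g x = 0) \<longrightarrow>
     2 * ennreal (norm (\<integral>x. u x * hankel_L1 \<alpha> g x \<partial>mu \<alpha>)) \<le> ennreal (3 * d) * (energy \<alpha> u + energy \<alpha> g)"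
proof -
  let ?\<eta> = "cutoff d"
  have eta: "?\<eta> > 0" by (rule cutoff_pos[OF d])
  define T where "T = min 1 (?\<eta> / (2 * (1 + b\<^sup>2)))"
  have q: "1 + b\<^sup>2 > 0" by (simp add: add_pos_nonneg)
  have T: "0 < T" "T \<le> 1" using eta q by (auto simp: T_def)
  have Tb: "T * (1 + b\<^sup>2) < ?\<eta>"
  proof -
    have "T * (1 + b\<^sup>2) \<le> ?\<eta> / (2 * (1 + b\<^sup>2)) * (1 + b\<^sup>2)" using q by (intro mult_right_mono) (auto simp: T_def)
    also have "\<dots> = ?\<eta> / 2"
    proof -
      have "e / (2 * Q) * Q = e / 2" if "Q > 0" for e Q :: real using that by simp
      from this[OF q] show ?thesis .
    qed
    finally show ?thesis using eta by simp
  qed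
  let ?A = "harnack_const \<alpha> ?\<eta> * (2 * pi * (\<alpha> + 2))" and ?B = "2 powr (\<alpha> + 1) * exp (pi / T)"
  have A: "?A > 0" unfolding harnack_const_def[OF a] using a by (intro mult_pos_pos) auto
  have B: "?B > 0" by simp
  define e1 where "e1 = min (d\<^sup>2 / 4 / ?A) (d\<^sup>2 / ?B)"
  have e1: "e1 > 0" using d A B by (auto simp: e1_def)
  show ?thesis
  proof (intro exI[of _ e1] conjI e1 allI impI)
    fix \<epsilon> S1 S2 and u g :: "real \<Rightarrow> complex"
    assume e: "\<epsilon> < e1" and th1: "thin \<epsilon> \<alpha> S1" and th2: "thin \<epsilon> \<alpha> S2" and u: "integrable (mu \<alpha>) u" and g: "integrable (mu \<alpha>) g"
      and su: "\<forall>x. x \<notin> S1 \<longrightarrow> u x = 0" and sg: "\<forall>x. x \<notin> {0..b} \<union> S2 \<longrightarrow> g x = 0"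
    have S1: "S1 \<in> sets (mu \<alpha>)" and S2: "S2 \<in> sets (mu \<alpha>)" using th1 th2 by (auto simp: thin_def)
    have eA: "\<epsilon> * ?A \<le> d\<^sup>2 / 4" using e A by (simp add: e1_def pos_less_divide_eq less_imp_le)
    have eB: "\<epsilon> * ?B \<le> d\<^sup>2" using e B by (simp add: e1_def pos_less_divide_eq less_imp_le)
    have col: "(\<integral>\<^sup>+x. band_kern \<alpha> (high T ?\<eta>) x y * indicator S x \<partial>mu \<alpha>) \<le> ennreal (d\<^sup>2 / 4)" if "thin \<epsilon> \<alpha> S" "y \<ge> 0" for S y
      using band_kern_column_thin[OF a high_pred _ eta that, of T] T eA
      by (intro order_trans[OF _ ennreal_leI[OF eA]]) auto
    have col2: "(\<integral>\<^sup>+x. band_kern \<alpha> (high T ?\<eta>) x y * indicator ({0..b} \<union> S2) x \<partial>mu \<alpha>) \<le> ennreal (d\<^sup>2 / 4)" if y: "y \<ge> 0" for y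
    proof -
      have z: "band_kern \<alpha> (high T ?\<eta>) x y = 0" if "0 \<le> x" "x \<le> b" for x
      proof -
        have no: "\<not> high T ?\<eta> s x" for s
        proof
          assume h: "high T ?\<eta> s x"
          have "x\<^sup>2 \<le> b\<^sup>2" using that by (intro power_mono) auto
          hence "s * (1 + x\<^sup>2) \<le> T * (1 + b\<^sup>2)" using h by (intro mult_mono) auto
          thus False using h Tb by linarith
        qed
        show ?thesis unfolding band_kern_def if_not_P[OF no] by simp
      qed
      have "(\<integral>\<^sup>+x. band_kern \<alpha> (high T ?\<eta>) x y * indicator ({0..b} \<union> S2) x \<partial>mu \<alpha>) \<le> (\<integral>\<^sup>+x. band_kern \<alpha> (high T ?\<eta>) x y * indicator S2 x \<partial>mu \<alpha>)"
        by (intro nn_integral_mono) (auto split: split_indicator simp: z)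
      also have "\<dots> \<le> ennreal (d\<^sup>2 / 4)" by (rule col[OF th2 y])
      finally show ?thesis .
    qed
    have U: "{0..b} \<union> S2 \<in> sets (mu \<alpha>)" by (rule sets.Un[OF sets_mu_borel S2]) auto
    let ?X = "energy \<alpha> u + energy \<alpha> g"
    have "2 * ennreal (norm (\<integral>x. u x * hankel_L1 \<alpha> g x \<partial>mu \<alpha>)) \<le> 2 * (kern_form \<alpha> (remainder \<alpha> T) u g + kern_form \<alpha> (band_kern \<alpha> (full T)) u g + kern_form \<alpha> (band_kern \<alpha> (full T)) g u)"
      by (intro mult_left_mono form_decomposition a u g T) auto
    also have "\<dots> = 2 * kern_form \<alpha> (remainder \<alpha> T) u g + 2 * kern_form \<alpha> (band_kern \<alpha> (full T)) u g + 2 * kern_form \<alpha> (band_kern \<alpha> (full T)) g u"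
      by (simp only: distrib_left)
    also have "\<dots> \<le> ennreal d * ?X + ennreal d * ?X + ennreal d * ?X"
    proof (intro add_mono)
      show "2 * kern_form \<alpha> (remainder \<alpha> T) u g \<le> ennreal d * ?X" using su by (intro remainder_form_bound[OF u g d T(1) th1 _ eB]) auto
      show "2 * kern_form \<alpha> (band_kern \<alpha> (full T)) u g \<le> ennreal d * ?X" using su col[OF th1] by (intro full_form_bound[OF u g d T S1]) auto
      have "2 * kern_form \<alpha> (band_kern \<alpha> (full T)) g u \<le> ennreal d * (energy \<alpha> g + energy \<alpha> u)" using sg col2 by (intro full_form_bound[OF g u d T U]) auto
      thus "2 * kern_form \<alpha> (band_kern \<alpha> (full T)) g u \<le> ennreal d * ?X" by (simp only: add.commute)
    qed
    also have "\<dots> = (ennreal d + ennreal d + ennreal d) * ?X" by (simp only: distrib_right)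
    also have "ennreal d + ennreal d + ennreal d = ennreal (3 * d)" using d by (simp flip: ennreal_plus)
    finally show "2 * ennreal (norm (\<integral>x. u x * hankel_L1 \<alpha> g x \<partial>mu \<alpha>)) \<le> ennreal (3 * d) * ?X" .
  qed
qed

text \<open>Test the form with the conjugate of the transform itself, restricted to \<open>A\<close> and truncated.\<close>

lemma energy_from_form:
  assumes f1: "integrable (mu \<alpha>) f" and f2: "f \<in> L2 \<alpha>" and A [measurable]: "A \<in> sets (mu \<alpha>)" and d: "0 < d" "d \<le> 1"
    and form: "\<And>h. integrable (mu \<alpha>) h \<Longrightarrow> (\<forall>x. x \<notin> A \<longrightarrow> h x = 0) \<Longrightarrow> 2 * ennreal (norm (\<integral>x. hankel_L1 \<alpha> f x * h x \<partial>mu \<alpha>)) \<le> ennreal d * (energy \<alpha> f + energy \<alpha> h)"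
  shows "(rnorm \<alpha> (\<lambda>x. indicator A x * hankel_L1 \<alpha> f x))\<^sup>2 \<le> d * (rnorm \<alpha> f)\<^sup>2"
proof -
  define w where "w = (\<lambda>x. indicator A x * hankel_L1 \<alpha> f x)"
  have wL: "w \<in> L2 \<alpha>" unfolding w_def by (intro L2_indicator hankel_L1_L2[OF a f1 f2] A)
  define W where "W = (\<lambda>(n::nat) x. indicator {..real n} x * w x)"
  have W: "W n \<in> L2 \<alpha>" "integrable (mu \<alpha>) (W n)" "(\<lambda>n. rnorm \<alpha> (\<lambda>x. W n x - w x)) \<longlonglongrightarrow> 0" for n
    using truncation[OF a wL] by (simp_all only: W_def)
  have bd: "(rnorm \<alpha> (W n))\<^sup>2 \<le> d * (rnorm \<alpha> f)\<^sup>2" for n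
  proof -
    let ?h = "\<lambda>x. cnj (W n x)"
    let ?N = "(rnorm \<alpha> (W n))\<^sup>2"
    have [measurable]: "W n \<in> borel_measurable (mu \<alpha>)" using W(1) by (rule L2_measurable)
    have eN: "energy \<alpha> (W n) = ennreal ?N" using energy_eq_rn[OF L2_finite[OF W(1)]] .
    have hN: "energy \<alpha> ?h = ennreal ?N" unfolding eN[symmetric] by (rule energy_cong) simp
    have pt: "hankel_L1 \<alpha> f x * ?h x = complex_of_real ((cmod (W n x))\<^sup>2)" for x
      unfolding complex_norm_square by (simp add: W_def w_def split: split_indicator)
    have i: "integrable (mu \<alpha>) (\<lambda>x. (cmod (W n x))\<^sup>2)"
      using L2_finite[OF W(1)] unfolding energy_def by (intro integrableI_nonneg) auto
    have "ennreal (norm (\<integral>x. hankel_L1 \<alpha> f x * ?h x \<partial>mu \<alpha>)) = ennreal (\<integral>x. (cmod (W n x))\<^sup>2 \<partial>mu \<alpha>)"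
      unfolding pt integral_complex_of_real by simp
    also have "\<dots> = energy \<alpha> (W n)" unfolding energy_def by (rule nn_integral_eq_integral[OF i, symmetric]) auto
    finally have nrm: "ennreal (norm (\<integral>x. hankel_L1 \<alpha> f x * ?h x \<partial>mu \<alpha>)) = ennreal ?N" using eN by simp
    have "2 * ennreal ?N \<le> ennreal d * (ennreal ((rnorm \<alpha> f)\<^sup>2) + ennreal ?N)"
    proof -
      have "integrable (mu \<alpha>) ?h" using W(2)[of n] by simp
      moreover have "\<forall>x. x \<notin> A \<longrightarrow> ?h x = 0" by (simp add: W_def w_def)
      ultimately show ?thesis using form[of ?h] unfolding nrm hN energy_eq_rn[OF L2_finite[OF f2]] by blast
    qed
    hence "ennreal (2 * ?N) \<le> ennreal (d * ((rnorm \<alpha> f)\<^sup>2 + ?N))" using d by (simp add: ennreal_mult)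
    hence "2 * ?N \<le> d * ((rnorm \<alpha> f)\<^sup>2 + ?N)" using d by (subst (asm) ennreal_le_iff) auto
    moreover have "d * ?N \<le> 1 * ?N" using d by (intro mult_right_mono) auto
    ultimately show ?thesis by (simp add: distrib_left)
  qed
  have lim: "(\<lambda>n. (rnorm \<alpha> (W n))\<^sup>2) \<longlonglongrightarrow> (rnorm \<alpha> w)\<^sup>2" by (intro tendsto_power rnorm_tendsto W wL)
  show ?thesis unfolding w_def[symmetric] by (rule LIMSEQ_le_const2[OF lim]) (use bd in auto)
qed

end

section \<open>Strict contraction between bounded intervals\<close>

context
  fixes \<alpha> :: real assumes a: "\<alpha> > -1/2"
begin

text \<open>Integrate the power series of the Bessel function term by term. The support condition bounds the coefficients by those of
  the modified Bessel function at \<open>2 \<pi> A \<bar>z\<bar>\<close>.\<close>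

lemma hankel_L1_entire_extension:
  assumes v: "integrable (mu \<alpha>) v" and A: "A > 0" and supp: "\<And>x. x > A \<Longrightarrow> v x = 0"
  shows "\<exists>h. h holomorphic_on UNIV \<and> (\<forall>y::real. h (complex_of_real y) = hankel_L1 \<alpha> v y) \<and>
     (\<forall>z. norm (h z) \<le> (\<integral>x. norm (v x) \<partial>mu \<alpha>) * bes \<alpha> (- ((pi * A * norm z)\<^sup>2)))"
proof -
  define V where "V = (\<integral>x. norm (v x) \<partial>mu \<alpha>)"
  have [measurable]: "v \<in> borel_measurable (mu \<alpha>)" using v by auto
  note [measurable] = measurable_mu_borel
  let ?m = "\<lambda>k x. v x * complex_of_real (((pi * x)\<^sup>2) ^ k)"
  have mb: "norm (?m k x) \<le> ((pi * A)\<^sup>2) ^ k * norm (v x)" if "x \<ge> 0" for k x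
  proof (cases "x \<le> A")
    case True
    have "((pi * x)\<^sup>2) ^ k \<le> ((pi * A)\<^sup>2) ^ k" using that True by (intro power_mono mult_left_mono) auto
    moreover have "\<bar>((pi * x)\<^sup>2) ^ k\<bar> = ((pi * x)\<^sup>2) ^ k" by (intro abs_of_nonneg zero_le_power zero_le_power2)
    hence "norm (?m k x) = ((pi * x)\<^sup>2) ^ k * norm (v x)" by (simp only: norm_mult norm_of_real mult.commute)
    ultimately show ?thesis by (simp only: mult_right_mono norm_ge_zero)
  qed (simp add: supp)
  have mi: "integrable (mu \<alpha>) (?m k)" for k
  proof (rule Bochner_Integration.integrable_bound[OF integrable_mult_right[OF integrable_norm[OF v], of "((pi * A)\<^sup>2) ^ k"]])
    show "AE x in mu \<alpha>. norm (?m k x) \<le> norm (((pi * A)\<^sup>2) ^ k * norm (v x))"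
      using mb by (intro AE_I2) (auto simp: abs_mult)
  qed measurable
  have mI: "(\<integral>x. norm (?m k x) \<partial>mu \<alpha>) \<le> ((pi * A)\<^sup>2) ^ k * V" for k
  proof -
    have "(\<integral>x. norm (?m k x) \<partial>mu \<alpha>) \<le> (\<integral>x. ((pi * A)\<^sup>2) ^ k * norm (v x) \<partial>mu \<alpha>)"
      using mb v by (intro integral_mono integrable_norm[OF mi]) auto
    thus ?thesis by (simp add: V_def)
  qed
  define c where "c = (\<lambda>k. complex_of_real (bes_coeff \<alpha> k) * (\<integral>x. ?m k x \<partial>mu \<alpha>))"
  have cb: "norm (c k) \<le> V * (\<bar>bes_coeff \<alpha> k\<bar> * ((pi * A)\<^sup>2) ^ k)" for k
  proof -
    have "norm (c k) = \<bar>bes_coeff \<alpha> k\<bar> * norm (\<integral>x. ?m k x \<partial>mu \<alpha>)" by (simp add: c_def norm_mult)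
    also have "\<dots> \<le> \<bar>bes_coeff \<alpha> k\<bar> * (((pi * A)\<^sup>2) ^ k * V)"
      by (intro mult_left_mono order_trans[OF integral_norm_bound mI]) auto
    finally show ?thesis by (simp add: mult_ac)
  qed
  have abs_coeff: "\<bar>bes_coeff \<alpha> k\<bar> * w ^ k = w ^ k / (fact k * pochhammer (\<alpha>+1) k)" for w k
    using pochhammer_pos_half[of "\<alpha>+1" k] a by (simp add: bes_coeff_def abs_mult)
  have bsum: "(\<lambda>k. V * (\<bar>bes_coeff \<alpha> k\<bar> * w ^ k)) sums (V * bes \<alpha> (- w))" for w
    unfolding abs_coeff by (intro sums_mult bes_neg_sums a)
  have tb: "norm (c k * w ^ k) \<le> V * (\<bar>bes_coeff \<alpha> k\<bar> * ((pi * A)\<^sup>2 * norm w) ^ k)" for k w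
  proof -
    have "norm (c k * w ^ k) \<le> V * (\<bar>bes_coeff \<alpha> k\<bar> * ((pi * A)\<^sup>2) ^ k) * norm w ^ k"
      unfolding norm_mult norm_power by (intro mult_right_mono cb) auto
    thus ?thesis by (simp add: power_mult_distrib mult_ac)
  qed
  have sumn: "summable (\<lambda>k. norm (c k * w ^ k))" for w
    by (rule summable_comparison_test'[OF sums_summable[OF bsum], of 0]) (use tb in auto)
  have sumc: "summable (\<lambda>k. c k * w ^ k)" for w by (rule summable_norm_cancel[OF sumn])
  define H where "H = (\<lambda>w. \<Sum>k. c k * w ^ k)"
  have Hd: "(H has_field_derivative (\<Sum>n. diffs c n * w ^ n)) (at w)" for w
    unfolding H_def by (rule termdiffs_strong_converges_everywhere[OF sumc])
  have Hhol: "H holomorphic_on UNIV" using Hd by (auto simp: holomorphic_on_open)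
  define h where "h = (\<lambda>z. H (z\<^sup>2))"
  have hhol: "h holomorphic_on UNIV"
    unfolding h_def by (rule holomorphic_on_compose_gen[OF _ Hhol, of "\<lambda>z. z\<^sup>2" UNIV, unfolded o_def]) (auto intro: holomorphic_intros)
  have hbound: "norm (h z) \<le> V * bes \<alpha> (- ((pi * A * norm z)\<^sup>2))" for z
  proof -
    have "norm (h z) \<le> (\<Sum>k. norm (c k * (z\<^sup>2) ^ k))" unfolding h_def H_def by (rule summable_norm[OF sumn])
    also have "\<dots> \<le> (\<Sum>k. V * (\<bar>bes_coeff \<alpha> k\<bar> * ((pi * A)\<^sup>2 * norm (z\<^sup>2)) ^ k))"
      by (rule suminf_le[OF tb sumn sums_summable[OF bsum]])
    also have "\<dots> = V * bes \<alpha> (- ((pi * A)\<^sup>2 * norm (z\<^sup>2)))" by (rule sums_unique[OF bsum, symmetric])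
    finally show ?thesis by (simp add: norm_power power_mult_distrib)
  qed
  have hreal: "h (complex_of_real y) = hankel_L1 \<alpha> v y" for y
  proof -
    let ?f = "\<lambda>k x. v x * complex_of_real (bes_coeff \<alpha> k * ((pi * x * y)\<^sup>2) ^ k)"
    have fm: "?f k x = complex_of_real (bes_coeff \<alpha> k * (y\<^sup>2) ^ k) * ?m k x" for k x
      by (simp add: power_mult_distrib mult_ac)
    have fi: "integrable (mu \<alpha>) (?f k)" for k unfolding fm by (intro integrable_mult_right mi)
    have fsum: "(\<lambda>k. ?f k x) sums (v x * complex_of_real (bes \<alpha> ((pi * x * y)\<^sup>2)))" for x
      unfolding bes_def by (intro sums_mult sums_of_real summable_sums bes_summable a)
    have fn: "summable (\<lambda>k. norm (?f k x))" for x
      unfolding norm_mult[of "v x"] norm_of_real by (rule summable_mult[OF bes_summable_abs[OF a]])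
    have fI: "(\<integral>x. norm (?f k x) \<partial>mu \<alpha>) \<le> V * (\<bar>bes_coeff \<alpha> k\<bar> * ((pi * A)\<^sup>2 * y\<^sup>2) ^ k)" for k
    proof -
      have "(\<integral>x. norm (?f k x) \<partial>mu \<alpha>) = \<bar>bes_coeff \<alpha> k\<bar> * (y\<^sup>2) ^ k * (\<integral>x. norm (?m k x) \<partial>mu \<alpha>)"
        unfolding fm norm_mult[of "complex_of_real (bes_coeff \<alpha> k * (y\<^sup>2) ^ k)"] integral_mult_right_zero norm_of_real by (simp add: abs_mult)
      also have "\<dots> \<le> \<bar>bes_coeff \<alpha> k\<bar> * (y\<^sup>2) ^ k * (((pi * A)\<^sup>2) ^ k * V)" by (intro mult_left_mono mI) auto
      finally show ?thesis by (simp add: power_mult_distrib mult_ac)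
    qed
    have fs: "summable (\<lambda>k. \<integral>x. norm (?f k x) \<partial>mu \<alpha>)"
      by (rule summable_comparison_test'[OF sums_summable[OF bsum[of "(pi * A)\<^sup>2 * y\<^sup>2"]], of 0]) (use fI in auto)
    have "hankel_L1 \<alpha> v y = (\<integral>x. (\<Sum>k. ?f k x) \<partial>mu \<alpha>)"
      unfolding hankel_L1_def hankel_kernel_eq[OF a] using sums_unique[OF fsum] by simp
    also have "\<dots> = (\<Sum>k. \<integral>x. ?f k x \<partial>mu \<alpha>)" by (rule integral_suminf[OF fi _ fs]) (use fn in auto)
    also have "(\<lambda>k. \<integral>x. ?f k x \<partial>mu \<alpha>) = (\<lambda>k. c k * ((complex_of_real y)\<^sup>2) ^ k)"
      unfolding fm integral_mult_right_zero c_def by (simp add: mult_ac)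
    finally show ?thesis unfolding h_def H_def by simp
  qed
  show ?thesis using hhol hreal hbound unfolding V_def by blast
qed

lemma L1_norm_bound:
  assumes v: "integrable (mu \<alpha>) v" "v \<in> L2 \<alpha>" and supp: "\<And>x. x > A \<Longrightarrow> v x = 0"
  shows "(\<integral>x. norm (v x) \<partial>mu \<alpha>) \<le> measure (mu \<alpha>) {0..A} + (rnorm \<alpha> v)\<^sup>2"
proof -
  have [measurable]: "v \<in> borel_measurable (mu \<alpha>)" using v by auto
  have i: "integrable (mu \<alpha>) (\<lambda>x. (cmod (v x))\<^sup>2)"
    using L2_finite[OF v(2)] unfolding energy_def by (intro integrableI_nonneg) auto
  have A: "{0..A} \<in> sets (mu \<alpha>)" by (intro sets_mu_borel) auto
  have ind: "integrable (mu \<alpha>) (indicator {0..A} :: real \<Rightarrow> real)"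
    using emeasure_mu_bounded[OF a, of A] by (intro integrable_real_indicator A)
  have "(\<integral>x. norm (v x) \<partial>mu \<alpha>) \<le> (\<integral>x. indicator {0..A} x + (cmod (v x))\<^sup>2 \<partial>mu \<alpha>)"
  proof (intro integral_mono Bochner_Integration.integrable_add ind i integrable_norm v)
    fix x assume "x \<in> space (mu \<alpha>)"
    have "z \<le> 1 + z\<^sup>2" for z :: real
      using zero_le_power2[of "z - 1/2"] by (simp add: power2_eq_square algebra_simps)
    thus "norm (v x) \<le> indicator {0..A} x + (cmod (v x))\<^sup>2"
      using supp[of x] \<open>x \<in> space (mu \<alpha>)\<close> by (cases "x \<le> A") auto
  qed
  also have "\<dots> = measure (mu \<alpha>) {0..A} + (\<integral>x. (cmod (v x))\<^sup>2 \<partial>mu \<alpha>)"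
    using ind i A by (simp add: Bochner_Integration.integral_add)
  also have "(\<integral>x. (cmod (v x))\<^sup>2 \<partial>mu \<alpha>) = (rnorm \<alpha> v)\<^sup>2"
    unfolding rnorm_sq energy_def by (subst nn_integral_eq_integral[OF i]) auto
  finally show ?thesis .
qed

lemma energy_split:
  assumes f: "f \<in> L2 \<alpha>" and A [measurable]: "A \<in> sets (mu \<alpha>)" and B [measurable]: "B \<in> sets (mu \<alpha>)" and dis: "A \<inter> B = {}"
  shows "(rnorm \<alpha> (\<lambda>x. indicator A x * f x))\<^sup>2 + (rnorm \<alpha> (\<lambda>x. indicator B x * f x))\<^sup>2 = (rnorm \<alpha> (\<lambda>x. indicator (A \<union> B) x * f x))\<^sup>2"
proof -
  have [measurable]: "f \<in> borel_measurable (mu \<alpha>)" using f by (rule L2_measurable)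
  have "energy \<alpha> (\<lambda>x. indicator (A \<union> B) x * f x) = (\<integral>\<^sup>+x. ennreal ((cmod (indicator A x * f x))\<^sup>2) + ennreal ((cmod (indicator B x * f x))\<^sup>2) \<partial>mu \<alpha>)"
    unfolding energy_def using dis by (intro nn_integral_cong) (auto split: split_indicator)
  also have "\<dots> = energy \<alpha> (\<lambda>x. indicator A x * f x) + energy \<alpha> (\<lambda>x. indicator B x * f x)"
    unfolding energy_def by (rule nn_integral_add) measurable
  finally show ?thesis
    unfolding rnorm_sq using L2_finite[OF L2_indicator[OF f A]] L2_finite[OF L2_indicator[OF f B]] by (simp add: enn2real_plus)
qed

text \<open>A compactness argument. If no such \<open>c\<close> existed, there would be unit vectors supported in \<open>[0,A]\<close> whose transforms have almost
  all their mass on \<open>[0,B]\<close>. The entire extensions form a normal family, so a subsequence converges locally uniformly. Its limit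
  vanishes almost everywhere on \<open>(B, B+1]\<close>, hence identically by the identity theorem, which contradicts the mass on \<open>[0,B]\<close>.\<close>

lemma strict_contraction_bounded:
  assumes A: "A > 0" and B: "B > 0"
  shows "\<exists>c<1. 0 \<le> c \<and> (\<forall>u. integrable (mu \<alpha>) u \<longrightarrow> u \<in> L2 \<alpha> \<longrightarrow> (\<forall>x. x > A \<longrightarrow> u x = 0) \<longrightarrow>
     (rnorm \<alpha> (\<lambda>y. indicator {0..B} y * hankel_L1 \<alpha> u y))\<^sup>2 \<le> c * (rnorm \<alpha> u)\<^sup>2)"
proof (rule ccontr)
  assume neg: "\<not> ?thesis"
  let ?low = "\<lambda>f. (rnorm \<alpha> (\<lambda>y. indicator {0..B} y * f y))\<^sup>2"
  have ex: "\<exists>v. integrable (mu \<alpha>) v \<and> v \<in> L2 \<alpha> \<and> (\<forall>x. x > A \<longrightarrow> v x = 0) \<and> rnorm \<alpha> v = 1 \<and> ?low (hankel_L1 \<alpha> v) \<ge> 1 - 1 / real (Suc n)" for n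
  proof -
    have "1 - 1 / real (Suc n) < 1" "0 \<le> 1 - 1 / real (Suc n)" by auto
    then obtain u where u: "integrable (mu \<alpha>) u" "u \<in> L2 \<alpha>" "\<And>x. x > A \<Longrightarrow> u x = 0"
       and gt: "?low (hankel_L1 \<alpha> u) > (1 - 1 / real (Suc n)) * (rnorm \<alpha> u)\<^sup>2"
      using neg by (meson not_le)
    have r: "rnorm \<alpha> u > 0"
    proof (rule ccontr)
      assume "\<not> rnorm \<alpha> u > 0"
      hence z: "rnorm \<alpha> u = 0" using rnorm_nonneg[of \<alpha> u] by linarith
      have HL2: "hankel_L1 \<alpha> u \<in> L2 \<alpha>" by (rule hankel_L1_L2[OF a u(1,2)])
      have "energy \<alpha> (\<lambda>y. indicator {0..B} y * hankel_L1 \<alpha> u y) \<le> energy \<alpha> (hankel_L1 \<alpha> u)"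
        by (intro energy_mono) (auto split: split_indicator)
      hence "?low (hankel_L1 \<alpha> u) \<le> (rnorm \<alpha> (hankel_L1 \<alpha> u))\<^sup>2"
        unfolding rnorm_sq using L2_finite[OF HL2] by (intro enn2real_mono) auto
      also have "\<dots> = 0" using plancherel_L1_L2[OF a u(1,2)] z by simp
      finally show False using gt z by simp
    qed
    let ?s = "complex_of_real (1 / rnorm \<alpha> u)"
    let ?v = "\<lambda>x. ?s * u x"
    have v2: "?v \<in> L2 \<alpha>" by (rule L2_cmult[OF u(2)])
    have rv: "rnorm \<alpha> ?v = 1" using r unfolding rnorm_cmult[OF a u(2)] norm_of_real by simp
    have e: "(\<lambda>y. indicator {0..B} y * hankel_L1 \<alpha> ?v y) = (\<lambda>y. ?s * (indicator {0..B} y * hankel_L1 \<alpha> u y))"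
      unfolding hankel_L1_cmult[OF a] by (simp add: mult_ac)
    have cs: "cmod ?s = 1 / rnorm \<alpha> u" unfolding norm_of_real using r by simp
    have "rnorm \<alpha> (\<lambda>y. indicator {0..B} y * hankel_L1 \<alpha> ?v y) = cmod ?s * rnorm \<alpha> (\<lambda>y. indicator {0..B} y * hankel_L1 \<alpha> u y)"
      unfolding e by (intro rnorm_cmult[OF a] L2_indicator hankel_L1_L2[OF a u(1,2)] sets_mu_borel) auto
    hence "?low (hankel_L1 \<alpha> ?v) = (1 / rnorm \<alpha> u)\<^sup>2 * ?low (hankel_L1 \<alpha> u)"
      by (simp only: cs power_mult_distrib)
    also have "\<dots> \<ge> (1 / rnorm \<alpha> u)\<^sup>2 * ((1 - 1 / real (Suc n)) * (rnorm \<alpha> u)\<^sup>2)"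
      using gt by (intro mult_left_mono) auto
    also have "(1 / rnorm \<alpha> u)\<^sup>2 * ((1 - 1 / real (Suc n)) * (rnorm \<alpha> u)\<^sup>2) = 1 - 1 / real (Suc n)"
      using r by (simp add: power_divide)
    finally have "?low (hankel_L1 \<alpha> ?v) \<ge> 1 - 1 / real (Suc n)" .
    thus ?thesis using u v2 rv by (intro exI[of _ ?v]) auto
  qed
  then obtain v where v: "\<And>n::nat. integrable (mu \<alpha>) (v n)" "\<And>n. v n \<in> L2 \<alpha>" "\<And>n x. x > A \<Longrightarrow> v n x = 0" "\<And>n. rnorm \<alpha> (v n) = 1"
    and big: "\<And>n. ?low (hankel_L1 \<alpha> (v n)) \<ge> 1 - 1 / real (Suc n)" by metis
  define V where "V = measure (mu \<alpha>) {0..A} + 1"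
  have V: "V \<ge> 0" by (simp add: V_def)
  let ?bd = "\<lambda>z. V * bes \<alpha> (- ((pi * A * norm z)\<^sup>2))"
  have "\<exists>h. h holomorphic_on UNIV \<and> (\<forall>y::real. h (complex_of_real y) = hankel_L1 \<alpha> (v n) y) \<and> (\<forall>z. norm (h z) \<le> ?bd z)" for n
  proof -
    obtain h where h: "h holomorphic_on UNIV" "\<And>y::real. h (complex_of_real y) = hankel_L1 \<alpha> (v n) y"
      and hb: "\<And>z. norm (h z) \<le> (\<integral>x. norm (v n x) \<partial>mu \<alpha>) * bes \<alpha> (- ((pi * A * norm z)\<^sup>2))"
      using hankel_L1_entire_extension[OF v(1) A v(3)] by blast
    have "(\<integral>x. norm (v n x) \<partial>mu \<alpha>) \<le> V" using L1_norm_bound[OF v(1,2,3)] v(4) by (simp add: V_def)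
    hence "norm (h z) \<le> ?bd z" for z
      using bes_neg_ge_1[OF a, of "(pi * A * norm z)\<^sup>2"] by (intro order_trans[OF hb] mult_right_mono) auto
    thus ?thesis using h by blast
  qed
  then obtain h where h: "\<And>n. h n holomorphic_on UNIV" "\<And>n (y::real). h n (complex_of_real y) = hankel_L1 \<alpha> (v n) y" "\<And>n z. norm (h n z) \<le> ?bd z" by metis
  have mono: "?bd z \<le> V * bes \<alpha> (- ((pi * A * R)\<^sup>2))" if "norm z \<le> R" for z :: complex and R
    using that A V by (intro mult_left_mono bes_neg_mono a power_mono mult_left_mono) auto
  obtain g r where g: "g holomorphic_on UNIV" and r: "strict_mono (r :: nat \<Rightarrow> nat)" and lim: "\<And>z. (\<lambda>n. h (r n) z) \<longlonglongrightarrow> g z"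
  proof (rule Montel[of UNIV "range h" h])
    fix K :: "complex set" assume "compact K"
    hence "bounded K" by (rule compact_imp_bounded)
    then obtain R where R: "\<And>z. z \<in> K \<Longrightarrow> norm z \<le> R" unfolding bounded_iff by blast
    have "norm (h n z) \<le> V * bes \<alpha> (- ((pi * A * R)\<^sup>2))" if "z \<in> K" for n z
      using order_trans[OF h(3) mono[OF R[OF that]]] .
    thus "\<exists>B. \<forall>f\<in>range h. \<forall>z\<in>K. norm (f z) \<le> B" by blast
  qed (use h in auto)
  define G where "G = (\<lambda>y::real. g (complex_of_real y))"
  have Glim: "(\<lambda>n. hankel_L1 \<alpha> (v (r n)) y) \<longlonglongrightarrow> G y" for y
    using lim[of "complex_of_real y"] unfolding h(2) G_def .
  have Gm [measurable]: "G \<in> borel_measurable (mu \<alpha>)"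
    by (rule borel_measurable_LIMSEQ_metric[OF _ Glim]) (intro hankel_L1_measurable[OF a] L2_measurable v(2))
  have Lm: "hankel_L1 \<alpha> (v n) \<in> L2 \<alpha>" for n by (rule hankel_L1_L2[OF a v(1,2)])
  have [measurable]: "hankel_L1 \<alpha> (v n) \<in> borel_measurable (mu \<alpha>)" for n using Lm by (rule L2_measurable)
  have Bs: "{0..B} \<in> sets (mu \<alpha>)" and Cs [measurable]: "{B<..B+1} \<in> sets (mu \<alpha>)"
    using B by (auto intro!: sets_mu_borel)
  let ?J = "{B<..B+1}"
  have small: "(rnorm \<alpha> (\<lambda>y. indicator ?J y * hankel_L1 \<alpha> (v n) y))\<^sup>2 \<le> 1 / real (Suc n)" for n
  proof -
    have "?low (hankel_L1 \<alpha> (v n)) + (rnorm \<alpha> (\<lambda>y. indicator ?J y * hankel_L1 \<alpha> (v n) y))\<^sup>2 = (rnorm \<alpha> (\<lambda>x. indicator ({0..B} \<union> ?J) x * hankel_L1 \<alpha> (v n) x))\<^sup>2"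
      by (rule energy_split[OF Lm Bs Cs]) auto
    also have "\<dots> \<le> (rnorm \<alpha> (hankel_L1 \<alpha> (v n)))\<^sup>2"
      unfolding rnorm_sq using L2_finite[OF Lm] by (intro enn2real_mono energy_mono) (auto split: split_indicator)
    also have "\<dots> = 1" using plancherel_L1_L2[OF a v(1,2)] v(4) by simp
    finally show ?thesis using big[of n] by simp
  qed
  have rnorm_lim: "(\<lambda>n. rnorm \<alpha> (\<lambda>y. indicator D y * hankel_L1 \<alpha> (v (r n)) y)) \<longlonglongrightarrow> rnorm \<alpha> (\<lambda>y. indicator D y * G y)"
    if D: "D \<in> sets borel" "D \<subseteq> {0..R}" for D R
  proof -
    have Ds [measurable]: "D \<in> sets (mu \<alpha>)" using D by (intro sets_mu_borel) auto
    define W where "W = V * bes \<alpha> (- ((pi * A * R)\<^sup>2))"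
    have hb: "cmod (hankel_L1 \<alpha> (v n) y) \<le> W" if "0 \<le> y" "y \<le> R" for n y
      using order_trans[OF h(3) mono, of "complex_of_real y" R n] that unfolding h(2) W_def by simp
    have Gb: "cmod (G y) \<le> W" if "0 \<le> y" "y \<le> R" for y
      by (rule LIMSEQ_le_const2[OF tendsto_norm[OF Glim]]) (use hb[OF that] in auto)
    have L: "(\<lambda>y. indicator D y * F y) \<in> L2 \<alpha>" if [measurable]: "F \<in> borel_measurable (mu \<alpha>)" and "\<And>y. 0 \<le> y \<Longrightarrow> y \<le> R \<Longrightarrow> cmod (F y) \<le> W" for F
    proof (rule bounded_support_L2[OF a, of _ "\<bar>W\<bar>" R])
      show "(\<lambda>y. indicator D y * F y) \<in> borel_measurable (mu \<alpha>)" by measurable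
      show "cmod (indicator D x * F x) \<le> \<bar>W\<bar>" if "x \<ge> 0" for x
        using \<open>\<And>y. 0 \<le> y \<Longrightarrow> y \<le> R \<Longrightarrow> cmod (F y) \<le> W\<close>[of x] that D by (cases "x \<in> D") auto
    qed (use D in \<open>auto split: split_indicator\<close>)
    have W1: "(\<lambda>y. indicator D y * complex_of_real W) \<in> L2 \<alpha>"
      by (rule bounded_support_L2[OF a, of _ "\<bar>W\<bar>" R]) (use D in \<open>auto split: split_indicator\<close>)
    show ?thesis
    proof (rule rnorm_tendsto[OF L L])
      show "(\<lambda>n. rnorm \<alpha> (\<lambda>x. indicator D x * hankel_L1 \<alpha> (v (r n)) x - indicator D x * G x)) \<longlonglongrightarrow> 0"
      proof (rule energy_dominated_tendsto[OF L L, where w = "\<lambda>x. indicator D x * W"])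
        show "(\<lambda>x. complex_of_real (indicator D x * W)) \<in> L2 \<alpha>"
          using W1 by (rule back_subst[of "\<lambda>f. f \<in> L2 \<alpha>"]) (auto split: split_indicator)
        show "AE x in mu \<alpha>. (\<lambda>n. indicator D x * hankel_L1 \<alpha> (v (r n)) x) \<longlonglongrightarrow> indicator D x * G x"
          by (intro AE_I2 tendsto_intros Glim)
      qed (use D hb Gb in \<open>auto split: split_indicator\<close>)
    qed (use hb Gb in auto)
  qed
  have inv0: "(\<lambda>n. 1 / real (Suc (r n))) \<longlonglongrightarrow> 0"
    using LIMSEQ_subseq_LIMSEQ[OF LIMSEQ_Suc[OF lim_1_over_n] r] by (simp add: o_def)
  have "(\<lambda>n. (rnorm \<alpha> (\<lambda>y. indicator ?J y * hankel_L1 \<alpha> (v (r n)) y))\<^sup>2) \<longlonglongrightarrow> (rnorm \<alpha> (\<lambda>y. indicator ?J y * G y))\<^sup>2"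
    using B by (intro tendsto_power rnorm_lim[of _ "B+1"]) auto
  moreover have "(\<lambda>n. (rnorm \<alpha> (\<lambda>y. indicator ?J y * hankel_L1 \<alpha> (v (r n)) y))\<^sup>2) \<longlonglongrightarrow> 0"
    by (rule tendsto_sandwich[OF _ _ tendsto_const inv0]) (use small in auto)
  ultimately have J0: "rnorm \<alpha> (\<lambda>y. indicator ?J y * G y) = 0" using LIMSEQ_unique by fastforce
  have G0: "G y = 0" for y
  proof -
    have JL: "energy \<alpha> (\<lambda>y. indicator ?J y * G y) < \<infinity>"
    proof -
      obtain C where C: "\<And>y. y \<in> {B..B+1} \<Longrightarrow> cmod (G y) \<le> C"
      proof -
        have "continuous_on {B..B+1} G" unfolding G_def
          by (intro continuous_on_compose2[OF holomorphic_on_imp_continuous_on[OF g]] continuous_intros) auto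
        hence "bounded (G ` {B..B+1})" by (intro compact_imp_bounded compact_continuous_image) auto
        thus ?thesis using that unfolding bounded_iff by blast
      qed
      have "(\<lambda>y. indicator ?J y * G y) \<in> L2 \<alpha>"
      proof (rule bounded_support_L2[OF a, of _ "\<bar>C\<bar>" "B+1"])
        show "cmod (indicator ?J x * G x) \<le> \<bar>C\<bar>" for x using C[of x] by (auto split: split_indicator)
        show "(\<lambda>y. indicator ?J y * G y) \<in> borel_measurable (mu \<alpha>)"
          by (intro borel_measurable_times borel_measurable_indicator Cs Gm)
      qed auto
      thus ?thesis by (rule L2_finite)
    qed
    hence "energy \<alpha> (\<lambda>y. indicator ?J y * G y) = 0" using J0 energy_eq_rn[OF JL] by simp
    hence AE0: "AE y in mu \<alpha>. indicator ?J y * G y = 0"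
      unfolding energy_def by (subst (asm) nn_integral_0_iff_AE) auto
    define Z where "Z = {y \<in> ?J. G y = 0}"
    have "infinite Z"
    proof
      assume fin: "finite Z"
      have "AE y in mu \<alpha>. y \<notin> Z"
        using AE_mu_of_negligible[OF a negligible_finite[OF fin]] .
      hence AEJ: "AE y in mu \<alpha>. y \<notin> ?J" using AE0 by eventually_elim (auto simp: Z_def split: split_indicator_asm)
      have "{y \<in> space (mu \<alpha>). \<not> y \<notin> ?J} = ?J" using B by auto
      from iffD1[OF AE_iff_measurable[OF Cs this] AEJ] have "emeasure (mu \<alpha>) ?J = 0" .
      hence "(\<integral>\<^sup>+x. ennreal (mu_const \<alpha> * x powr (2 * \<alpha> + 1)) * indicator ?J x \<partial>lborel) = 0" unfolding emeasure_mu[OF Cs] .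
      hence "AE x in lborel. ennreal (mu_const \<alpha> * x powr (2 * \<alpha> + 1)) * indicator ?J x = 0"
        by (subst (asm) nn_integral_0_iff_AE) auto
      hence AEL: "AE x in lborel. x \<notin> ?J"
        by eventually_elim (use B mu_const_pos[OF a] in \<open>auto split: split_indicator_asm simp: ennreal_eq_0_iff mult_le_0_iff\<close>)
      have "{y \<in> space lborel. \<not> y \<notin> ?J} = ?J" by auto
      from iffD1[OF AE_iff_measurable[OF _ this] AEL] have "emeasure lborel ?J = 0" by simp
      thus False by simp
    qed
    hence "infinite (complex_of_real ` Z)" by (simp add: finite_image_iff inj_on_def)
    moreover have "complex_of_real ` Z \<subseteq> complex_of_real ` {B..B+1}" by (auto simp: Z_def)
    moreover have "compact (complex_of_real ` {B..B+1})" by (intro compact_continuous_image continuous_intros) auto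
    ultimately obtain \<xi> where \<xi>: "\<xi> islimpt (complex_of_real ` Z)" unfolding compact_eq_Bolzano_Weierstrass by blast
    have "g (complex_of_real y) = 0"
      by (rule analytic_continuation[OF g open_UNIV connected_UNIV subset_UNIV UNIV_I \<xi> _ UNIV_I]) (auto simp: Z_def G_def)
    thus ?thesis by (simp add: G_def)
  qed
  have "(\<lambda>n. ?low (hankel_L1 \<alpha> (v (r n)))) \<longlonglongrightarrow> (rnorm \<alpha> (\<lambda>y. indicator {0..B} y * G y))\<^sup>2"
    by (intro tendsto_power rnorm_lim[of _ B]) auto
  moreover have "(rnorm \<alpha> (\<lambda>y. indicator {0..B} y * G y))\<^sup>2 = 0" by (simp add: G0 rnorm_def energy_def)
  ultimately have lim0: "(\<lambda>n. ?low (hankel_L1 \<alpha> (v (r n)))) \<longlonglongrightarrow> 0" by (simp only:)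
  have lim1: "(\<lambda>n. 1 - 1 / real (Suc (r n))) \<longlonglongrightarrow> 1 - 0" by (intro tendsto_intros inv0)
  have "1 - 0 \<le> (0::real)" by (rule LIMSEQ_le[OF lim1 lim0]) (use big in blast)
  thus False by simp
qed

end

section \<open>Localization and its two consequences\<close>

context
  fixes \<alpha> :: real assumes a: "\<alpha> > -1/2"
begin

lemma rnorm_mono:
  assumes "g \<in> L2 \<alpha>" "\<And>x. x \<ge> 0 \<Longrightarrow> cmod (f x) \<le> cmod (g x)"
  shows "rnorm \<alpha> f \<le> rnorm \<alpha> g"
  unfolding rnorm_def using L2_finite[OF assms(1)] assms(2)
  by (intro real_sqrt_le_mono enn2real_mono energy_mono) auto

text \<open>Between the two intervals the strict contraction applies. The small form handles the thin part of \<open>u\<close> seen on \<open>[0,B]\<close>, and the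
  whole of \<open>u\<close> seen on the thin part of \<open>\<Sigma>\<close>.\<close>

lemma localization_L1_L2:
  assumes ab: "A > 0" "B > 0"
  shows "\<exists>\<epsilon>\<^sub>0>0. \<exists>c. 0 \<le> c \<and> c < 1 \<and> (\<forall>\<epsilon> S\<^sub>i \<Sigma>\<^sub>i u. \<epsilon> < \<epsilon>\<^sub>0 \<longrightarrow> thin \<epsilon> \<alpha> S\<^sub>i \<longrightarrow> thin \<epsilon> \<alpha> \<Sigma>\<^sub>i \<longrightarrow> 
     integrable (mu \<alpha>) u \<longrightarrow> u \<in> L2 \<alpha> \<longrightarrow> (\<forall>x. x \<notin> {0..A} \<union> S\<^sub>i \<longrightarrow> u x = 0) \<longrightarrow>
     rnorm \<alpha> (\<lambda>y. indicator ({0..B} \<union> \<Sigma>\<^sub>i) y * hankel_L1 \<alpha> u y) \<le> c * rnorm \<alpha> u)"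
proof -
  obtain c0 where c0: "0 \<le> c0" "c0 < 1"
    and strict: "\<And>u. integrable (mu \<alpha>) u \<Longrightarrow> u \<in> L2 \<alpha> \<Longrightarrow> (\<And>x. x > A \<Longrightarrow> u x = 0) \<Longrightarrow>
       (rnorm \<alpha> (\<lambda>y. indicator {0..B} y * hankel_L1 \<alpha> u y))\<^sup>2 \<le> c0 * (rnorm \<alpha> u)\<^sup>2"
    using strict_contraction_bounded[OF a ab] by blast
  define s where "s = sqrt c0"
  have s: "0 \<le> s" "s < 1" "s\<^sup>2 = c0" using c0 by (auto simp: s_def)
  \<comment> \<open>Three small pieces of size t leave room below one: s + 3 t < 1.\<close>
  define t where "t = (1 - s) / 4"
  have t: "0 < t" "t \<le> 1/4" using s by (auto simp: t_def)
  define d where "d = t\<^sup>2 / 3"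
  have "t\<^sup>2 \<le> 1" using t by (simp add: power_le_one)
  hence d: "d > 0" "0 < 3 * d" "3 * d \<le> 1" "3 * d = t\<^sup>2" using t by (auto simp: d_def)
  obtain e1 where e1: "e1 > 0" and form1: "\<And>\<epsilon> S\<^sub>1 S\<^sub>2 u g. \<epsilon> < e1 \<Longrightarrow> thin \<epsilon> \<alpha> S\<^sub>1 \<Longrightarrow> thin \<epsilon> \<alpha> S\<^sub>2 \<Longrightarrow>
     integrable (mu \<alpha>) u \<Longrightarrow> integrable (mu \<alpha>) g \<Longrightarrow> (\<forall>x. x \<notin> S\<^sub>1 \<longrightarrow> u x = 0) \<Longrightarrow> (\<forall>x. x \<notin> {0..A} \<union> S\<^sub>2 \<longrightarrow> g x = 0) \<Longrightarrow>
     2 * ennreal (norm (\<integral>x. u x * hankel_L1 \<alpha> g x \<partial>mu \<alpha>)) \<le> ennreal (3 * d) * (energy \<alpha> u + energy \<alpha> g)"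
    using small_form[OF a d(1), of A] by blast
  obtain e2 where e2: "e2 > 0" and form2: "\<And>\<epsilon> S\<^sub>1 S\<^sub>2 u g. \<epsilon> < e2 \<Longrightarrow> thin \<epsilon> \<alpha> S\<^sub>1 \<Longrightarrow> thin \<epsilon> \<alpha> S\<^sub>2 \<Longrightarrow>
     integrable (mu \<alpha>) u \<Longrightarrow> integrable (mu \<alpha>) g \<Longrightarrow> (\<forall>x. x \<notin> S\<^sub>1 \<longrightarrow> u x = 0) \<Longrightarrow> (\<forall>x. x \<notin> {0..B} \<union> S\<^sub>2 \<longrightarrow> g x = 0) \<Longrightarrow>
     2 * ennreal (norm (\<integral>x. u x * hankel_L1 \<alpha> g x \<partial>mu \<alpha>)) \<le> ennreal (3 * d) * (energy \<alpha> u + energy \<alpha> g)"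
    using small_form[OF a d(1), of B] by blast
  have root: "x \<le> k * y" if "x\<^sup>2 \<le> k\<^sup>2 * y\<^sup>2" "0 \<le> k" "0 \<le> y" for x y k :: real
  proof -
    have "x\<^sup>2 \<le> (k * y)\<^sup>2" using that by (simp add: power_mult_distrib)
    thus ?thesis by (rule power2_le_imp_le) (use that in auto)
  qed
  show ?thesis
  proof (rule exI[of _ "min e1 e2"], intro exI[of _ "s + 3 * t"] conjI allI impI)
    show "0 < min e1 e2" using e1 e2 by simp
    show "0 \<le> s + 3 * t" using s t by simp
    show "s + 3 * t < 1" using s(2) unfolding t_def by (simp add: field_simps)
    fix \<epsilon> Si \<Sigma>i and u :: "real \<Rightarrow> complex"
    assume e: "\<epsilon> < min e1 e2" and thS: "thin \<epsilon> \<alpha> Si" and thG: "thin \<epsilon> \<alpha> \<Sigma>i"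
      and u1: "integrable (mu \<alpha>) u" and u2: "u \<in> L2 \<alpha>" and supp: "\<forall>x. x \<notin> {0..A} \<union> Si \<longrightarrow> u x = 0"
    have um [measurable]: "u \<in> borel_measurable (mu \<alpha>)" using u2 by (rule L2_measurable)
    have Ssets [measurable]: "Si \<in> sets (mu \<alpha>)" "\<Sigma>i \<in> sets (mu \<alpha>)" using thS thG by (auto simp: thin_def)
    have Bs [measurable]: "{0..B} \<in> sets (mu \<alpha>)" and As [measurable]: "{0..A} \<in> sets (mu \<alpha>)" by (auto intro!: sets_mu_borel)
    define u0 where "u0 = (\<lambda>x. indicator {0..A} x * u x)"
    define ui where "ui = (\<lambda>x. indicator (Si - {0..A}) x * u x)"
    have part: "(\<lambda>x. indicator D x * u x) \<in> L2 \<alpha>" "integrable (mu \<alpha>) (\<lambda>x. indicator D x * u x)"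
      "rnorm \<alpha> (\<lambda>x. indicator D x * u x) \<le> rnorm \<alpha> u" if D [measurable]: "D \<in> sets (mu \<alpha>)" for D
    proof -
      show "(\<lambda>x. indicator D x * u x) \<in> L2 \<alpha>" by (rule L2_indicator[OF u2 D])
      have "(\<lambda>x. indicator D x :: complex) \<in> borel_measurable (mu \<alpha>)" by measurable
      from integrable_bounded_times[OF u1 this, of 1] show "integrable (mu \<alpha>) (\<lambda>x. indicator D x * u x)"
        by (simp add: mult.commute indicator_def)
      show "rnorm \<alpha> (\<lambda>x. indicator D x * u x) \<le> rnorm \<alpha> u" by (rule rnorm_mono[OF u2]) (auto split: split_indicator)
    qed
    have u0: "u0 \<in> L2 \<alpha>" "integrable (mu \<alpha>) u0" "rnorm \<alpha> u0 \<le> rnorm \<alpha> u" unfolding u0_def using part[OF As] .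
    have ui: "ui \<in> L2 \<alpha>" "integrable (mu \<alpha>) ui" "rnorm \<alpha> ui \<le> rnorm \<alpha> u" unfolding ui_def using part[of "Si - {0..A}"] by auto
    have usplit: "u x = u0 x + ui x" for x using supp by (auto simp: u0_def ui_def split: split_indicator)
    have HLsplit: "hankel_L1 \<alpha> u y = hankel_L1 \<alpha> u0 y + hankel_L1 \<alpha> ui y" for y
      using hankel_L1_add[OF a u0(2) ui(2), of y] usplit[abs_def] by simp
    have b0: "rnorm \<alpha> (\<lambda>y. indicator {0..B} y * hankel_L1 \<alpha> u0 y) \<le> s * rnorm \<alpha> u0"
    proof (rule root)
      show "(rnorm \<alpha> (\<lambda>y. indicator {0..B} y * hankel_L1 \<alpha> u0 y))\<^sup>2 \<le> s\<^sup>2 * (rnorm \<alpha> u0)\<^sup>2"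
        unfolding s(3) by (rule strict[OF u0(2,1)]) (simp add: u0_def)
    qed (use s in auto)
    have b1: "rnorm \<alpha> (\<lambda>y. indicator {0..B} y * hankel_L1 \<alpha> ui y) \<le> t * rnorm \<alpha> ui"
    proof (rule root)
      have "(rnorm \<alpha> (\<lambda>y. indicator {0..B} y * hankel_L1 \<alpha> ui y))\<^sup>2 \<le> (3 * d) * (rnorm \<alpha> ui)\<^sup>2"
      proof (rule energy_from_form[OF a ui(2,1) Bs d(2,3)])
        fix h :: "real \<Rightarrow> complex" assume h: "integrable (mu \<alpha>) h" "\<forall>x. x \<notin> {0..B} \<longrightarrow> h x = 0"
        have "2 * ennreal (norm (\<integral>x. ui x * hankel_L1 \<alpha> h x \<partial>mu \<alpha>)) \<le> ennreal (3 * d) * (energy \<alpha> ui + energy \<alpha> h)"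
          using e h by (intro form2[OF _ thS thG ui(2) h(1)]) (auto simp: ui_def)
        thus "2 * ennreal (norm (\<integral>x. hankel_L1 \<alpha> ui x * h x \<partial>mu \<alpha>)) \<le> ennreal (3 * d) * (energy \<alpha> ui + energy \<alpha> h)"
          by (simp only: hankel_L1_mult_formula[OF a ui(2) h(1)])
      qed
      thus "(rnorm \<alpha> (\<lambda>y. indicator {0..B} y * hankel_L1 \<alpha> ui y))\<^sup>2 \<le> t\<^sup>2 * (rnorm \<alpha> ui)\<^sup>2" by (simp only: d(4))
    qed (use t in auto)
    have b2: "rnorm \<alpha> (\<lambda>y. indicator \<Sigma>i y * hankel_L1 \<alpha> u y) \<le> t * rnorm \<alpha> u"
    proof (rule root)
      have "(rnorm \<alpha> (\<lambda>y. indicator \<Sigma>i y * hankel_L1 \<alpha> u y))\<^sup>2 \<le> (3 * d) * (rnorm \<alpha> u)\<^sup>2"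
      proof (rule energy_from_form[OF a u1 u2 Ssets(2) d(2,3)])
        fix h :: "real \<Rightarrow> complex" assume h: "integrable (mu \<alpha>) h" "\<forall>x. x \<notin> \<Sigma>i \<longrightarrow> h x = 0"
        have "2 * ennreal (norm (\<integral>x. h x * hankel_L1 \<alpha> u x \<partial>mu \<alpha>)) \<le> ennreal (3 * d) * (energy \<alpha> h + energy \<alpha> u)"
          using e supp h by (intro form1[OF _ thG thS h(1) u1]) auto
        thus "2 * ennreal (norm (\<integral>x. hankel_L1 \<alpha> u x * h x \<partial>mu \<alpha>)) \<le> ennreal (3 * d) * (energy \<alpha> u + energy \<alpha> h)"
          by (simp only: mult.commute[of "hankel_L1 \<alpha> u _"] add.commute)
      qed
      thus "(rnorm \<alpha> (\<lambda>y. indicator \<Sigma>i y * hankel_L1 \<alpha> u y))\<^sup>2 \<le> t\<^sup>2 * (rnorm \<alpha> u)\<^sup>2" by (simp only: d(4))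
    qed (use t in auto)
    have HuL: "hankel_L1 \<alpha> u \<in> L2 \<alpha>" "hankel_L1 \<alpha> u0 \<in> L2 \<alpha>" "hankel_L1 \<alpha> ui \<in> L2 \<alpha>" using hankel_L1_L2[OF a] u1 u2 u0 ui by auto
    have "rnorm \<alpha> (\<lambda>y. indicator ({0..B} \<union> \<Sigma>i) y * hankel_L1 \<alpha> u y) = rnorm \<alpha> (\<lambda>y. (indicator {0..B} y * hankel_L1 \<alpha> u0 y + indicator {0..B} y * hankel_L1 \<alpha> ui y) + indicator (\<Sigma>i - {0..B}) y * hankel_L1 \<alpha> u y)"
      by (rule arg_cong[where f = "rnorm \<alpha>"]) (auto simp: fun_eq_iff HLsplit split: split_indicator)
    also have "\<dots> \<le> rnorm \<alpha> (\<lambda>y. indicator {0..B} y * hankel_L1 \<alpha> u0 y + indicator {0..B} y * hankel_L1 \<alpha> ui y) + rnorm \<alpha> (\<lambda>y. indicator (\<Sigma>i - {0..B}) y * hankel_L1 \<alpha> u y)"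
      by (intro rnorm_triangle L2_add L2_indicator HuL) measurable
    also have "\<dots> \<le> (rnorm \<alpha> (\<lambda>y. indicator {0..B} y * hankel_L1 \<alpha> u0 y) + rnorm \<alpha> (\<lambda>y. indicator {0..B} y * hankel_L1 \<alpha> ui y)) + rnorm \<alpha> (\<lambda>y. indicator \<Sigma>i y * hankel_L1 \<alpha> u y)"
      by (intro add_mono rnorm_triangle L2_indicator HuL Bs rnorm_mono[OF L2_indicator[OF HuL(1) Ssets(2)]]) (auto split: split_indicator)
    also have "\<dots> \<le> (s * rnorm \<alpha> u + t * rnorm \<alpha> u) + t * rnorm \<alpha> u"
    proof (intro add_mono)
      show "rnorm \<alpha> (\<lambda>y. indicator {0..B} y * hankel_L1 \<alpha> u0 y) \<le> s * rnorm \<alpha> u" using b0 mult_left_mono[OF u0(3) s(1)] by linarith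
      show "rnorm \<alpha> (\<lambda>y. indicator {0..B} y * hankel_L1 \<alpha> ui y) \<le> t * rnorm \<alpha> u" using b1 mult_left_mono[OF ui(3), of t] t by linarith
      show "rnorm \<alpha> (\<lambda>y. indicator \<Sigma>i y * hankel_L1 \<alpha> u y) \<le> t * rnorm \<alpha> u" by (rule b2)
    qed
    also have "\<dots> \<le> (s + 3 * t) * rnorm \<alpha> u"
      using mult_nonneg_nonneg[of t "rnorm \<alpha> u"] t by (simp add: algebra_simps)
    finally show "rnorm \<alpha> (\<lambda>y. indicator ({0..B} \<union> \<Sigma>i) y * hankel_L1 \<alpha> u y) \<le> (s + 3 * t) * rnorm \<alpha> u" .
  qed
qed

lemma localization_L2:
  assumes S [measurable]: "S \<in> sets (mu \<alpha>)" and G [measurable]: "\<Sigma> \<in> sets (mu \<alpha>)" and c: "c \<ge> 0"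
    and loc: "\<And>u. integrable (mu \<alpha>) u \<Longrightarrow> u \<in> L2 \<alpha> \<Longrightarrow> (\<And>x. x \<notin> S \<Longrightarrow> u x = 0) \<Longrightarrow> rnorm \<alpha> (\<lambda>y. indicator \<Sigma> y * hankel_L1 \<alpha> u y) \<le> c * rnorm \<alpha> u"
    and f: "f \<in> L2 \<alpha>" and supp: "\<And>x. x \<notin> S \<Longrightarrow> f x = 0"
  shows "rnorm \<alpha> (\<lambda>y. indicator \<Sigma> y * hankel \<alpha> f y) \<le> c * rnorm \<alpha> f"
proof -
  define F where "F = (\<lambda>(n::nat) x. indicator {..real n} x * f x)"
  have F: "F n \<in> L2 \<alpha>" "integrable (mu \<alpha>) (F n)" "(\<lambda>n. rnorm \<alpha> (\<lambda>x. F n x - f x)) \<longlonglongrightarrow> 0" for n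
    using truncation[OF a f] by (simp_all only: F_def)
  have HFL: "hankel_L1 \<alpha> (F n) \<in> L2 \<alpha>" for n by (rule hankel_L1_L2[OF a F(2,1)])
  have hL: "hankel \<alpha> f \<in> L2 \<alpha>" by (rule hankel_L2[OF a f])
  have le: "rnorm \<alpha> (\<lambda>y. indicator \<Sigma> y * hankel_L1 \<alpha> (F n) y - indicator \<Sigma> y * hankel \<alpha> f y) \<le> rnorm \<alpha> (\<lambda>x. F n x - f x)" for n
  proof -
    have "rnorm \<alpha> (\<lambda>y. indicator \<Sigma> y * hankel_L1 \<alpha> (F n) y - indicator \<Sigma> y * hankel \<alpha> f y) \<le> rnorm \<alpha> (\<lambda>y. hankel_L1 \<alpha> (F n) y - hankel \<alpha> f y)"
      by (rule rnorm_mono[OF L2_diff[OF HFL hL]]) (auto split: split_indicator)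
    thus ?thesis using hankel_L1_approx_norm[OF a f F(1,2)] by simp
  qed
  have lim: "(\<lambda>n. rnorm \<alpha> (\<lambda>y. indicator \<Sigma> y * hankel_L1 \<alpha> (F n) y - indicator \<Sigma> y * hankel \<alpha> f y)) \<longlonglongrightarrow> 0"
    by (rule tendsto_sandwich[OF _ _ tendsto_const F(3)]) (use le in auto)
  have l1: "(\<lambda>n. rnorm \<alpha> (\<lambda>y. indicator \<Sigma> y * hankel_L1 \<alpha> (F n) y)) \<longlonglongrightarrow> rnorm \<alpha> (\<lambda>y. indicator \<Sigma> y * hankel \<alpha> f y)"
    by (rule rnorm_tendsto[OF L2_indicator[OF HFL G] L2_indicator[OF hL G] lim])
  have l2: "(\<lambda>n. c * rnorm \<alpha> (F n)) \<longlonglongrightarrow> c * rnorm \<alpha> f"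
    by (intro tendsto_mult_left rnorm_tendsto F f)
  have bd: "rnorm \<alpha> (\<lambda>y. indicator \<Sigma> y * hankel_L1 \<alpha> (F n) y) \<le> c * rnorm \<alpha> (F n)" for n
    using F by (intro loc) (auto simp: F_def supp)
  show ?thesis by (rule LIMSEQ_le[OF l1 l2]) (use bd in auto)
qed

lemma l2_norm_sq_on_complement:
  assumes "A \<in> sets (mu \<alpha>)" "f \<in> L2 \<alpha>"
  shows "l2_norm_sq_on \<alpha> ({0..} - A) f = ennreal ((rnorm \<alpha> (\<lambda>x. indicator ({0..} - A) x * f x))\<^sup>2)"
proof -
  have D: "{0..} - A \<in> sets (mu \<alpha>)" using sets.compl_sets[OF assms(1)] by simp
  have "l2_norm_sq_on \<alpha> ({0..} - A) f = energy \<alpha> (\<lambda>x. indicator ({0..} - A) x * f x)"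
    unfolding l2_norm_sq_on_def energy_def by (intro nn_integral_cong) (auto split: split_indicator)
  thus ?thesis using energy_eq_rn[OF L2_finite[OF L2_indicator[OF assms(2) D]]] by simp
qed

lemma op_norm_bound:
  assumes S: "S \<in> sets (mu \<alpha>)" and G: "\<Sigma> \<in> sets (mu \<alpha>)" and c: "0 \<le> c" "c < 1"
    and loc: "\<And>f. f \<in> L2 \<alpha> \<Longrightarrow> (\<And>x. x \<notin> S \<Longrightarrow> f x = 0) \<Longrightarrow> rnorm \<alpha> (\<lambda>y. indicator \<Sigma> y * hankel \<alpha> f y) \<le> c * rnorm \<alpha> f"
  shows "op_norm \<alpha> (F_proj \<alpha> \<Sigma> \<circ> E_proj S) < 1"
proof -
  have "l2_norm \<alpha> ((F_proj \<alpha> \<Sigma> \<circ> E_proj S) f) \<le> ennreal c" if f: "f \<in> L2 \<alpha>" "l2_norm \<alpha> f \<le> 1" for f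
  proof -
    have Ef: "E_proj S f \<in> L2 \<alpha>" unfolding E_proj_def by (rule L2_indicator[OF f(1) S])
    have h: "E_proj \<Sigma> (hankel \<alpha> (E_proj S f)) \<in> L2 \<alpha>"
      unfolding E_proj_def[of \<Sigma>] by (rule L2_indicator[OF hankel_L2[OF a Ef] G])
    have r1: "rnorm \<alpha> f \<le> 1" using f(2) unfolding l2_norm_eq_rn[OF L2_finite[OF f(1)]] by simp
    have "rnorm \<alpha> ((F_proj \<alpha> \<Sigma> \<circ> E_proj S) f) = rnorm \<alpha> (E_proj \<Sigma> (hankel \<alpha> (E_proj S f)))"
      unfolding F_proj_def o_def by (rule hankel_norm[OF a h])
    also have "\<dots> \<le> c * rnorm \<alpha> (E_proj S f)"
      unfolding E_proj_def[of \<Sigma>] by (rule loc[OF Ef]) (simp add: E_proj_def)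
    also have "\<dots> \<le> c * 1"
    proof (intro mult_left_mono order_trans[OF _ r1] c)
      show "rnorm \<alpha> (E_proj S f) \<le> rnorm \<alpha> f" unfolding E_proj_def by (rule rnorm_mono[OF f(1)]) (auto split: split_indicator)
    qed
    finally have "rnorm \<alpha> ((F_proj \<alpha> \<Sigma> \<circ> E_proj S) f) \<le> c" by simp
    moreover have "(F_proj \<alpha> \<Sigma> \<circ> E_proj S) f \<in> L2 \<alpha>" unfolding F_proj_def o_def by (rule hankel_L2[OF a h])
    ultimately show ?thesis using l2_norm_eq_rn[OF L2_finite] by (simp add: ennreal_leI)
  qed
  hence "op_norm \<alpha> (F_proj \<alpha> \<Sigma> \<circ> E_proj S) \<le> ennreal c" unfolding op_norm_def by (intro SUP_least) auto
  also have "\<dots> < 1" using c by (simp add: ennreal_less_one_iff)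
  finally show ?thesis .
qed

text \<open>With \<open>N\<close>, \<open>X\<close>, \<open>Y\<close> the norms of \<open>f\<close>, of \<open>f\<close> off \<open>S\<close> and of the transform off \<open>\<Sigma>\<close>, the isometry and the triangle
  inequality give \<open>N \<le> (c N + X) + Y\<close>.\<close>

lemma strong_annihilating_from_localization:
  assumes S: "S \<in> sets (mu \<alpha>)" and G: "\<Sigma> \<in> sets (mu \<alpha>)" and c: "0 \<le> c" "c < 1"
    and loc: "\<And>f. f \<in> L2 \<alpha> \<Longrightarrow> (\<And>x. x \<notin> S \<Longrightarrow> f x = 0) \<Longrightarrow> rnorm \<alpha> (\<lambda>y. indicator \<Sigma> y * hankel \<alpha> f y) \<le> c * rnorm \<alpha> f"
  shows "strong_annihilating \<alpha> S \<Sigma>"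
  unfolding strong_annihilating_def
proof (intro conjI S G exI[of _ "2 / (1 - c)\<^sup>2"] ballI)
  fix f assume f: "f \<in> L2 \<alpha>"
  let ?Sc = "{0..} - S" and ?Gc = "{0..} - \<Sigma>"
  have Sc: "?Sc \<in> sets (mu \<alpha>)" and Gc: "?Gc \<in> sets (mu \<alpha>)" using sets.compl_sets[OF S] sets.compl_sets[OF G] by auto
  define p where "p = (\<lambda>x. indicator S x * f x)"
  define q where "q = (\<lambda>x. indicator ?Sc x * f x)"
  have pL: "p \<in> L2 \<alpha>" and qL: "q \<in> L2 \<alpha>" unfolding p_def q_def by (intro L2_indicator f S Sc)+
  note hL = hankel_L2[OF a f] hankel_L2[OF a pL] hankel_L2[OF a qL]
  have zero: "rnorm \<alpha> (\<lambda>y. (hankel \<alpha> f y - hankel \<alpha> p y) - hankel \<alpha> q y) = 0"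
  proof -
    have "rnorm \<alpha> (\<lambda>x. (f x - p x) - q x) = rnorm \<alpha> (\<lambda>x. 0)"
      unfolding rnorm_def by (rule arg_cong[OF arg_cong[OF energy_cong]]) (auto simp: p_def q_def split: split_indicator)
    thus ?thesis unfolding hankel_diff_norm[OF a f pL qL] by (simp add: rnorm_def energy_def)
  qed
  define X where "X = rnorm \<alpha> q"
  define Y where "Y = rnorm \<alpha> (\<lambda>y. indicator ?Gc y * hankel \<alpha> f y)"
  have r_le: "rnorm \<alpha> (\<lambda>y. indicator D y * g y) \<le> rnorm \<alpha> g" if "g \<in> L2 \<alpha>" for D g
    by (rule rnorm_mono[OF that]) (auto split: split_indicator)
  have sigma: "rnorm \<alpha> (\<lambda>y. indicator \<Sigma> y * hankel \<alpha> f y) \<le> c * rnorm \<alpha> f + X"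
  proof -
    let ?z = "\<lambda>y. (hankel \<alpha> f y - hankel \<alpha> p y) - hankel \<alpha> q y"
    have zL: "?z \<in> L2 \<alpha>" by (intro L2_diff hL)
    have "rnorm \<alpha> (\<lambda>y. indicator \<Sigma> y * hankel \<alpha> f y)
      = rnorm \<alpha> (\<lambda>y. (indicator \<Sigma> y * hankel \<alpha> p y + indicator \<Sigma> y * hankel \<alpha> q y) + indicator \<Sigma> y * ?z y)"
      by (simp add: algebra_simps)
    also have "\<dots> \<le> rnorm \<alpha> (\<lambda>y. indicator \<Sigma> y * hankel \<alpha> p y + indicator \<Sigma> y * hankel \<alpha> q y) + rnorm \<alpha> (\<lambda>y. indicator \<Sigma> y * ?z y)"
      by (intro rnorm_triangle L2_add L2_indicator hL zL G)
    also have "\<dots> \<le> (rnorm \<alpha> (\<lambda>y. indicator \<Sigma> y * hankel \<alpha> p y) + rnorm \<alpha> (\<lambda>y. indicator \<Sigma> y * hankel \<alpha> q y)) + rnorm \<alpha> ?z"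
      by (intro add_mono rnorm_triangle L2_indicator hL G r_le zL)
    also have "\<dots> \<le> (c * rnorm \<alpha> p + rnorm \<alpha> (hankel \<alpha> q)) + 0"
    proof (intro add_mono)
      show "rnorm \<alpha> (\<lambda>y. indicator \<Sigma> y * hankel \<alpha> p y) \<le> c * rnorm \<alpha> p" by (rule loc[OF pL]) (simp add: p_def)
      show "rnorm \<alpha> (\<lambda>y. indicator \<Sigma> y * hankel \<alpha> q y) \<le> rnorm \<alpha> (hankel \<alpha> q)" by (rule r_le[OF hL(3)])
    qed (use zero in simp)
    also have "\<dots> \<le> c * rnorm \<alpha> f + X"
      using mult_left_mono[OF r_le[OF f, of S] c(1)] hankel_norm[OF a qL] by (simp add: p_def X_def)
    finally show ?thesis .
  qed
  have "rnorm \<alpha> f = rnorm \<alpha> (hankel \<alpha> f)" by (rule hankel_norm[OF a f, symmetric])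
  also have "\<dots> = rnorm \<alpha> (\<lambda>y. indicator \<Sigma> y * hankel \<alpha> f y + indicator ?Gc y * hankel \<alpha> f y)"
    unfolding rnorm_def by (rule arg_cong[OF arg_cong[OF energy_cong]]) (auto split: split_indicator)
  also have "\<dots> \<le> rnorm \<alpha> (\<lambda>y. indicator \<Sigma> y * hankel \<alpha> f y) + Y"
    unfolding Y_def by (intro rnorm_triangle L2_indicator hL G Gc)
  also have "\<dots> \<le> c * rnorm \<alpha> f + X + Y" using sigma by simp
  finally have key: "(1 - c) * rnorm \<alpha> f \<le> X + Y" by (simp add: algebra_simps)
  have "((1 - c) * rnorm \<alpha> f)\<^sup>2 \<le> (X + Y)\<^sup>2" using key c by (intro power_mono) auto
  also have "\<dots> \<le> 2 * (X\<^sup>2 + Y\<^sup>2)" using zero_le_power2[of "X - Y"] by (simp add: power2_eq_square algebra_simps)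
  finally have "(1 - c)\<^sup>2 * (rnorm \<alpha> f)\<^sup>2 \<le> 2 * (X\<^sup>2 + Y\<^sup>2)" by (simp add: power_mult_distrib)
  hence main: "(rnorm \<alpha> f)\<^sup>2 \<le> 2 / (1 - c)\<^sup>2 * (X\<^sup>2 + Y\<^sup>2)" using c by (simp add: pos_le_divide_eq mult.commute)
  have "(l2_norm \<alpha> f)\<^sup>2 = ennreal ((rnorm \<alpha> f)\<^sup>2)" unfolding l2_norm_sq by (rule energy_eq_rn[OF L2_finite[OF f]])
  also have "\<dots> \<le> ennreal (2 / (1 - c)\<^sup>2 * (X\<^sup>2 + Y\<^sup>2))" by (rule ennreal_leI[OF main])
  also have "\<dots> = ennreal (2 / (1 - c)\<^sup>2) * (ennreal (X\<^sup>2) + ennreal (Y\<^sup>2))"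
    by (subst ennreal_mult) (auto simp: ennreal_plus)
  also have "\<dots> = ennreal (2 / (1 - c)\<^sup>2) * (l2_norm_sq_on \<alpha> ?Sc f + l2_norm_sq_on \<alpha> ?Gc (hankel \<alpha> f))"
    unfolding l2_norm_sq_on_complement[OF S f] l2_norm_sq_on_complement[OF G hL(1)] X_def Y_def q_def ..
  finally show "(l2_norm \<alpha> f)\<^sup>2 \<le> ennreal (2 / (1 - c)\<^sup>2) * (l2_norm_sq_on \<alpha> ?Sc f + l2_norm_sq_on \<alpha> ?Gc (hankel \<alpha> f))" .
qed

end

theorem corollary3p5:
  fixes \<alpha> a b :: real
  assumes "\<alpha> > -1/2" and "a > 0" and "b > 0"
  shows "\<exists>\<epsilon>\<^sub>0>0. \<forall>\<epsilon> S \<Sigma> S\<^sub>i \<Sigma>\<^sub>i.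
    0 < \<epsilon> \<and> \<epsilon> < \<epsilon>\<^sub>0 \<and>
    S = {0..a} \<union> S\<^sub>i \<and> S\<^sub>i \<subseteq> {a..} \<and> thin \<epsilon> \<alpha> S\<^sub>i \<and>
    \<Sigma> = {0..b} \<union> \<Sigma>\<^sub>i \<and> \<Sigma>\<^sub>i \<subseteq> {b..} \<and> thin \<epsilon> \<alpha> \<Sigma>\<^sub>i \<longrightarrow>
    op_norm \<alpha> (F_proj \<alpha> \<Sigma> \<circ> E_proj S) < 1 \<and> strong_annihilating \<alpha> S \<Sigma>"
proof -
  obtain e0 c where e0: "e0 > 0" and c: "0 \<le> c" "c < 1"
    and L: "\<And>\<epsilon> S\<^sub>i \<Sigma>\<^sub>i u. \<epsilon> < e0 \<Longrightarrow> thin \<epsilon> \<alpha> S\<^sub>i \<Longrightarrow> thin \<epsilon> \<alpha> \<Sigma>\<^sub>i \<Longrightarrow> 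
     integrable (mu \<alpha>) u \<Longrightarrow> u \<in> L2 \<alpha> \<Longrightarrow> (\<forall>x. x \<notin> {0..a} \<union> S\<^sub>i \<longrightarrow> u x = 0) \<Longrightarrow>
     rnorm \<alpha> (\<lambda>y. indicator ({0..b} \<union> \<Sigma>\<^sub>i) y * hankel_L1 \<alpha> u y) \<le> c * rnorm \<alpha> u"
    using localization_L1_L2[OF assms] by blast
  show ?thesis
  proof (intro exI[of _ e0] conjI[OF e0] allI impI)
    fix \<epsilon> S \<Sigma> Si \<Sigma>i
    assume H: "0 < \<epsilon> \<and> \<epsilon> < e0 \<and> S = {0..a} \<union> Si \<and> Si \<subseteq> {a..} \<and> thin \<epsilon> \<alpha> Si \<and>
      \<Sigma> = {0..b} \<union> \<Sigma>i \<and> \<Sigma>i \<subseteq> {b..} \<and> thin \<epsilon> \<alpha> \<Sigma>i"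
    have "Si \<in> sets (mu \<alpha>)" "\<Sigma>i \<in> sets (mu \<alpha>)" using H by (auto simp: thin_def)
    hence S: "S \<in> sets (mu \<alpha>)" and G: "\<Sigma> \<in> sets (mu \<alpha>)"
      using H sets_mu_borel[of "{0..a}" \<alpha>] sets_mu_borel[of "{0..b}" \<alpha>] by auto
    have loc: "rnorm \<alpha> (\<lambda>y. indicator \<Sigma> y * hankel \<alpha> f y) \<le> c * rnorm \<alpha> f"
      if "f \<in> L2 \<alpha>" "\<And>x. x \<notin> S \<Longrightarrow> f x = 0" for f
    proof (rule localization_L2[OF assms(1) S G c(1) _ that])
      fix u assume "integrable (mu \<alpha>) u" "u \<in> L2 \<alpha>" "\<And>x. x \<notin> S \<Longrightarrow> u x = 0"
      thus "rnorm \<alpha> (\<lambda>y. indicator \<Sigma> y * hankel_L1 \<alpha> u y) \<le> c * rnorm \<alpha> u"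
        using L[of \<epsilon> Si \<Sigma>i u] H by blast
    qed
    show "op_norm \<alpha> (F_proj \<alpha> \<Sigma> \<circ> E_proj S) < 1 \<and> strong_annihilating \<alpha> S \<Sigma>"
      using op_norm_bound[OF assms(1) S G c loc] strong_annihilating_from_localization[OF assms(1) S G c loc] by blast
  qed
qed

end
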